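(* Let $0<\alpha<1$, let $\Omega\subset(0,\alpha)$ be a finite set with a probability distribution $\mathbb P=(p_\beta)_{\beta\in\Omega}$, let $\nu=\mathbb P^{\otimes\mathbb N}$ on $\Sigma=\Omega^{\mathbb N}$, and let $\mu$ be the absolutely continuous stationary probability measure of the associated random system of intermittent maps $(T_\beta)_{\beta\in\Omega}$. Let $\varphi\in C^1([0,1])$ with $\mu(\varphi)=0$. Given $p>\max\{1,\frac1\alpha-1\}$, set $\kappa:=\lceil\frac{4p}{1-\alpha}\rceil$. Then there is a constant $C_{\alpha,p,\varphi}$ such that for $\nu$-almost every $\omega\in\Sigma$ there exists $N(\omega)$ such that for each $\epsilon>0$ and all $n\ge N(\omega)$ $$m\Big\{x:\Big|\sum_{j=1}^n\varphi(\mathcal T^j_\omega x)\Big|>4n\epsilon\Big\}\le C_{\alpha,p,\varphi}\,n^{1-\frac1\alpha}(\log n)^{\frac1\alpha}\epsilon^{-\kappa}.$$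
   Context: $m$ is Lebesgue measure on $[0,1]$. For $\beta\in(0,1)$ the intermittent map $T_\beta:[0,1]\to[0,1]$ is $T_\beta(x)=x+2^\beta x^{1+\beta}$ for $0\le x\le 1/2$ and $T_\beta(x)=2x-1$ for $1/2<x\le1$. For $\omega=(\omega_1,\omega_2,\dots)\in\Sigma=\Omega^{\mathbb N}$, $\mathcal T^j_\omega:=T_{\omega_j}\circ\cdots\circ T_{\omega_1}$. A probability measure $\mu$ on $[0,1]$ is stationary if $\mu(A)=\sum_{\beta\in\Omega}p_\beta\,\mu(T_\beta^{-1}A)$ for all Borel $A$. It is known that there is a unique stationary probability measure absolutely continuous with respect to Lebesgue measure; $\mu$ denotes this measure, and $\mu(\varphi)=\int\varphi\,d\mu$. $\lceil x\rceil$ is the smallest integer greater than or equal to $x$. *)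

theory Defs
  imports "HOL-Probability.Probability"
begin

definition unit_lebesgue :: "real measure"
  where "unit_lebesgue = restrict_space lborel {0..1}"

(* The map on [0,1]; its values outside [0,1] play no role. *)
definition intermittent_map :: "real \<Rightarrow> real \<Rightarrow> real"
  where "intermittent_map \<beta> x =
    (if x \<le> 1/2 then x + 2 powr \<beta> * x powr (1 + \<beta>) else 2 * x - 1)"

(* The composition of the maps with parameters w_1, ..., w_j, applied in this order.
   Sequences are indexed from 0 here: the k-th parameter w_k is "\<omega> (k - 1)". *)
primrec orbit :: "(nat \<Rightarrow> real) \<Rightarrow> nat \<Rightarrow> real \<Rightarrow> real"
  where
    "orbit \<omega> 0 x = x"
  | "orbit \<omega> (Suc j) x = intermittent_map (\<omega> j) (orbit \<omega> j x)"

definition prob_weights :: "real set \<Rightarrow> (real \<Rightarrow> real) \<Rightarrow> bool"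
  where "prob_weights \<Omega> P \<longleftrightarrow> finite \<Omega> \<and> (\<forall>\<beta>\<in>\<Omega>. 0 \<le> P \<beta>) \<and> (\<Sum>\<beta>\<in>\<Omega>. P \<beta>) = 1"

(* The product measure on the sequence space; its space is the set of all functions from nat to \<Omega>. *)
definition sequence_measure :: "real set \<Rightarrow> (real \<Rightarrow> real) \<Rightarrow> (nat \<Rightarrow> real) measure"
  where "sequence_measure \<Omega> P = PiM UNIV (\<lambda>_. point_measure \<Omega> (\<lambda>\<beta>. ennreal (P \<beta>)))"

definition stationary :: "real set \<Rightarrow> (real \<Rightarrow> real) \<Rightarrow> real measure \<Rightarrow> bool"
  where "stationary \<Omega> P \<mu> \<longleftrightarrow>
    prob_space \<mu> \<and> sets \<mu> = sets (restrict_space borel {0..1}) \<and>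
    (\<forall>A\<in>sets \<mu>. measure \<mu> A =
      (\<Sum>\<beta>\<in>\<Omega>. P \<beta> * measure \<mu> (intermittent_map \<beta> -` A \<inter> {0..1})))"

definition ac_stationary :: "real set \<Rightarrow> (real \<Rightarrow> real) \<Rightarrow> real measure \<Rightarrow> bool"
  where "ac_stationary \<Omega> P \<mu> \<longleftrightarrow>
    stationary \<Omega> P \<mu> \<and> absolutely_continuous unit_lebesgue \<mu>"

(* Derivatives at the endpoints are one-sided, unlike in C1_differentiable_on. *)
definition C1_unit_interval :: "(real \<Rightarrow> real) \<Rightarrow> bool"
  where "C1_unit_interval \<phi> \<longleftrightarrow>
    (\<exists>\<phi>'. (\<forall>x\<in>{0..1}. (\<phi> has_real_derivative \<phi>' x) (at x within {0..1})) \<and>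
          continuous_on {0..1} \<phi>')"

end

theory Submission
  imports Defs
begin

text \<open>
The loss of memory of the sequential system is proved by averaging over dynamical cylinders, in place of the
random perturbations of Liverani, Saussol and Vaienti. Each branch of each map preserves the decreasing densities
\<open>f\<close> for which \<open>x powr (1 + \<alpha>) * f x\<close> is increasing, and after \<open>n\<close> steps such a density is bounded below by a
constant times its mass outside the leftmost cylinder \<open>[0, x\<^sub>n]\<close>, where \<open>x\<^sub>n = O(n powr (-1/\<alpha>))\<close>. Averaging the
difference of two densities over the \<open>n\<close>-cylinders costs \<open>O(x\<^sub>n powr (1 - \<alpha>))\<close> in \<open>L\<^sup>1\<close>, and its positive and
negative parts are pushed into this class. Hence \<open>2n\<close> steps contract the \<open>L\<^sup>1\<close> distance by a fixed factor up to
that error, and logarithmically many repetitions give the rate \<open>(ln n / n) powr (1/\<alpha> - 1)\<close>, uniformly in the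
sequence of parameters.

A Rio-type inequality for a high even moment turns this rate into the tail bound for the sums centered fibrewise.
The sum of the fibrewise means is at most \<open>n powr (1 - \<theta>)\<close> with \<open>\<theta> = (1/\<alpha> - 1)/\<kappa>\<close> for almost every \<open>\<omega>\<close>, by a
second moment bound and the Borel-Cantelli lemma along \<open>n = l ^ q\<close>; if \<open>\<epsilon>\<close> is below \<open>n powr (-\<theta>)\<close>, the right-hand
side of the claim exceeds \<open>1\<close>.
\<close>

section \<open>Branches and transfer operators\<close>

text \<open>The moment estimate pairs an observable at time j with powers of the sum over later
  times. As functions of the later position these powers have no regularity uniform in the number of
  terms; only their size is controlled. Hence decay must be an L^1 decay of pushed signed densities,
  valid for each word of parameters. Randomness enters only through the sum of fibrewise means,
  which is why the constant depends on \<alpha>, p and \<phi> alone.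

  Densities in the cone may blow up like \<open>x powr - \<alpha>\<close> and so have unbounded
  oscillation; they are cut off before averaging. At height \<open>A * X powr - \<alpha>\<close>,
  with X a bound for the leftmost cylinder, the mass removed and the averaging error are both of
  order \<open>A * X powr (1 - \<alpha>)\<close>.

  The exponents fit as follows, with \<gamma> = 1/\<alpha> - 1. The moment of order 2l + 2 grows
  like n^(2l + 2 - \<gamma>) up to logarithms once l >= 2\<gamma>, and the least such order is below
  4\<gamma> + 4 = 4/\<alpha>, hence below \<kappa>. Since \<theta> * \<kappa> = \<gamma>, the claim
  becomes trivial exactly below \<epsilon> = n^(-\<theta>). The condition on p yields \<theta> <
  min(1, \<gamma>)/4, which is the room that the almost sure bound on the fibrewise means
  consumes.\<close>

lemma bernoulli_powr_ge:
  fixes r u :: real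
  assumes "1 \<le> r" "0 \<le> u"
  shows "1 + r * u \<le> (1 + u) powr r"
proof -
  have "(1 + 0) powr r - r * 0 \<le> (1 + u) powr r - r * u"
  proof (rule DERIV_nonneg_imp_nondecreasing[OF assms(2)])
    fix x :: real assume x: "0 \<le> x" "x \<le> u"
    have "((\<lambda>x. (1 + x) powr r - r * x) has_real_derivative r * (1 + x) powr (r - 1) - r) (at x)"
      using x by (auto intro!: derivative_eq_intros)
    moreover have "1 \<le> (1 + x) powr (r - 1)"
      using x assms by (intro ge_one_powr_ge_zero) auto
    then have "0 \<le> r * (1 + x) powr (r - 1) - r"
      using assms by (simp add: mult_left_le)
    ultimately show "\<exists>y. ((\<lambda>x. (1 + x) powr r - r * x) has_real_derivative y) (at x) \<and> 0 \<le> y"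
      by blast
  qed
  then show ?thesis by simp
qed

text \<open>The preceding inequality for the exponent \<open>1 / r\<close> at the point
  \<open>r * u\<close>, raised to the power \<open>r\<close>.\<close>

lemma bernoulli_powr_le:
  fixes r u :: real
  assumes "0 < r" "r \<le> 1" "0 \<le> u"
  shows "(1 + u) powr r \<le> 1 + r * u"
proof -
  have "1 + (1/r) * (r * u) \<le> (1 + r * u) powr (1/r)"
    using assms by (intro bernoulli_powr_ge) auto
  then have "1 + u \<le> (1 + r * u) powr (1/r)" using assms by simp
  then have "(1 + u) powr r \<le> ((1 + r * u) powr (1/r)) powr r"
    using assms by (intro powr_mono2) auto
  also have "\<dots> = 1 + r * u" using assms by (simp add: powr_powr)
  finally show ?thesis .
qed

section \<open>Lebesgue measure on the unit interval\<close>

abbreviation leb :: "real measure" where "leb \<equiv> unit_lebesgue"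

lemma space_leb [simp]: "space leb = {0..1}"
  by (simp add: unit_lebesgue_def space_restrict_space)

lemma sets_leb: "sets leb = sets (restrict_space borel {0..1})"
  by (simp add: unit_lebesgue_def sets_restrict_space)

lemma measurable_leb_cong: "measurable leb M = measurable (restrict_space borel {0..1}) M"
  by (rule measurable_cong_sets) (simp_all add: sets_leb)

lemma measurable_leb_borel:
  "f \<in> borel_measurable borel \<Longrightarrow> f \<in> borel_measurable leb"
  unfolding measurable_leb_cong by (rule measurable_restrict_space1)

lemma ident_measurable_leb [measurable]: "(\<lambda>x. x) \<in> borel_measurable leb"
  by (rule measurable_leb_borel) simp

lemma measurable_into_leb:
  assumes "f \<in> borel_measurable M" "\<And>x. x \<in> space M \<Longrightarrow> f x \<in> {0..1}"
  shows "f \<in> measurable M leb"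
proof -
  have "f \<in> measurable M (restrict_space borel {0..1})"
    by (rule measurable_restrict_space2) (use assms in auto)
  then show ?thesis
    by (subst measurable_cong_sets[where M'=M and N'="restrict_space borel {0..1}"]) (simp_all add: sets_leb)
qed

lemma sets_leb_interval [measurable]: "A \<in> sets borel \<Longrightarrow> A \<subseteq> {0..1} \<Longrightarrow> A \<in> sets leb"
  by (auto simp: sets_leb sets_restrict_space)

lemma emeasure_leb: "A \<in> sets leb \<Longrightarrow> emeasure leb A = emeasure lborel A"
  unfolding unit_lebesgue_def
  by (subst emeasure_restrict_space) (auto simp: sets_restrict_space)

lemma measure_leb_interval: "0 \<le> a \<Longrightarrow> a \<le> b \<Longrightarrow> b \<le> 1 \<Longrightarrow> measure leb {a..b} = b - a"
  by (simp add: measure_def emeasure_leb sets_leb_interval)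

interpretation leb: prob_space leb
  by (rule prob_spaceI) (simp add: emeasure_leb sets_leb_interval)

lemma integral_leb:
  fixes f :: "real \<Rightarrow> real"
  shows "integral\<^sup>L leb f = (LBINT x:{0..1}. f x)"
  unfolding unit_lebesgue_def set_lebesgue_integral_def by (rule integral_restrict_space) simp

lemma integrable_leb:
  fixes f :: "real \<Rightarrow> real"
  shows "integrable leb f \<longleftrightarrow> set_integrable lborel {0..1} f"
  unfolding unit_lebesgue_def set_integrable_def by (rule integrable_restrict_space) simp

lemma borel_measurable_leb_iff:
  fixes f :: "real \<Rightarrow> real"
  shows "f \<in> borel_measurable leb \<longleftrightarrow> (\<lambda>x. indicator {0..1} x * f x) \<in> borel_measurable borel"
proof -
  have "(borel_measurable lborel :: (real \<Rightarrow> real) set) = borel_measurable borel"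
    by (rule measurable_cong_sets) simp_all
  then show ?thesis
    unfolding unit_lebesgue_def
    by (subst borel_measurable_restrict_space_iff) (simp_all only: real_scaleR_def, simp)
qed

lemma nn_integral_leb: "nn_integral leb f = (\<integral>\<^sup>+x. f x * indicator {0..1} x \<partial>lborel)"
  unfolding unit_lebesgue_def by (rule nn_integral_restrict_space) simp

lemma AE_leb: "(AE x in leb. P x) \<longleftrightarrow> (AE x in lborel. x \<in> {0..1} \<longrightarrow> P x)"
  unfolding unit_lebesgue_def by (subst AE_restrict_space_iff) auto

lemma AE_leb_pos: "AE x in leb. 0 < x"
proof -
  have "AE x in lborel. x \<noteq> (0::real)" by (rule AE_lborel_singleton)
  then show ?thesis unfolding AE_leb by eventually_elim auto
qed

section \<open>The left branch and its inverse\<close>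

definition left_inv :: "real \<Rightarrow> real \<Rightarrow> real"
  where "left_inv \<beta> = the_inv_into {0..1/2} (intermittent_map \<beta>)"

text \<open>With t = (2x)^\<beta>, which runs through [0,1] on the left half, the branch is x(1 + t)
  and its derivative is 1 + (1 + \<beta>)t. Most estimates on the left branch thereby become
  inequalities in t.\<close>

lemma intermittent_left:
  assumes "0 \<le> x" "x \<le> 1/2"
  shows "intermittent_map \<beta> x = x * (1 + (2 * x) powr \<beta>)"
  using assms by (simp add: intermittent_map_def powr_add powr_mult algebra_simps)

lemma intermittent_in: "0 < \<beta> \<Longrightarrow> x \<in> {0..1} \<Longrightarrow> intermittent_map \<beta> x \<in> {0..1}"
proof (cases "x \<le> 1/2")
  case True
  assume b: "0 < \<beta>" "x \<in> {0..1}"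
  have "(2 * x) powr \<beta> \<le> 1 powr \<beta>" using b True by (intro powr_mono2) auto
  then have "x * (1 + (2 * x) powr \<beta>) \<le> (1/2) * (1 + 1)"
    using True b by (intro mult_mono) auto
  then show ?thesis using True b by (subst intermittent_left) auto
qed (auto simp: intermittent_map_def)

lemma intermittent_strict_mono:
  assumes "0 < \<beta>" "0 \<le> x" "x < y" "y \<le> 1/2"
  shows "intermittent_map \<beta> x < intermittent_map \<beta> y"
proof -
  have "(2 * x) powr \<beta> \<le> (2 * y) powr \<beta>" using assms by (intro powr_mono2) auto
  then have "x * (1 + (2 * x) powr \<beta>) < y * (1 + (2 * y) powr \<beta>)"
    using assms by (intro mult_less_le_imp_less) (auto simp: add_pos_nonneg)
  then show ?thesis using assms by (simp add: intermittent_left)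
qed

lemma intermittent_image:
  assumes "0 < \<beta>"
  shows "intermittent_map \<beta> ` {0..1/2} = {0..1}"
proof
  show "intermittent_map \<beta> ` {0..1/2} \<subseteq> {0..1}" using intermittent_in[OF assms] by auto
  show "{0..1} \<subseteq> intermittent_map \<beta> ` {0..1/2}"
  proof
    fix y :: real assume y: "y \<in> {0..1}"
    have "continuous_on {0..1/2} (\<lambda>x::real. x * (1 + (2 * x) powr \<beta>))"
      using assms by (intro continuous_intros continuous_on_powr') auto
    then have "\<exists>x\<ge>0. x \<le> 1/2 \<and> x * (1 + (2 * x) powr \<beta>) = y"
      using y by (intro IVT') auto
    then show "y \<in> intermittent_map \<beta> ` {0..1/2}" by (force simp: intermittent_left image_iff)
  qed
qed

lemma intermittent_inj: "0 < \<beta> \<Longrightarrow> inj_on (intermittent_map \<beta>) {0..1/2}"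
  using intermittent_strict_mono[of \<beta>] by (intro linorder_inj_onI') (force simp: not_less)+

lemma left_inv_intermittent: "0 < \<beta> \<Longrightarrow> x \<in> {0..1/2} \<Longrightarrow> left_inv \<beta> (intermittent_map \<beta> x) = x"
  unfolding left_inv_def by (rule the_inv_into_f_f[OF intermittent_inj])

lemma intermittent_left_inv: "0 < \<beta> \<Longrightarrow> x \<in> {0..1} \<Longrightarrow> intermittent_map \<beta> (left_inv \<beta> x) = x"
  unfolding left_inv_def by (rule f_the_inv_into_f[OF intermittent_inj]) (simp_all add: intermittent_image)

lemma left_inv_in: "0 < \<beta> \<Longrightarrow> x \<in> {0..1} \<Longrightarrow> left_inv \<beta> x \<in> {0..1/2}"
  unfolding left_inv_def by (rule the_inv_into_into[OF intermittent_inj]) (simp_all add: intermittent_image)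

lemma left_inv_less:
  assumes "0 < \<beta>" "0 \<le> x" "x < y" "y \<le> 1"
  shows "left_inv \<beta> x < left_inv \<beta> y"
proof (rule ccontr)
  assume "\<not> ?thesis"
  then have le: "left_inv \<beta> y \<le> left_inv \<beta> x" by simp
  have "intermittent_map \<beta> (left_inv \<beta> y) \<le> intermittent_map \<beta> (left_inv \<beta> x)"
    using le intermittent_strict_mono[of \<beta> "left_inv \<beta> y" "left_inv \<beta> x"] left_inv_in[of \<beta> x] left_inv_in[of \<beta> y] assms
    by (cases "left_inv \<beta> y = left_inv \<beta> x") auto
  then show False using assms by (simp add: intermittent_left_inv)
qed

lemma left_inv_mono: "0 < \<beta> \<Longrightarrow> 0 \<le> x \<Longrightarrow> x \<le> y \<Longrightarrow> y \<le> 1 \<Longrightarrow> left_inv \<beta> x \<le> left_inv \<beta> y"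
  using left_inv_less[of \<beta> x y] by (cases "x = y") auto

lemma left_inv_0 [simp]: "0 < \<beta> \<Longrightarrow> left_inv \<beta> 0 = 0"
  using left_inv_intermittent[of \<beta> 0] by (simp add: intermittent_map_def)

lemma left_inv_1 [simp]: "0 < \<beta> \<Longrightarrow> left_inv \<beta> 1 = 1/2"
  using left_inv_intermittent[of \<beta> "1/2"] by (simp add: intermittent_left)

lemma left_inv_pos: "0 < \<beta> \<Longrightarrow> 0 < x \<Longrightarrow> x \<le> 1 \<Longrightarrow> 0 < left_inv \<beta> x"
  using left_inv_less[of \<beta> 0 x] by simp

lemma left_inv_eq:
  assumes "0 < \<beta>" "x \<in> {0..1}"
  shows "left_inv \<beta> x * (1 + (2 * left_inv \<beta> x) powr \<beta>) = x"
  using intermittent_left_inv[OF assms] left_inv_in[OF assms] by (simp add: intermittent_left)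

lemma left_inv_measurable: "0 < \<beta> \<Longrightarrow> left_inv \<beta> \<in> measurable leb leb"
proof (rule measurable_into_leb)
  assume b: "0 < \<beta>"
  show "left_inv \<beta> \<in> borel_measurable leb"
    unfolding measurable_leb_cong
    by (rule borel_measurable_mono_on_fnc) (use b in \<open>auto intro!: mono_onI left_inv_mono\<close>)
  show "left_inv \<beta> x \<in> {0..1}" if "x \<in> space leb" for x
    using left_inv_in[OF b, of x] that by auto
qed

lemma right_inv_measurable: "(\<lambda>x. (1 + x) / 2) \<in> measurable leb leb"
  by (rule measurable_into_leb) auto

lemma intermittent_measurable_borel [measurable]: "intermittent_map \<beta> \<in> borel_measurable borel"
  unfolding intermittent_map_def[abs_def] by measurable

lemma intermittent_measurable: "0 < \<beta> \<Longrightarrow> intermittent_map \<beta> \<in> measurable leb leb"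
  by (rule measurable_into_leb) (use intermittent_in in auto)

section \<open>Transfer operators of the branches\<close>

definition transfer_left :: "real \<Rightarrow> (real \<Rightarrow> real) \<Rightarrow> real \<Rightarrow> real"
  where "transfer_left \<beta> f x = f (left_inv \<beta> x) / (1 + (1 + \<beta>) * (2 * left_inv \<beta> x) powr \<beta>)"

definition transfer_right :: "(real \<Rightarrow> real) \<Rightarrow> real \<Rightarrow> real"
  where "transfer_right f x = f ((1 + x) / 2) / 2"

text \<open>The Perron-Frobenius operator with respect to Lebesgue measure; each summand divides by
  the derivative of its branch at the preimage. The summands have names of their own because
  cylinders are words of branches, and the later recursions follow each branch separately.\<close>

definition transfer :: "real \<Rightarrow> (real \<Rightarrow> real) \<Rightarrow> real \<Rightarrow> real"
  where "transfer \<beta> f x = transfer_left \<beta> f x + transfer_right f x"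

lemma transfer_left_measurable:
  assumes "0 < \<beta>" "f \<in> borel_measurable leb"
  shows "transfer_left \<beta> f \<in> borel_measurable leb"
proof -
  have L: "left_inv \<beta> \<in> borel_measurable leb"
    using measurable_compose[OF left_inv_measurable[OF assms(1)] ident_measurable_leb] by simp
  have "(\<lambda>x. f (left_inv \<beta> x)) \<in> borel_measurable leb"
    by (rule measurable_compose[OF left_inv_measurable[OF assms(1)] assms(2)])
  with L show ?thesis unfolding transfer_left_def[abs_def] by measurable
qed

text \<open>The absolute value extends the branch to an odd function, which has a two-sided
  derivative at the endpoint 0, as the substitution rules demand. At 0 the derivative comes from
  Caratheodory's criterion, since \<open>powr\<close> cannot be differentiated there.\<close>

lemma left_branch_deriv:
  assumes "0 < \<beta>" "0 \<le> x"
  shows "((\<lambda>y. y * (1 + (2 * \<bar>y\<bar>) powr \<beta>)) has_real_derivative 1 + (1 + \<beta>) * (2 * x) powr \<beta>) (at x)"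
proof (cases "x = 0")
  case True
  have "continuous_on UNIV (\<lambda>y::real. 1 + (2 * \<bar>y\<bar>) powr \<beta>)"
    using assms by (intro continuous_intros continuous_on_powr') auto
  then have "isCont (\<lambda>y::real. 1 + (2 * \<bar>y\<bar>) powr \<beta>) 0"
    by (simp add: continuous_on_eq_continuous_at)
  then have "((\<lambda>y. y * (1 + (2 * \<bar>y\<bar>) powr \<beta>)) has_real_derivative (1 + (2 * \<bar>0\<bar>) powr \<beta>)) (at 0)"
    by (intro CARAT_DERIV[THEN iffD2] exI[of _ "\<lambda>y. 1 + (2 * \<bar>y\<bar>) powr \<beta>"]) auto
  then show ?thesis using True by simp
next
  case False
  then have x: "x > 0" using assms by simp
  have e: "x * (\<beta> * (2 * x) powr (\<beta> - 1) * 2) = \<beta> * (2 * x) powr \<beta>"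
    using x by (simp add: powr_diff)
  have "((\<lambda>y. y * (1 + (2 * y) powr \<beta>)) has_real_derivative 1 + (1 + \<beta>) * (2 * x) powr \<beta>) (at x)"
    by (rule derivative_eq_intros refl | use x e in \<open>simp add: algebra_simps\<close>)+
  then show ?thesis
  proof (rule has_field_derivative_transform_within[where d=x])
    fix y assume "dist y x < x"
    then have "y > 0" by (auto simp: dist_real_def abs_if split: if_splits)
    then show "y * (1 + (2 * y) powr \<beta>) = y * (1 + (2 * \<bar>y\<bar>) powr \<beta>)" by simp
  qed (use x in auto)
qed

text \<open>Substitution along the left branch, in two forms: the second one presupposes that
  \<open>transfer_left \<beta> f\<close> is integrable, and this is derived afterwards from the
  first form applied to the absolute value of \<open>f\<close>.\<close>

lemma transfer_left_subst:
  assumes b: "0 < \<beta>" and f: "f \<in> borel_measurable leb"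
  shows nn_integral_transfer_left: "(\<integral>\<^sup>+x. ennreal (transfer_left \<beta> f x) \<partial>leb) = (\<integral>\<^sup>+x. ennreal (indicator {0..1/2} x * f x) \<partial>leb)"
    and "integrable leb f \<Longrightarrow> integrable leb (transfer_left \<beta> f) \<Longrightarrow>
      (\<integral>x. transfer_left \<beta> f x \<partial>leb) = (\<integral>x. indicator {0..1/2} x * f x \<partial>leb)"
proof -
  define g where "g = (\<lambda>y::real. y * (1 + (2 * \<bar>y\<bar>) powr \<beta>))"
  define g' where "g' = (\<lambda>x::real. 1 + (1 + \<beta>) * (2 * x) powr \<beta>)"
  have g0: "g 0 = 0" "g (1/2) = 1" by (auto simp: g_def)
  have pos: "0 < g' x" if "x \<in> {0..1/2}" for x
    using b that by (auto simp: g'_def intro!: add_pos_nonneg)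
  have gf: "transfer_left \<beta> f (g x) * g' x = f x" if "x \<in> {0..1/2}" for x
  proof -
    have "g x = intermittent_map \<beta> x" using that by (simp add: g_def intermittent_left)
    then have "left_inv \<beta> (g x) = x" using left_inv_intermittent[OF b that] by simp
    then show ?thesis using pos[OF that] by (simp add: transfer_left_def g'_def)
  qed
  have meas: "set_borel_measurable borel {g 0..g (1/2)} (transfer_left \<beta> f)"
    using transfer_left_measurable[OF b f] unfolding set_borel_measurable_def g0 borel_measurable_leb_iff real_scaleR_def .
  have cont: "continuous_on {0..1/2} g'"
    unfolding g'_def using b by (intro continuous_intros continuous_on_powr') auto
  have der: "(g has_real_derivative g' x) (at x)" if "x \<in> {0..1/2}" for x
    unfolding g_def g'_def using that by (intro left_branch_deriv b) auto
  have "(\<integral>\<^sup>+x. ennreal (transfer_left \<beta> f x) \<partial>leb) = (\<integral>\<^sup>+x. ennreal (transfer_left \<beta> f x) * indicator {g 0..g (1/2)} x \<partial>lborel)"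
    by (simp add: nn_integral_leb g0)
  also have "\<dots> = (\<integral>\<^sup>+x. ennreal (transfer_left \<beta> f x * indicator {g 0..g (1/2)} x) \<partial>lborel)"
    by (intro nn_integral_cong) (auto split: split_indicator)
  also have "\<dots> = (\<integral>\<^sup>+x. ennreal (transfer_left \<beta> f (g x) * g' x * indicator {0..1/2} x) \<partial>lborel)"
    by (rule nn_integral_substitution[OF meas der cont]) (use pos in \<open>auto intro: less_imp_le\<close>)
  also have "\<dots> = (\<integral>\<^sup>+x. ennreal (indicator {0..1/2} x * f x) \<partial>leb)"
    unfolding nn_integral_leb by (intro nn_integral_cong) (auto simp: gf split: split_indicator)
  finally show "(\<integral>\<^sup>+x. ennreal (transfer_left \<beta> f x) \<partial>leb) = (\<integral>\<^sup>+x. ennreal (indicator {0..1/2} x * f x) \<partial>leb)" .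
  assume i: "integrable leb f" "integrable leb (transfer_left \<beta> f)"
  have "(\<integral>x. transfer_left \<beta> f x \<partial>leb) = (LBINT x. transfer_left \<beta> f x * indicator {g 0..g (1/2)} x)"
    by (simp add: integral_leb set_lebesgue_integral_def g0 mult.commute)
  also have "\<dots> = (LBINT x. transfer_left \<beta> f (g x) * g' x * indicator {0..1/2} x)"
    by (rule integral_substitution[OF _ der cont])
      (use pos i in \<open>auto intro: less_imp_le simp: g0 integrable_leb\<close>)
  also have "\<dots> = (\<integral>x. indicator {0..1/2} x * f x \<partial>leb)"
    unfolding integral_leb set_lebesgue_integral_def
    by (intro Bochner_Integration.integral_cong) (auto simp: gf split: split_indicator)
  finally show "(\<integral>x. transfer_left \<beta> f x \<partial>leb) = (\<integral>x. indicator {0..1/2} x * f x \<partial>leb)" .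
qed

lemma transfer_left_integral:
  assumes b: "0 < \<beta>" and i: "integrable leb f"
  shows transfer_left_integrable: "integrable leb (transfer_left \<beta> f)"
    and integral_transfer_left: "(\<integral>x. transfer_left \<beta> f x \<partial>leb) = (\<integral>x. indicator {0..1/2} x * f x \<partial>leb)"
proof -
  have f: "f \<in> borel_measurable leb" using i by simp
  have "(\<integral>\<^sup>+x. ennreal \<bar>transfer_left \<beta> f x\<bar> \<partial>leb) = (\<integral>\<^sup>+x. ennreal (transfer_left \<beta> (\<lambda>x. \<bar>f x\<bar>) x) \<partial>leb)"
  proof (intro nn_integral_cong)
    fix x assume "x \<in> space leb"
    then have "0 < 1 + (1 + \<beta>) * (2 * left_inv \<beta> x) powr \<beta>"
      using b left_inv_in[OF b, of x] by (auto intro!: add_pos_nonneg)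
    then show "ennreal \<bar>transfer_left \<beta> f x\<bar> = ennreal (transfer_left \<beta> (\<lambda>x. \<bar>f x\<bar>) x)"
      by (simp add: transfer_left_def abs_divide)
  qed
  also have "\<dots> = (\<integral>\<^sup>+x. ennreal (indicator {0..1/2} x * \<bar>f x\<bar>) \<partial>leb)"
    using f by (intro nn_integral_transfer_left b) simp
  also have "\<dots> \<le> (\<integral>\<^sup>+x. ennreal \<bar>f x\<bar> \<partial>leb)"
    by (intro nn_integral_mono) (auto split: split_indicator)
  also have "\<dots> < \<infinity>" using i by (simp add: integrable_iff_bounded)
  finally show I: "integrable leb (transfer_left \<beta> f)"
    using transfer_left_measurable[OF b f] by (simp add: integrable_iff_bounded)
  show "(\<integral>x. transfer_left \<beta> f x \<partial>leb) = (\<integral>x. indicator {0..1/2} x * f x \<partial>leb)"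
    by (rule transfer_left_subst(2)[OF b f i I])
qed

lemma transfer_right_integral:
  assumes i: "integrable leb f"
  shows transfer_right_integrable: "integrable leb (transfer_right f)"
    and integral_transfer_right: "(\<integral>x. transfer_right f x \<partial>leb) = (\<integral>x. indicator {1/2..1} x * f x \<partial>leb)"
proof -
  define h where "h = (\<lambda>x. indicator {1/2..1} x * f x :: real)"
  have h1: "(\<lambda>x. indicator {0..1} x * h x) = h"
    by (auto simp: h_def fun_eq_iff split: split_indicator)
  have h: "integrable lborel h"
  proof -
    have "integrable leb (\<lambda>x. f x * indicator {1/2..1} x)"
      using i by (intro integrable_real_mult_indicator sets_leb_interval) auto
    then have "integrable lborel (\<lambda>x. indicator {0..1} x * h x)"
      unfolding integrable_leb set_integrable_def h_def by (simp add: mult.commute)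
    then show ?thesis unfolding h1 .
  qed
  have e: "(\<lambda>x. h (1/2 + (1/2) * x)) = (\<lambda>x. indicator {0..1} x * f ((1 + x) / 2))"
    by (auto simp: h_def fun_eq_iff field_simps split: split_indicator)
  have "integrable lborel (\<lambda>x. h (1/2 + (1/2) * x))"
    by (rule lborel_integrable_real_affine[OF h]) simp
  then show "integrable leb (transfer_right f)"
    unfolding e integrable_leb set_integrable_def transfer_right_def by simp
  have "(LBINT x. h x) = \<bar>1/2\<bar> *\<^sub>R (LBINT x. h (1/2 + (1/2) * x))"
    by (rule lborel_integral_real_affine) simp
  also have "\<dots> = (\<integral>x. transfer_right f x \<partial>leb)"
    unfolding e integral_leb set_lebesgue_integral_def transfer_right_def by simp
  finally have "(\<integral>x. transfer_right f x \<partial>leb) = (LBINT x. h x)" by simp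
  also have "\<dots> = (LBINT x. indicator {0..1} x * h x)" unfolding h1 ..
  also have "\<dots> = (\<integral>x. indicator {1/2..1} x * f x \<partial>leb)"
    unfolding integral_leb set_lebesgue_integral_def h_def by simp
  finally show "(\<integral>x. transfer_right f x \<partial>leb) = (\<integral>x. indicator {1/2..1} x * f x \<partial>leb)" .
qed

lemma integrable_leb_indicator:
  fixes f :: "real \<Rightarrow> real"
  assumes "integrable leb f" "A \<in> sets borel"
  shows "integrable leb (\<lambda>x. indicator A x * f x)"
proof (rule Bochner_Integration.integrable_bound[OF assms(1)])
  have "(indicator A :: real \<Rightarrow> real) \<in> borel_measurable leb"
    using assms by (intro measurable_leb_borel) simp
  then show "(\<lambda>x. indicator A x * f x) \<in> borel_measurable leb"
    using assms by measurable
qed (auto split: split_indicator)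

lemma integral_leb_mono:
  fixes f g :: "real \<Rightarrow> real"
  assumes "integrable leb f" "integrable leb g" "\<And>x. 0 < x \<Longrightarrow> x \<le> 1 \<Longrightarrow> f x \<le> g x"
  shows "(\<integral>x. f x \<partial>leb) \<le> (\<integral>x. g x \<partial>leb)"
proof (rule integral_mono_AE[OF assms(1,2)])
  show "AE x in leb. f x \<le> g x"
    using AE_leb_pos AE_space by eventually_elim (use assms(3) in auto)
qed

lemma integral_leb_cong:
  fixes f g :: "real \<Rightarrow> real"
  assumes "f \<in> borel_measurable leb" "g \<in> borel_measurable leb" "\<And>x. 0 < x \<Longrightarrow> x \<le> 1 \<Longrightarrow> f x = g x"
  shows "(\<integral>x. f x \<partial>leb) = (\<integral>x. g x \<partial>leb)"
proof (rule integral_cong_AE[OF assms(1,2)])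
  show "AE x in leb. f x = g x"
    using AE_leb_pos AE_space by eventually_elim (use assms(3) in auto)
qed

lemma integral_leb_indicator: "0 \<le> y \<Longrightarrow> y \<le> 1 \<Longrightarrow> (\<integral>x. indicator {0..y} x * c \<partial>leb) = y * c"
  using measure_leb_interval[of 0 y] by (simp add: Int_absorb2)

lemma transfer_integrable: "0 < \<beta> \<Longrightarrow> integrable leb f \<Longrightarrow> integrable leb (transfer \<beta> f)"
  unfolding transfer_def[abs_def]
  by (intro Bochner_Integration.integrable_add transfer_left_integrable transfer_right_integrable)

lemma integral_split_half:
  fixes f :: "real \<Rightarrow> real"
  assumes "integrable leb f"
  shows "(\<integral>x. f x \<partial>leb) = (\<integral>x. indicator {0..1/2} x * f x \<partial>leb) + (\<integral>x. indicator {1/2..1} x * f x \<partial>leb)"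
proof -
  note i = integrable_leb_indicator[OF assms]
  have "AE x in lborel. x \<noteq> (1/2::real)" by (rule AE_lborel_singleton)
  then have "AE x in leb. f x = indicator {0..1/2} x * f x + indicator {1/2..1} x * f x"
    unfolding AE_leb by eventually_elim (auto split: split_indicator)
  then have "(\<integral>x. f x \<partial>leb) = (\<integral>x. indicator {0..1/2} x * f x + indicator {1/2..1} x * f x \<partial>leb)"
    by (rule integral_cong_AE[rotated 2]) (use assms i in auto)
  then show ?thesis using i by simp
qed

lemma integral_transfer: "0 < \<beta> \<Longrightarrow> integrable leb f \<Longrightarrow> (\<integral>x. transfer \<beta> f x \<partial>leb) = (\<integral>x. f x \<partial>leb)"
  unfolding transfer_def
  by (simp add: transfer_left_integrable transfer_right_integrable integral_transfer_left
      integral_transfer_right integral_split_half[symmetric])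

text \<open>Both inverse branches are right inverses of the map, so \<open>g\<close> comes out of
  the operator. The point 0 is left out: its right preimage 1/2 belongs to the left branch, which
  sends it to 1.\<close>

lemma transfer_mult:
  assumes "0 < \<beta>" "0 < x" "x \<le> 1"
  shows "transfer \<beta> (\<lambda>y. f y * g (intermittent_map \<beta> y)) x = transfer \<beta> f x * g x"
proof -
  have "intermittent_map \<beta> ((1 + x) / 2) = x" using assms by (simp add: intermittent_map_def field_simps)
  moreover have "intermittent_map \<beta> (left_inv \<beta> x) = x" using assms by (intro intermittent_left_inv) auto
  ultimately show ?thesis by (simp add: transfer_def transfer_left_def transfer_right_def algebra_simps)
qed

lemma integrable_mult_bounded:
  fixes f g :: "real \<Rightarrow> real"
  assumes "integrable leb f" "g \<in> borel_measurable leb" "\<And>x. x \<in> {0..1} \<Longrightarrow> \<bar>g x\<bar> \<le> B"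
  shows "integrable leb (\<lambda>x. f x * g x)"
proof (rule Bochner_Integration.integrable_bound)
  show "integrable leb (\<lambda>x. B * f x)" using assms by simp
  show "(\<lambda>x. f x * g x) \<in> borel_measurable leb" using assms by measurable
  have "norm (f x * g x) \<le> norm (B * f x)" if "x \<in> {0..1}" for x
    using mult_right_mono[OF assms(3)[OF that], of "\<bar>f x\<bar>"] assms(3)[OF that]
    by (simp add: abs_mult mult.commute)
  then show "AE x in leb. norm (f x * g x) \<le> norm (B * f x)" by (intro AE_I2) auto
qed

text \<open>Conservation of mass for \<open>f * (g o T)\<close>, followed by pulling
  \<open>g\<close> out with \<open>transfer_mult\<close>.\<close>

lemma transfer_dual:
  assumes b: "0 < \<beta>" and i: "integrable leb f" and g: "g \<in> borel_measurable leb"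
    and B: "\<And>x. x \<in> {0..1} \<Longrightarrow> \<bar>g x\<bar> \<le> B"
  shows "(\<integral>x. transfer \<beta> f x * g x \<partial>leb) = (\<integral>x. f x * g (intermittent_map \<beta> x) \<partial>leb)"
proof -
  have gT: "(\<lambda>x. g (intermittent_map \<beta> x)) \<in> borel_measurable leb"
    by (rule measurable_compose[OF intermittent_measurable[OF b] g])
  have i2: "integrable leb (\<lambda>x. f x * g (intermittent_map \<beta> x))"
    by (rule integrable_mult_bounded[OF i gT B]) (use intermittent_in[OF b] in auto)
  have "(\<integral>x. f x * g (intermittent_map \<beta> x) \<partial>leb) = (\<integral>x. transfer \<beta> (\<lambda>y. f y * g (intermittent_map \<beta> y)) x \<partial>leb)"
    by (rule integral_transfer[OF b i2, symmetric])
  also have "\<dots> = (\<integral>x. transfer \<beta> f x * g x \<partial>leb)"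
    by (rule integral_leb_cong)
      (use transfer_integrable[OF b i2] transfer_integrable[OF b i] g transfer_mult[OF b] in auto)
  finally show ?thesis ..
qed

lemma transfer_left_nonneg:
  assumes "0 < \<beta>" "\<And>x. x \<in> {0..1} \<Longrightarrow> 0 \<le> f x" "x \<in> {0..1}"
  shows "0 \<le> transfer_left \<beta> f x"
  using assms left_inv_in[of \<beta> x] by (auto simp: transfer_left_def intro!: divide_nonneg_nonneg)

lemma transfer_right_nonneg:
  assumes "\<And>x. x \<in> {0..1} \<Longrightarrow> 0 \<le> f x" "x \<in> {0..1}"
  shows "0 \<le> transfer_right f x"
  using assms by (auto simp: transfer_right_def)

text \<open>The inverse branch is increasing, so it carries [0,y] to an initial interval. Iterated,
  this tracks the mass of the leftmost cylinder.\<close>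

lemma transfer_left_head:
  assumes b: "0 < \<beta>" and i: "integrable leb f" and y: "0 \<le> y" "y \<le> 1"
  shows "(\<integral>x. indicator {0..y} x * transfer_left \<beta> f x \<partial>leb) = (\<integral>x. indicator {0..left_inv \<beta> y} x * f x \<partial>leb)"
proof -
  have Ly: "left_inv \<beta> y \<in> {0..1/2}" using left_inv_in[OF b] y by auto
  have "(\<integral>x. indicator {0..y} x * transfer_left \<beta> f x \<partial>leb) = (\<integral>x. transfer_left \<beta> (\<lambda>z. indicator {0..left_inv \<beta> y} z * f z) x \<partial>leb)"
  proof (rule Bochner_Integration.integral_cong)
    fix x assume "x \<in> space leb"
    then have "left_inv \<beta> x \<in> {0..left_inv \<beta> y} \<longleftrightarrow> x \<in> {0..y}"
      using left_inv_in[OF b, of x] left_inv_mono[OF b, of x y] left_inv_less[OF b, of y x] y by force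
    then show "indicator {0..y} x * transfer_left \<beta> f x = transfer_left \<beta> (\<lambda>z. indicator {0..left_inv \<beta> y} z * f z) x"
      by (auto simp: transfer_left_def split: split_indicator)
  qed simp
  also have "\<dots> = (\<integral>x. indicator {0..1/2} x * (indicator {0..left_inv \<beta> y} x * f x) \<partial>leb)"
    by (rule integral_transfer_left[OF b integrable_leb_indicator[OF i]]) simp
  also have "\<dots> = (\<integral>x. indicator {0..left_inv \<beta> y} x * f x \<partial>leb)"
    by (rule Bochner_Integration.integral_cong) (use Ly in \<open>auto split: split_indicator\<close>)
  finally show ?thesis .
qed

text \<open>The cones of Liverani, Saussol and Vaienti; the values at \<open>0\<close> are only required to be nonnegative.\<close>

definition regular_density :: "real \<Rightarrow> (real \<Rightarrow> real) \<Rightarrow> bool"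
  where "regular_density \<alpha> f \<longleftrightarrow> integrable leb f \<and> (\<forall>x\<in>{0..1}. 0 \<le> f x) \<and>
    (\<forall>x y. 0 < x \<longrightarrow> x \<le> y \<longrightarrow> y \<le> 1 \<longrightarrow> f y \<le> f x \<and> x powr (1 + \<alpha>) * f x \<le> y powr (1 + \<alpha>) * f y)"

text \<open>The mass condition is what makes the pointwise bound invariant: through the left branch
  the bound improves by \<open>(1 - \<alpha>) / 2 * A\<close>, and the right branch adds at most the
  total mass.\<close>

definition density_cone :: "real \<Rightarrow> real \<Rightarrow> (real \<Rightarrow> real) \<Rightarrow> bool"
  where "density_cone \<alpha> A f \<longleftrightarrow> regular_density \<alpha> f \<and> (\<forall>x. 0 < x \<longrightarrow> x \<le> 1 \<longrightarrow> f x \<le> A * x powr - \<alpha>) \<and>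
    (\<integral>x. f x \<partial>leb) \<le> (1 - \<alpha>) / 2 * A"

lemma regular_densityD:
  assumes "regular_density \<alpha> f"
  shows "integrable leb f" "x \<in> {0..1} \<Longrightarrow> 0 \<le> f x"
    "0 < x \<Longrightarrow> x \<le> y \<Longrightarrow> y \<le> 1 \<Longrightarrow> f y \<le> f x"
    "0 < x \<Longrightarrow> x \<le> y \<Longrightarrow> y \<le> 1 \<Longrightarrow> x powr (1 + \<alpha>) * f x \<le> y powr (1 + \<alpha>) * f y"
  using assms unfolding regular_density_def by blast+

lemma regular_density_add: "regular_density \<alpha> f \<Longrightarrow> regular_density \<alpha> g \<Longrightarrow> regular_density \<alpha> (\<lambda>x. f x + g x)"
  unfolding regular_density_def by (auto simp: algebra_simps intro: add_mono)

lemma regular_density_cmult: "regular_density \<alpha> f \<Longrightarrow> 0 \<le> c \<Longrightarrow> regular_density \<alpha> (\<lambda>x. c * f x)"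
  unfolding regular_density_def
  by (auto simp: mult.left_commute[of _ c] intro!: mult_left_mono)

lemma regular_density_const: "0 < \<alpha> \<Longrightarrow> 0 \<le> c \<Longrightarrow> regular_density \<alpha> (\<lambda>x. c)"
  unfolding regular_density_def by (auto intro!: mult_right_mono powr_mono2)

text \<open>If s = (2u)^\<beta> at the left preimage u of x, then x = u(1 + s), and x^(1+\<alpha>)
  times \<open>transfer_left \<beta> f x\<close> is u^(1+\<alpha>) f(u) times this quotient; so
  monotonicity of the quotient is the invariance of the second cone condition. The growth of the
  denominator is at most q^(1+\<beta>) by Bernoulli, hence at most q^(1+\<alpha>), because q >= 1
  and \<beta> <= \<alpha>.\<close>

lemma distortion_mono:
  fixes s t :: real
  assumes "0 < \<beta>" "\<beta> \<le> \<alpha>" "0 \<le> s" "s \<le> t"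
  shows "(1 + s) powr (1 + \<alpha>) / (1 + (1 + \<beta>) * s) \<le> (1 + t) powr (1 + \<alpha>) / (1 + (1 + \<beta>) * t)"
proof -
  define q where "q = (1 + t) / (1 + s)"
  have q: "1 \<le> q" "1 + t = (1 + s) * q" "q = 1 + (t - s) / (1 + s)"
    using assms by (auto simp: q_def field_simps)
  have p: "0 < 1 + (1 + \<beta>) * s" "0 < 1 + (1 + \<beta>) * t"
    using assms by (auto intro!: add_pos_nonneg)
  have "(1 + (1 + \<beta>) * t) / (1 + (1 + \<beta>) * s) = 1 + (1 + \<beta>) * (t - s) / (1 + (1 + \<beta>) * s)"
    using p by (simp add: field_simps)
  also have "\<dots> \<le> 1 + (1 + \<beta>) * ((t - s) / (1 + s))"
  proof -
    have "1 + s \<le> 1 + (1 + \<beta>) * s" using assms by (simp add: algebra_simps)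
    then have "(1 + \<beta>) * (t - s) / (1 + (1 + \<beta>) * s) \<le> (1 + \<beta>) * (t - s) / (1 + s)"
      using assms by (intro divide_left_mono) (auto intro!: mult_nonneg_nonneg mult_pos_pos add_pos_nonneg)
    then show ?thesis by simp
  qed
  also have "\<dots> \<le> q powr (1 + \<beta>)"
    unfolding q(3) using assms by (intro bernoulli_powr_ge) auto
  also have "\<dots> \<le> q powr (1 + \<alpha>)" using assms q by (intro powr_mono) auto
  finally have "(1 + (1 + \<beta>) * t) / (1 + (1 + \<beta>) * s) \<le> q powr (1 + \<alpha>)" .
  then have "(1 + s) powr (1 + \<alpha>) * ((1 + (1 + \<beta>) * t) / (1 + (1 + \<beta>) * s)) \<le> (1 + s) powr (1 + \<alpha>) * q powr (1 + \<alpha>)"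
    by (intro mult_left_mono) auto
  also have "\<dots> = (1 + t) powr (1 + \<alpha>)" using assms q by (simp add: powr_mult)
  finally show ?thesis using p by (simp add: divide_simps mult.commute)
qed

lemma regular_density_transfer_left:
  assumes f: "regular_density \<alpha> f" and b: "0 < \<beta>" "\<beta> \<le> \<alpha>"
  shows "regular_density \<alpha> (transfer_left \<beta> f)"
  unfolding regular_density_def
proof (intro conjI allI impI ballI)
  note fD = regular_densityD[OF f]
  show "integrable leb (transfer_left \<beta> f)" by (rule transfer_left_integrable[OF b(1) fD(1)])
  show "0 \<le> transfer_left \<beta> f x" if "x \<in> {0..1}" for x
    by (rule transfer_left_nonneg[OF b(1) fD(2) that])
  fix x y :: real assume xy: "0 < x" "x \<le> y" "y \<le> 1"
  define u v where "u = left_inv \<beta> x" and "v = left_inv \<beta> y"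
  define s t where "s = (2 * u) powr \<beta>" and "t = (2 * v) powr \<beta>"
  have uv: "0 < u" "u \<le> v" "v \<le> 1/2"
    using left_inv_pos[of \<beta> x] left_inv_mono[of \<beta> x y] left_inv_in[of \<beta> y] xy b by (auto simp: u_def v_def)
  have st: "0 \<le> s" "s \<le> t"
    using uv b by (auto simp: s_def t_def intro!: powr_mono2)
  have x: "x = u * (1 + s)" and y: "y = v * (1 + t)"
    using left_inv_eq[OF b(1), of x] left_inv_eq[OF b(1), of y] xy by (auto simp: u_def v_def s_def t_def)
  have xp: "x powr (1 + \<alpha>) = u powr (1 + \<alpha>) * (1 + s) powr (1 + \<alpha>)"
    "y powr (1 + \<alpha>) = v powr (1 + \<alpha>) * (1 + t) powr (1 + \<alpha>)"
    unfolding x y using uv st by (simp_all add: powr_mult)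
  have p: "0 < 1 + (1 + \<beta>) * s" "1 + (1 + \<beta>) * s \<le> 1 + (1 + \<beta>) * t"
    using b st by (auto intro!: add_pos_nonneg mult_left_mono)
  have e: "transfer_left \<beta> f x = f u / (1 + (1 + \<beta>) * s)" "transfer_left \<beta> f y = f v / (1 + (1 + \<beta>) * t)"
    by (auto simp: transfer_left_def u_def v_def s_def t_def)
  show "transfer_left \<beta> f y \<le> transfer_left \<beta> f x"
    unfolding e using p uv fD(2)[of v] fD(2)[of u] fD(3)[of u v] by (intro frac_le) auto
  have D: "(1 + s) powr (1 + \<alpha>) / (1 + (1 + \<beta>) * s) \<le> (1 + t) powr (1 + \<alpha>) / (1 + (1 + \<beta>) * t)"
    using distortion_mono[OF b st] .
  have "x powr (1 + \<alpha>) * transfer_left \<beta> f x = (u powr (1 + \<alpha>) * f u) * ((1 + s) powr (1 + \<alpha>) / (1 + (1 + \<beta>) * s))"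
    unfolding e xp by simp
  also have "\<dots> \<le> (v powr (1 + \<alpha>) * f v) * ((1 + t) powr (1 + \<alpha>) / (1 + (1 + \<beta>) * t))"
    using uv p fD(2)[of v] by (intro mult_mono[OF fD(4)[of u v] D]) auto
  also have "\<dots> = y powr (1 + \<alpha>) * transfer_left \<beta> f y"
    unfolding e xp by simp
  finally show "x powr (1 + \<alpha>) * transfer_left \<beta> f x \<le> y powr (1 + \<alpha>) * transfer_left \<beta> f y" .
qed

text \<open>For the preimage u = (1 + x)/2 the ratio x/u increases with x, so replacing
  u^(1+\<alpha>) by x^(1+\<alpha>) keeps the product increasing.\<close>

lemma regular_density_transfer_right:
  assumes f: "regular_density \<alpha> f" and a: "0 < \<alpha>"
  shows "regular_density \<alpha> (transfer_right f)"
  unfolding regular_density_def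
proof (intro conjI allI impI ballI)
  note fD = regular_densityD[OF f]
  show "integrable leb (transfer_right f)" by (rule transfer_right_integrable[OF fD(1)])
  show "0 \<le> transfer_right f x" if "x \<in> {0..1}" for x
    by (rule transfer_right_nonneg[OF fD(2) that])
  fix x y :: real assume xy: "0 < x" "x \<le> y" "y \<le> 1"
  define u v where "u = (1 + x) / 2" and "v = (1 + y) / 2"
  have uv: "0 < u" "u \<le> v" "v \<le> 1" using xy by (auto simp: u_def v_def)
  show "transfer_right f y \<le> transfer_right f x"
    using fD(3)[of u v] uv by (simp add: transfer_right_def u_def v_def)
  have "x * v \<le> y * u" using xy by (simp add: u_def v_def field_simps)
  then have "x / u \<le> y / v" using uv by (simp add: field_simps)
  then have D: "(x / u) powr (1 + \<alpha>) \<le> (y / v) powr (1 + \<alpha>)"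
    using xy uv a by (intro powr_mono2) auto
  have "x powr (1 + \<alpha>) * transfer_right f x = (u powr (1 + \<alpha>) * f u) * (x / u) powr (1 + \<alpha>) / 2"
    using xy uv by (simp add: transfer_right_def u_def[symmetric] powr_divide)
  also have "\<dots> \<le> (v powr (1 + \<alpha>) * f v) * (y / v) powr (1 + \<alpha>) / 2"
    using uv fD(2)[of v] by (intro divide_right_mono mult_mono[OF fD(4)[of u v] D]) auto
  also have "\<dots> = y powr (1 + \<alpha>) * transfer_right f y"
    using xy uv by (simp add: transfer_right_def v_def[symmetric] powr_divide)
  finally show "x powr (1 + \<alpha>) * transfer_right f x \<le> y powr (1 + \<alpha>) * transfer_right f y" .
qed

lemma regular_density_transfer:
  assumes "regular_density \<alpha> f" "0 < \<beta>" "\<beta> \<le> \<alpha>"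
  shows "regular_density \<alpha> (transfer \<beta> f)"
  unfolding transfer_def[abs_def]
  using assms by (intro regular_density_add regular_density_transfer_left regular_density_transfer_right) auto

text \<open>A decreasing density is at least \<open>f x\<close> on (0,x].\<close>

lemma regular_density_le_mass:
  assumes f: "regular_density \<alpha> f" and x: "0 < x" "x \<le> 1"
  shows "x * f x \<le> (\<integral>x. f x \<partial>leb)"
proof -
  note fD = regular_densityD[OF f]
  have "x * f x = (\<integral>y. indicator {0..x} y * f x \<partial>leb)" using x by (simp only: integral_leb_indicator less_imp_le)
  also have "\<dots> \<le> (\<integral>y. f y \<partial>leb)"
    by (rule integral_leb_mono[OF integrable_leb_indicator[of "\<lambda>_. f x"]])
      (use fD x in \<open>auto split: split_indicator\<close>)
  finally show ?thesis .
qed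

text \<open>In terms of t = (2u)^\<beta>, the left branch multiplies the bound A x^(-\<alpha>) by (1
  + t)^\<alpha> / (1 + (1 + \<beta>)t) <= 1 - (1 - \<alpha>)t/2. Since x^(-\<alpha>) t >= 1, the
  gain is at least (1 - \<alpha>)A/2, just what the right branch can add.\<close>

lemma density_cone_transfer:
  assumes f: "density_cone \<alpha> A f" and b: "0 < \<beta>" "\<beta> \<le> \<alpha>" and a: "\<alpha> < 1"
  shows "density_cone \<alpha> A (transfer \<beta> f)"
proof -
  have reg: "regular_density \<alpha> f" and le: "\<And>x. 0 < x \<Longrightarrow> x \<le> 1 \<Longrightarrow> f x \<le> A * x powr - \<alpha>"
    and mass: "(\<integral>x. f x \<partial>leb) \<le> (1 - \<alpha>) / 2 * A" using f by (auto simp: density_cone_def)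
  note fD = regular_densityD[OF reg]
  have A: "0 \<le> A" using order_trans[OF fD(2)[of 1] le[of 1]] by simp
  have "transfer \<beta> f x \<le> A * x powr - \<alpha>" if x: "0 < x" "x \<le> 1" for x
  proof -
    define u where "u = left_inv \<beta> x"
    define t where "t = (2 * u) powr \<beta>"
    have u: "0 < u" "u \<le> 1/2" using left_inv_pos[OF b(1) x] left_inv_in[OF b(1), of x] x by (auto simp: u_def)
    have t: "0 < t" "t \<le> 1" using u b powr_mono2[of \<beta> "2 * u" 1] by (auto simp: t_def)
    have xu: "x = u * (1 + t)" using left_inv_eq[OF b(1), of x] x by (simp add: u_def t_def)
    \<comment> \<open>The gain has to be measured against x^\<alpha>: from x <= 2u and \<beta> <=
      \<alpha> one gets x^\<alpha> <= x^\<beta> <= t.\<close>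
    have "x \<le> 2 * u" using mult_left_mono[of "1 + t" 2 u] t u xu by auto
    then have "x powr \<beta> \<le> t" unfolding t_def using b x by (intro powr_mono2) auto
    moreover have "x powr \<alpha> \<le> x powr \<beta>" using x b by (intro powr_mono') auto
    ultimately have "x powr \<alpha> \<le> t" by simp
    then have xt: "1 \<le> x powr - \<alpha> * t" using x by (simp add: powr_minus field_simps)
    have ux: "u powr - \<alpha> = x powr - \<alpha> * (1 + t) powr \<alpha>"
      unfolding xu using u t by (simp add: powr_mult powr_minus)
    have B: "(1 + t) powr \<alpha> \<le> 1 + \<alpha> * t" using t a b by (intro bernoulli_powr_le) auto
    have "(1 + t) powr \<alpha> / (1 + (1 + \<beta>) * t) \<le> (1 + \<alpha> * t) / (1 + t)"
      using B t b by (intro frac_le) (auto simp: algebra_simps)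
    also have "\<dots> \<le> 1 - (1 - \<alpha>) / 2 * t"
    proof -
      have "(1 - \<alpha>) * t * (1 + t) \<le> (1 - \<alpha>) * t * 2" using t a by (intro mult_left_mono) auto
      then show ?thesis using t by (simp add: field_simps)
    qed
    finally have R: "(1 + t) powr \<alpha> / (1 + (1 + \<beta>) * t) \<le> 1 - (1 - \<alpha>) / 2 * t" .
    have "transfer_left \<beta> f x = f u / (1 + (1 + \<beta>) * t)"
      by (simp add: transfer_left_def u_def t_def)
    also have "\<dots> \<le> A * u powr - \<alpha> / (1 + (1 + \<beta>) * t)"
      using le[of u] u t b by (intro divide_right_mono) auto
    also have "\<dots> = A * x powr - \<alpha> * ((1 + t) powr \<alpha> / (1 + (1 + \<beta>) * t))"
      unfolding ux by simp
    also have "\<dots> \<le> A * x powr - \<alpha> * (1 - (1 - \<alpha>) / 2 * t)"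
      using R A by (intro mult_left_mono) auto
    also have "\<dots> = A * x powr - \<alpha> - (1 - \<alpha>) / 2 * A * (x powr - \<alpha> * t)" by (simp add: algebra_simps)
    also have "\<dots> \<le> A * x powr - \<alpha> - (1 - \<alpha>) / 2 * A * 1"
      using xt A a by (intro diff_left_mono mult_left_mono) auto
    finally have L: "transfer_left \<beta> f x \<le> A * x powr - \<alpha> - (1 - \<alpha>) / 2 * A" by simp
    \<comment> \<open>The right preimage v is at least 1/2, so f(v)/2 <= v f(v), which is at most
      the mass.\<close>
    have "f ((1 + x) / 2) / 2 \<le> (1 + x) / 2 * f ((1 + x) / 2)"
      using x fD(2)[of "(1+x)/2"] by (simp add: field_simps)
    also have "\<dots> \<le> (\<integral>x. f x \<partial>leb)" using x by (intro regular_density_le_mass[OF reg]) auto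
    finally have "transfer_right f x \<le> (1 - \<alpha>) / 2 * A" using mass by (simp add: transfer_right_def)
    with L show ?thesis by (simp add: transfer_def)
  qed
  then show ?thesis
    unfolding density_cone_def
    using regular_density_transfer[OF reg b] mass integral_transfer[OF b(1) fD(1)] by auto
qed

text \<open>The pointwise bound integrated over [0,y]; the comparison runs through nonnegative
  integrals, where x^(-\<alpha>) can be evaluated directly from its \<open>has_integral\<close>
  statement.\<close>

lemma density_cone_head:
  assumes f: "density_cone \<alpha> A f" and a: "0 < \<alpha>" "\<alpha> < 1" and y: "0 \<le> y" "y \<le> 1"
  shows "(\<integral>x. indicator {0..y} x * f x \<partial>leb) \<le> A * (y powr (1 - \<alpha>) / (1 - \<alpha>))"
proof -
  have reg: "regular_density \<alpha> f" and le: "\<And>x. 0 < x \<Longrightarrow> x \<le> 1 \<Longrightarrow> f x \<le> A * x powr - \<alpha>"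
    using f by (auto simp: density_cone_def)
  note fD = regular_densityD[OF reg]
  have A: "0 \<le> A" using order_trans[OF fD(2)[of 1] le[of 1]] by simp
  have I: "((\<lambda>x. A * x powr - \<alpha>) has_integral A * (y powr (1 - \<alpha>) / (1 - \<alpha>))) {0..y}"
    using has_integral_powr_from_0[of "- \<alpha>" y] a y by (intro has_integral_mult_right) simp_all
  have "ennreal (\<integral>x. indicator {0..y} x * f x \<partial>leb) = (\<integral>\<^sup>+x. ennreal (indicator {0..y} x * f x) \<partial>leb)"
    by (rule nn_integral_eq_integral[symmetric])
      (use fD y in \<open>auto intro!: integrable_leb_indicator AE_I2 split: split_indicator\<close>)
  also have "\<dots> \<le> (\<integral>\<^sup>+x. ennreal (A * x powr - \<alpha>) * indicator {0..y} x \<partial>leb)"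
  proof (rule nn_integral_mono_AE)
    show "AE x in leb. ennreal (indicator {0..y} x * f x) \<le> ennreal (A * x powr - \<alpha>) * indicator {0..y} x"
      using AE_leb_pos AE_space by eventually_elim (use le in \<open>auto split: split_indicator intro!: ennreal_leI\<close>)
  qed
  also have "\<dots> = (\<integral>\<^sup>+x. ennreal (A * x powr - \<alpha>) * indicator {0..y} x \<partial>lborel)"
    unfolding nn_integral_leb by (intro nn_integral_cong) (use y in \<open>auto split: split_indicator\<close>)
  also have "\<dots> = ennreal (A * (y powr (1 - \<alpha>) / (1 - \<alpha>)))"
    by (rule nn_integral_has_integral_lebesgue'[OF _ I]) (use A in auto)
  finally show ?thesis using A a by (simp add: ennreal_le_iff)
qed

text \<open>If [0,y] carries at most half of the mass, then beyond y, where f <= f(y), lies the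
  other half, so f(y) is at least half the mass. The increasing function x^(1+\<alpha>) f(x)
  transports this to the point 1, and f >= f(1).\<close>

lemma density_cone_lower:
  assumes f: "density_cone \<alpha> A f" and a: "0 < \<alpha>" "\<alpha> < 1" and y: "0 < y" "y \<le> 1"
    and small: "A * (y powr (1 - \<alpha>) / (1 - \<alpha>)) \<le> (\<integral>x. f x \<partial>leb) / 2" and x: "0 < x" "x \<le> 1"
  shows "y powr (1 + \<alpha>) * ((\<integral>x. f x \<partial>leb) / 2) \<le> f x"
proof -
  have reg: "regular_density \<alpha> f" using f by (auto simp: density_cone_def)
  note fD = regular_densityD[OF reg]
  have iy: "integrable leb (\<lambda>x. indicator {0..y} x * f x)"
    using fD by (intro integrable_leb_indicator) auto
  have "(\<integral>x. f x \<partial>leb) \<le> (\<integral>x. indicator {0..y} x * f x + f y \<partial>leb)"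
    by (rule integral_leb_mono) (use fD iy y in \<open>auto split: split_indicator\<close>)
  also have "\<dots> = (\<integral>x. indicator {0..y} x * f x \<partial>leb) + f y"
    using iy leb.prob_space by simp
  also have "\<dots> \<le> (\<integral>x. f x \<partial>leb) / 2 + f y"
    using order_trans[OF density_cone_head[OF f a, of y] small] y by simp
  finally have "(\<integral>x. f x \<partial>leb) / 2 \<le> f y" by simp
  then have "y powr (1 + \<alpha>) * ((\<integral>x. f x \<partial>leb) / 2) \<le> y powr (1 + \<alpha>) * f y" by (intro mult_left_mono) auto
  also have "\<dots> \<le> f 1" using fD(4)[of y 1] y by simp
  also have "\<dots> \<le> f x" using fD(3)[of x 1] x by simp
  finally show ?thesis .
qed

section \<open>Compositions of transfer operators\<close>

lemma transfer_left_linear: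
  "transfer_left \<beta> (\<lambda>x. f x + g x) = (\<lambda>x. transfer_left \<beta> f x + transfer_left \<beta> g x)"
  "transfer_left \<beta> (\<lambda>x. f x - g x) = (\<lambda>x. transfer_left \<beta> f x - transfer_left \<beta> g x)"
  "transfer_left \<beta> (\<lambda>x. - f x) = (\<lambda>x. - transfer_left \<beta> f x)"
  "transfer_left \<beta> (\<lambda>x. c * f x) = (\<lambda>x. c * transfer_left \<beta> f x)"
  by (auto simp: transfer_left_def fun_eq_iff add_divide_distrib diff_divide_distrib)

lemma transfer_right_linear:
  "transfer_right (\<lambda>x. f x + g x) = (\<lambda>x. transfer_right f x + transfer_right g x)"
  "transfer_right (\<lambda>x. f x - g x) = (\<lambda>x. transfer_right f x - transfer_right g x)"
  "transfer_right (\<lambda>x. - f x) = (\<lambda>x. - transfer_right f x)"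
  "transfer_right (\<lambda>x. c * f x) = (\<lambda>x. c * transfer_right f x)"
  by (auto simp: transfer_right_def fun_eq_iff add_divide_distrib diff_divide_distrib)

lemma transfer_linear:
  "transfer \<beta> (\<lambda>x. f x + g x) = (\<lambda>x. transfer \<beta> f x + transfer \<beta> g x)"
  "transfer \<beta> (\<lambda>x. f x - g x) = (\<lambda>x. transfer \<beta> f x - transfer \<beta> g x)"
  "transfer \<beta> (\<lambda>x. c * f x) = (\<lambda>x. c * transfer \<beta> f x)"
  by (auto simp: transfer_def transfer_left_linear transfer_right_linear fun_eq_iff algebra_simps)

definition push :: "real list \<Rightarrow> (real \<Rightarrow> real) \<Rightarrow> real \<Rightarrow> real"
  where "push bs f = fold transfer bs f"

lemma push_simps [simp]:
  "push [] f = f" "push (b # bs) f = push bs (transfer b f)" "push (as @ bs) f = push bs (push as f)"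
  by (simp_all add: push_def)

lemma push_linear:
  "push bs (\<lambda>x. f x + g x) = (\<lambda>x. push bs f x + push bs g x)"
  "push bs (\<lambda>x. f x - g x) = (\<lambda>x. push bs f x - push bs g x)"
  "push bs (\<lambda>x. c * f x) = (\<lambda>x. c * push bs f x)"
  by (induction bs arbitrary: f g) (simp_all add: transfer_linear)

lemma push_integral:
  assumes "set bs \<subseteq> {0<..}" "integrable leb f"
  shows push_integrable: "integrable leb (push bs f)"
    and integral_push: "(\<integral>x. push bs f x \<partial>leb) = (\<integral>x. f x \<partial>leb)"
  using assms by (induction bs arbitrary: f) (auto simp: transfer_integrable integral_transfer)

text \<open>The half-open interval is mapped into itself by both inverse branches. Pointwise
  comparisons are made only there, because the cone conditions give no upper bound at 0.\<close>

lemma transfer_mono: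
  assumes "0 < \<beta>" "\<And>x. x \<in> {0<..1} \<Longrightarrow> f x \<le> g x" "x \<in> {0<..1}"
  shows "transfer \<beta> f x \<le> transfer \<beta> g x"
proof -
  have "left_inv \<beta> x \<in> {0<..1}" using left_inv_pos[of \<beta> x] left_inv_in[of \<beta> x] assms by auto
  moreover have "(1 + x) / 2 \<in> {0<..1}" using assms by auto
  moreover have "0 < 1 + (1 + \<beta>) * (2 * left_inv \<beta> x) powr \<beta>"
    using assms by (intro add_pos_nonneg) auto
  ultimately show ?thesis using assms(2)
    by (auto simp: transfer_def transfer_left_def transfer_right_def intro!: add_mono divide_right_mono)
qed

lemma push_mono:
  assumes "set bs \<subseteq> {0<..}" "\<And>x. x \<in> {0<..1} \<Longrightarrow> f x \<le> g x" "x \<in> {0<..1}"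
  shows "push bs f x \<le> push bs g x"
  using assms(1,2)
proof (induction bs arbitrary: f g)
  case (Cons b bs)
  have "transfer b f z \<le> transfer b g z" if "z \<in> {0<..1}" for z
    using Cons.prems that by (intro transfer_mono) auto
  then show ?case using Cons.IH[of "transfer b f" "transfer b g"] Cons.prems(1) by simp
qed (use assms(3) in simp)

lemma push_abs:
  assumes "set bs \<subseteq> {0<..}" "x \<in> {0<..1}"
  shows "\<bar>push bs f x\<bar> \<le> push bs (\<lambda>x. \<bar>f x\<bar>) x"
proof -
  have "push bs f x \<le> push bs (\<lambda>x. \<bar>f x\<bar>) x" by (rule push_mono[OF assms(1) _ assms(2)]) auto
  moreover have "push bs (\<lambda>x. - 1 * f x) x \<le> push bs (\<lambda>x. \<bar>f x\<bar>) x"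
    by (rule push_mono[OF assms(1) _ assms(2)]) auto
  ultimately show ?thesis unfolding push_linear by auto
qed

lemma push_contraction:
  assumes "set bs \<subseteq> {0<..}" "integrable leb f"
  shows "(\<integral>x. \<bar>push bs f x\<bar> \<partial>leb) \<le> (\<integral>x. \<bar>f x\<bar> \<partial>leb)"
proof -
  have "(\<integral>x. \<bar>push bs f x\<bar> \<partial>leb) \<le> (\<integral>x. push bs (\<lambda>x. \<bar>f x\<bar>) x \<partial>leb)"
    using assms by (intro integral_leb_mono push_abs push_integrable integrable_abs) auto
  also have "\<dots> = (\<integral>x. \<bar>f x\<bar> \<partial>leb)" using assms by (intro integral_push) auto
  finally show ?thesis .
qed

lemma fold_intermittent_measurable: "set bs \<subseteq> {0<..} \<Longrightarrow> fold intermittent_map bs \<in> measurable leb leb"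
  by (induction bs) (auto intro!: measurable_compose[OF intermittent_measurable] simp: o_def)

lemma fold_intermittent_in: "set bs \<subseteq> {0<..} \<Longrightarrow> x \<in> {0..1} \<Longrightarrow> fold intermittent_map bs x \<in> {0..1}"
  using measurable_space[OF fold_intermittent_measurable, of bs x] by simp

text \<open>Serves in \<open>sequential_moment\<close> to turn an estimate known along orbits into
  one at every point of the interval.\<close>

lemma fold_intermittent_surj: "set bs \<subseteq> {0<..} \<Longrightarrow> y \<in> {0..1} \<Longrightarrow> \<exists>x\<in>{0..1}. fold intermittent_map bs x = y"
proof (induction bs)
  case (Cons b bs)
  then obtain z where z: "z \<in> {0..1}" "fold intermittent_map bs z = y" by auto
  then obtain x where "x \<in> {0..1/2}" "intermittent_map b x = z"
    using intermittent_image[of b] Cons.prems by (metis imageE insert_subset list.simps(15) greaterThan_iff)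
  with z show ?case by (intro bexI[of _ x]) auto
qed auto

lemma push_dual:
  assumes "set bs \<subseteq> {0<..}" "integrable leb f" "g \<in> borel_measurable leb" "\<And>x. x \<in> {0..1} \<Longrightarrow> \<bar>g x\<bar> \<le> B"
  shows "(\<integral>x. push bs f x * g x \<partial>leb) = (\<integral>x. f x * g (fold intermittent_map bs x) \<partial>leb)"
  using assms
proof (induction bs arbitrary: f)
  case (Cons b bs)
  have b: "0 < b" using Cons.prems by auto
  have bs: "set bs \<subseteq> {0<..}" using Cons.prems by auto
  note m = fold_intermittent_measurable[OF bs] and inv = fold_intermittent_in[OF bs]
  have "(\<integral>x. push (b # bs) f x * g x \<partial>leb) = (\<integral>x. transfer b f x * g (fold intermittent_map bs x) \<partial>leb)"
    using Cons.IH[of "transfer b f"] Cons.prems transfer_integrable[OF b] by simp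
  also have "\<dots> = (\<integral>x. f x * g (fold intermittent_map bs (intermittent_map b x)) \<partial>leb)"
    by (rule transfer_dual[OF b Cons.prems(2) measurable_compose[OF m Cons.prems(3)], where B=B])
      (use Cons.prems(4) inv in auto)
  finally show ?case by simp
qed simp

lemma positive_parameters: "set bs \<subseteq> {0<..\<alpha>} \<Longrightarrow> set bs \<subseteq> {0<..}" for \<alpha> :: real
  by auto

lemma density_cone_push:
  assumes "density_cone \<alpha> A f" "set bs \<subseteq> {0<..\<alpha>}" "\<alpha> < 1"
  shows "density_cone \<alpha> A (push bs f)"
  using assms by (induction bs arbitrary: f) (auto simp: density_cone_transfer)

section \<open>Uniform lower bounds and the leftmost cylinder\<close>

lemma density_cone_one:
  assumes "0 < \<alpha>" "\<alpha> < 1"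
  shows "density_cone \<alpha> (2 / (1 - \<alpha>)) (\<lambda>x. 1)"
  unfolding density_cone_def
proof (intro conjI allI impI)
  show "regular_density \<alpha> (\<lambda>x. 1)" using assms by (intro regular_density_const) auto
  show "1 \<le> 2 / (1 - \<alpha>) * x powr - \<alpha>" if "0 < x" "x \<le> 1" for x
  proof -
    have "1 * 1 \<le> 2 / (1 - \<alpha>) * x powr - \<alpha>"
      using assms that powr_mono2'[of "- \<alpha>" x 1] by (intro mult_mono) auto
    then show ?thesis by simp
  qed
  show "(\<integral>x. 1 \<partial>leb) \<le> (1 - \<alpha>) / 2 * (2 / (1 - \<alpha>))" using assms leb.prob_space by simp
qed

text \<open>This is y^(1+\<alpha>)/2 for the y with y^(1-\<alpha>) = (1 - \<alpha>)^2/4. For mass 1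
  and \<open>A = 2 / (1 - \<alpha>)\<close>, the scale of the constant density, this y makes the
  head bound of \<open>density_cone_head\<close> equal to 1/2, as \<open>density_cone_lower\<close>
  requires.\<close>

definition lower_const :: "real \<Rightarrow> real"
  where "lower_const \<alpha> = ((1 - \<alpha>)\<^sup>2 / 4) powr ((1 + \<alpha>) / (1 - \<alpha>)) / 2"

lemma lower_const_pos: "0 < \<alpha> \<Longrightarrow> \<alpha> < 1 \<Longrightarrow> 0 < lower_const \<alpha>"
  by (simp add: lower_const_def)

lemma push_one_lower:
  assumes a: "0 < \<alpha>" "\<alpha> < 1" and bs: "set bs \<subseteq> {0<..\<alpha>}" and x: "x \<in> {0<..1}"
  shows "lower_const \<alpha> \<le> push bs (\<lambda>x. 1) x"
proof -
  define q where "q = (1 - \<alpha>)\<^sup>2 / 4"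
  define y where "y = q powr (1 / (1 - \<alpha>))"
  have q: "0 < q" "q \<le> 1"
    using a power_le_one[of "1 - \<alpha>" 2] by (auto simp: q_def)
  have y: "0 < y" "y \<le> 1" using q a by (auto simp: y_def intro: powr_le1)
  have m: "(\<integral>x. push bs (\<lambda>x. 1) x \<partial>leb) = 1"
    using integral_push[OF positive_parameters[OF bs], of "\<lambda>x. 1"] leb.prob_space by simp
  have "y powr (1 - \<alpha>) = q" using a q by (simp add: y_def powr_powr)
  then have "2 / (1 - \<alpha>) * (y powr (1 - \<alpha>) / (1 - \<alpha>)) = 1 / 2"
    using a by (simp add: q_def power2_eq_square)
  then have "y powr (1 + \<alpha>) * (1 / 2) \<le> push bs (\<lambda>x. 1) x"
    using density_cone_lower[OF density_cone_push[OF density_cone_one[OF a] bs a(2)] a y, of x] x m by simp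
  then show ?thesis using a q by (simp add: lower_const_def y_def powr_powr q_def)
qed

text \<open>Right end of the leftmost cylinder, the set of points whose successive images all use
  the left branch. The first parameter acts first on points, hence last among the inverse
  branches.\<close>

primrec left_end :: "real list \<Rightarrow> real"
  where "left_end [] = 1" | "left_end (b # bs) = left_inv b (left_end bs)"

lemma left_end_in: "set bs \<subseteq> {0<..} \<Longrightarrow> 0 < left_end bs \<and> left_end bs \<le> 1"
proof (induction bs)
  case (Cons b bs)
  then show ?case using left_inv_pos[of b "left_end bs"] left_inv_in[of b "left_end bs"] by auto
qed simp

text \<open>The factor \<open>(1/2) powr (1 + \<alpha>)\<close> is paid at the first visit to the
  right branch, where the density is replaced by a constant; \<open>lower_const\<close> bounds the
  later images of that constant.\<close>

definition doeblin_const :: "real \<Rightarrow> real"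
  where "doeblin_const \<alpha> = lower_const \<alpha> * (1/2) powr (1 + \<alpha>)"

text \<open>The right branch sees only [1/2,1], where the two monotonicity conditions force f(1) >=
  2^(-(1+\<alpha>)) f(1/2).\<close>

lemma transfer_right_lower:
  assumes f: "regular_density \<alpha> f" and x: "x \<in> {0<..1}"
  shows "(1/2) powr (1 + \<alpha>) * (\<integral>x. transfer_right f x \<partial>leb) \<le> transfer_right f x"
proof -
  note fD = regular_densityD[OF f]
  have "(\<integral>x. transfer_right f x \<partial>leb) \<le> (\<integral>x. f (1/2) / 2 \<partial>leb)"
    by (rule integral_leb_mono[OF transfer_right_integrable[OF fD(1)]])
      (use fD(3)[of "1/2"] in \<open>auto simp: transfer_right_def\<close>)
  also have "\<dots> = f (1/2) / 2" using leb.prob_space by simp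
  finally have "(1/2) powr (1 + \<alpha>) * (\<integral>x. transfer_right f x \<partial>leb) \<le> (1/2) powr (1 + \<alpha>) * (f (1/2) / 2)"
    by (intro mult_left_mono) auto
  also have "\<dots> \<le> f 1 / 2" using fD(4)[of "1/2" 1] by simp
  also have "\<dots> \<le> transfer_right f x" using fD(3)[of "(1 + x)/2" 1] x by (simp add: transfer_right_def)
  finally show ?thesis .
qed

text \<open>The first visit to the right branch makes a density comparable to a constant; the points without such a
  visit form the leftmost cylinder.\<close>

lemma doeblin:
  assumes a: "0 < \<alpha>" "\<alpha> < 1" and h: "regular_density \<alpha> h" and bs: "set bs \<subseteq> {0<..\<alpha>}" and x: "x \<in> {0<..1}"
  shows "doeblin_const \<alpha> * ((\<integral>x. h x \<partial>leb) - (\<integral>x. indicator {0..left_end bs} x * h x \<partial>leb)) \<le> push bs h x"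
  using h bs
proof (induction bs arbitrary: h)
  case Nil
  \<comment> \<open>For the empty word the cylinder is the whole interval, and the lower bound to be
    proved is 0.\<close>
  have "(\<integral>x. indicator {0..1} x * h x \<partial>leb) = (\<integral>x. h x \<partial>leb)"
    by (rule Bochner_Integration.integral_cong) auto
  then show ?case using regular_densityD(2)[OF Nil(1), of x] x by simp
next
  case (Cons b bs)
  note hD = regular_densityD[OF Cons.prems(1)]
  have b: "0 < b" "b \<le> \<alpha>" and bs: "set bs \<subseteq> {0<..\<alpha>}" using Cons.prems by auto
  define c where "c = (1/2) powr (1 + \<alpha>) * (\<integral>x. transfer_right h x \<partial>leb)"
  have c: "0 \<le> c"
    unfolding c_def using hD(2) by (auto intro!: mult_nonneg_nonneg integral_nonneg_AE AE_I2 transfer_right_nonneg)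
  have e: "0 \<le> left_end bs" "left_end bs \<le> 1" using left_end_in[OF positive_parameters[OF bs]] by auto
  have "doeblin_const \<alpha> * ((\<integral>x. transfer_left b h x \<partial>leb) - (\<integral>x. indicator {0..left_end bs} x * transfer_left b h x \<partial>leb))
      \<le> push bs (transfer_left b h) x"
    by (rule Cons.IH[OF regular_density_transfer_left[OF Cons.prems(1) b] bs])
  then have 1: "doeblin_const \<alpha> * ((\<integral>x. transfer_left b h x \<partial>leb) - (\<integral>x. indicator {0..left_end (b # bs)} x * h x \<partial>leb))
      \<le> push bs (transfer_left b h) x"
    using transfer_left_head[OF b(1) hD(1) e] by simp
  \<comment> \<open>The part that visits the right branch now lies above the constant
    \<open>c\<close>, so its image lies above \<open>c\<close> times the image of Lebesgue measure.
    The left part is left to the induction hypothesis.\<close>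
  have "doeblin_const \<alpha> * (\<integral>x. transfer_right h x \<partial>leb) = c * lower_const \<alpha>"
    by (simp add: doeblin_const_def c_def)
  also have "\<dots> \<le> c * push bs (\<lambda>x. 1) x"
    using push_one_lower[OF a bs x] c by (intro mult_left_mono)
  also have "\<dots> = push bs (\<lambda>x. c * 1) x" unfolding push_linear ..
  also have "\<dots> \<le> push bs (transfer_right h) x"
    by (rule push_mono[OF positive_parameters[OF bs] _ x]) (use transfer_right_lower[OF Cons.prems(1)] in \<open>auto simp: c_def\<close>)
  finally have 2: "doeblin_const \<alpha> * (\<integral>x. transfer_right h x \<partial>leb) \<le> push bs (transfer_right h) x" .
  have "(\<integral>x. h x \<partial>leb) = (\<integral>x. transfer_left b h x \<partial>leb) + (\<integral>x. transfer_right h x \<partial>leb)"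
    using integral_split_half[OF hD(1)] integral_transfer_left[OF b(1) hD(1)] integral_transfer_right[OF hD(1)] by simp
  moreover have "push (b # bs) h x = push bs (transfer_left b h) x + push bs (transfer_right h) x"
    by (simp add: transfer_def[abs_def] push_linear)
  ultimately show ?case using 1 2 by (simp add: algebra_simps)
qed

lemma left_inv_half: "0 < \<beta> \<Longrightarrow> x \<in> {0..1} \<Longrightarrow> x / 2 \<le> left_inv \<beta> x"
proof -
  assume b: "0 < \<beta>" "x \<in> {0..1}"
  define u where "u = left_inv \<beta> x"
  have u: "0 \<le> u" "u \<le> 1/2" using left_inv_in[OF b] by (auto simp: u_def)
  have "x = u * (1 + (2 * u) powr \<beta>)" using left_inv_eq[OF b] by (simp add: u_def)
  also have "\<dots> \<le> u * (1 + 1)" using u b powr_mono2[of \<beta> "2 * u" 1] by (intro mult_left_mono) auto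
  finally show ?thesis by (simp add: u_def)
qed

text \<open>For u the preimage and s = (2u)^\<alpha>, the smallest value of (2u)^\<beta> allowed by
  \<beta> <= \<alpha>, one has u(1 + s) <= x. Then (1 + s)^\<alpha> >= 1 + \<alpha>s/2 gives a gain
  proportional to u^(-\<alpha>) s = 2^\<alpha> >= 1.\<close>

lemma left_inv_powr:
  assumes a: "\<alpha> < 1" and b: "0 < \<beta>" "\<beta> \<le> \<alpha>" and x: "0 < x" "x \<le> 1"
  shows "x powr - \<alpha> + \<alpha> / 3 \<le> left_inv \<beta> x powr - \<alpha>"
proof -
  define u where "u = left_inv \<beta> x"
  define s where "s = (2 * u) powr \<alpha>"
  have a0: "0 < \<alpha>" using b by simp
  have u: "0 < u" "u \<le> 1/2" using left_inv_pos[OF b(1) x] left_inv_in[OF b(1), of x] x by (auto simp: u_def)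
  have s: "0 < s" "s \<le> 1" using u a0 powr_mono2[of \<alpha> "2 * u" 1] by (auto simp: s_def)
  have "s \<le> (2 * u) powr \<beta>" unfolding s_def using u b by (intro powr_mono') auto
  then have "u * (1 + s) \<le> u * (1 + (2 * u) powr \<beta>)" using u by (intro mult_left_mono) auto
  also have "\<dots> = x" using left_inv_eq[OF b(1), of x] x by (simp add: u_def)
  finally have "x powr - \<alpha> \<le> (u * (1 + s)) powr - \<alpha>" using u s a0 by (intro powr_mono2') auto
  also have "\<dots> = u powr - \<alpha> / (1 + s) powr \<alpha>" using u s by (simp add: powr_mult powr_minus divide_simps)
  also have "\<dots> \<le> u powr - \<alpha> / (1 + \<alpha> * s / 2)"
  proof (intro divide_left_mono)
    have "ln (1 / (1 + s)) \<le> 1 / (1 + s) - 1" using s by (intro ln_le_minus_one) auto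
    then have "s / (1 + s) \<le> ln (1 + s)" using s by (simp add: ln_div field_simps)
    moreover have "s / 2 \<le> s / (1 + s)" using s by (intro divide_left_mono) auto
    ultimately have "s / 2 \<le> ln (1 + s)" by linarith
    then have "\<alpha> * (s / 2) \<le> \<alpha> * ln (1 + s)" using a0 by (intro mult_left_mono) auto
    then have "1 + \<alpha> * s / 2 \<le> 1 + \<alpha> * ln (1 + s)" by simp
    also have "\<dots> \<le> exp (\<alpha> * ln (1 + s))" by (rule exp_ge_add_one_self)
    also have "\<dots> = (1 + s) powr \<alpha>" using s by (simp add: powr_def)
    finally show "1 + \<alpha> * s / 2 \<le> (1 + s) powr \<alpha>" .
    show "0 < (1 + s) powr \<alpha> * (1 + \<alpha> * s / 2)" using s a0 by (auto intro!: mult_pos_pos add_pos_nonneg)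
  qed auto
  \<comment> \<open>Clearing the denominator, the gain u^(-\<alpha>) \<alpha>s/2 is at least
    \<alpha>/2, and \<alpha>/3 is what survives division by 1 + \<alpha>s/2 <= 3/2.\<close>
  also have "\<dots> \<le> u powr - \<alpha> - \<alpha> / 3"
  proof -
    have "1 \<le> u powr - \<alpha> * s"
    proof -
      have "u powr - \<alpha> * s = 2 powr \<alpha>" unfolding s_def using u by (simp add: powr_mult powr_minus)
      then show ?thesis using a0 by (simp add: ge_one_powr_ge_zero)
    qed
    then have 1: "\<alpha> / 3 * 1 \<le> \<alpha> / 3 * (u powr - \<alpha> * s)" using a0 by (intro mult_left_mono) auto
    have "\<alpha> * s \<le> 1" using a s a0 mult_mono[of \<alpha> 1 s 1] by auto
    then have "\<alpha> / 3 * (1 + \<alpha> * s / 2) \<le> \<alpha> / 3 * (1 + 1 / 2)" using a0 by (intro mult_left_mono) auto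
    then have 2: "\<alpha> / 3 * (1 + \<alpha> * s / 2) \<le> \<alpha> / 2" by simp
    have "u powr - \<alpha> * (\<alpha> * s / 2) = \<alpha> / 2 * (u powr - \<alpha> * s)" by simp
    also have "\<dots> \<ge> \<alpha> / 2 * 1" using \<open>1 \<le> u powr - \<alpha> * s\<close> a0 by (intro mult_left_mono) auto
    finally have "\<alpha> / 3 * (1 + \<alpha> * s / 2) \<le> u powr - \<alpha> * (\<alpha> * s / 2)" using 2 by simp
    then have "u powr - \<alpha> \<le> (u powr - \<alpha> - \<alpha> / 3) * (1 + \<alpha> * s / 2)" by (simp add: algebra_simps)
    moreover have "0 < 1 + \<alpha> * s / 2" using a0 s by (intro add_pos_pos) auto
    ultimately show ?thesis by (simp add: pos_divide_le_eq)
  qed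
  finally show ?thesis by (simp add: u_def)
qed

text \<open>The quantity x^(-\<alpha>) starts at 1 and rises by at least \<alpha>/3 with each
  inverse left branch.\<close>

lemma left_end_decay:
  assumes a: "0 < \<alpha>" "\<alpha> < 1" and bs: "set bs \<subseteq> {0<..\<alpha>}" and n: "n \<le> length bs"
  shows "left_end bs \<le> (1 + \<alpha> / 3 * real n) powr (- 1 / \<alpha>)"
proof -
  have e: "0 < left_end bs" using left_end_in[OF positive_parameters[OF bs]] by simp
  have "1 + \<alpha> / 3 * real (length bs) \<le> left_end bs powr - \<alpha>"
    using bs
  proof (induction bs)
    case (Cons b bs)
    then have "1 + \<alpha> / 3 * real (length bs) \<le> left_end bs powr - \<alpha>" by simp
    also have "\<dots> + \<alpha> / 3 \<le> left_inv b (left_end bs) powr - \<alpha>"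
      using left_inv_powr[of \<alpha> b "left_end bs"] left_end_in[OF positive_parameters, of bs \<alpha>] a Cons.prems by simp
    finally show ?case by (simp add: field_simps)
  qed simp
  moreover have "\<alpha> / 3 * real n \<le> \<alpha> / 3 * real (length bs)" using n a by (intro mult_left_mono) auto
  ultimately have "1 + \<alpha> / 3 * real n \<le> left_end bs powr - \<alpha>" by simp
  then have "(left_end bs powr - \<alpha>) powr (- 1 / \<alpha>) \<le> (1 + \<alpha> / 3 * real n) powr (- 1 / \<alpha>)"
    using a by (intro powr_mono2') (auto intro!: add_pos_nonneg)
  then show ?thesis using a e by (simp add: powr_powr)
qed

section \<open>Loss of memory\<close>

text \<open>Replacing the density \<open>f\<close> relative to the reference \<open>g\<close> by its mean on each cylinder and pushing the
  result forward; the recursion on the word never mentions the cylinders themselves.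
  The second version keeps only the cylinders on which the mean is positive.\<close>

primrec averaged :: "real list \<Rightarrow> (real \<Rightarrow> real) \<Rightarrow> (real \<Rightarrow> real) \<Rightarrow> real \<Rightarrow> real"
  where
    "averaged [] f g = (\<lambda>x. (\<integral>x. f x \<partial>leb) / (\<integral>x. g x \<partial>leb) * g x)"
  | "averaged (b # bs) f g =
      (\<lambda>x. averaged bs (transfer_left b f) (transfer_left b g) x + averaged bs (transfer_right f) (transfer_right g) x)"

primrec averaged_pos :: "real list \<Rightarrow> (real \<Rightarrow> real) \<Rightarrow> (real \<Rightarrow> real) \<Rightarrow> real \<Rightarrow> real"
  where
    "averaged_pos [] f g = (\<lambda>x. max 0 (\<integral>x. f x \<partial>leb) / (\<integral>x. g x \<partial>leb) * g x)"
  | "averaged_pos (b # bs) f g =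
      (\<lambda>x. averaged_pos bs (transfer_left b f) (transfer_left b g) x + averaged_pos bs (transfer_right f) (transfer_right g) x)"

text \<open>The class of the branch images of Lebesgue measure that serve as denominators of the
  cylinder means. Positivity at 1 makes the masses positive and passes to both branches, since
  g(1/2) >= g(1).\<close>

definition reference :: "real \<Rightarrow> (real \<Rightarrow> real) \<Rightarrow> bool"
  where "reference \<alpha> g \<longleftrightarrow> regular_density \<alpha> g \<and> 0 < g 1"

lemma reference_mass: "reference \<alpha> g \<Longrightarrow> 0 < (\<integral>x. g x \<partial>leb)"
  using regular_density_le_mass[of \<alpha> g 1] by (auto simp: reference_def)

lemma reference_transfer:
  assumes g: "reference \<alpha> g" and b: "0 < \<beta>" "\<beta> \<le> \<alpha>"
  shows reference_transfer_left: "reference \<alpha> (transfer_left \<beta> g)"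
    and reference_transfer_right: "reference \<alpha> (transfer_right g)"
proof -
  have r: "regular_density \<alpha> g" and p: "0 < g 1" using g by (auto simp: reference_def)
  have "g 1 \<le> g (1/2)" using regular_densityD(3)[OF r, of "1/2" 1] by simp
  then show "reference \<alpha> (transfer_left \<beta> g)" "reference \<alpha> (transfer_right g)"
    unfolding reference_def
    using p b regular_density_transfer_left[OF r b] regular_density_transfer_right[OF r]
    by (auto simp: transfer_left_def transfer_right_def)
qed

text \<open>The reason for averaging: an averaged density is a sum of nonnegative multiples of
  branch images of \<open>g\<close>, so it is regular however irregular \<open>f\<close> is.\<close>

lemma regular_averaged_pos:
  assumes "reference \<alpha> g" "set bs \<subseteq> {0<..\<alpha>}"
  shows "regular_density \<alpha> (averaged_pos bs f g)"
  using assms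
proof (induction bs arbitrary: f g)
  case Nil
  then show ?case using reference_mass[OF Nil(1)] unfolding averaged_pos.simps
    by (intro regular_density_cmult) (auto simp: reference_def)
next
  case (Cons b bs)
  then show ?case by (auto intro!: regular_density_add reference_transfer)
qed

lemma averaged_pos_diff:
  "averaged_pos bs f g x - averaged_pos bs (\<lambda>x. - f x) g x = averaged bs f g x"
proof (induction bs arbitrary: f g)
  case Nil
  have "max 0 a / m * y - max 0 (- a) / m * y = a / m * y" for a m y :: real by (auto simp: max_def)
  then show ?case by simp
next
  case (Cons b bs)
  have "averaged_pos (b # bs) f g x - averaged_pos (b # bs) (\<lambda>x. - f x) g x =
      (averaged_pos bs (transfer_left b f) (transfer_left b g) x - averaged_pos bs (\<lambda>x. - transfer_left b f x) (transfer_left b g) x)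
    + (averaged_pos bs (transfer_right f) (transfer_right g) x - averaged_pos bs (\<lambda>x. - transfer_right f x) (transfer_right g) x)"
    by (simp add: transfer_left_linear transfer_right_linear)
  also have "\<dots> = averaged (b # bs) f g x" unfolding Cons.IH by simp
  finally show ?case .
qed

lemma averaged_diff:
  assumes "set bs \<subseteq> {0<..}" "integrable leb f" "integrable leb h"
  shows "averaged bs (\<lambda>x. f x - h x) g x = averaged bs f g x - averaged bs h g x"
  using assms
proof (induction bs arbitrary: f h g)
  case (Cons b bs)
  then show ?case
    by (simp add: transfer_left_linear transfer_right_linear transfer_left_integrable transfer_right_integrable)
qed (simp add: diff_divide_distrib algebra_simps)

text \<open>On each cylinder the positive part of the mean of a difference is at most the mean of
  \<open>f\<close>. This lets head estimates for \<open>f\<close>, which is dominated by a cone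
  density, control the positive part.\<close>

lemma averaged_pos_le:
  assumes "reference \<alpha> g" "set bs \<subseteq> {0<..\<alpha>}" "integrable leb f" "integrable leb h"
    and "\<And>x. x \<in> {0..1} \<Longrightarrow> 0 \<le> f x" "\<And>x. x \<in> {0..1} \<Longrightarrow> 0 \<le> h x" "x \<in> {0..1}"
  shows "averaged_pos bs (\<lambda>x. f x - h x) g x \<le> averaged bs f g x"
  using assms(1-6)
proof (induction bs arbitrary: f h g)
  case Nil
  have "0 \<le> (\<integral>x. f x \<partial>leb)" "0 \<le> (\<integral>x. h x \<partial>leb)" using Nil by (auto intro!: integral_nonneg_AE AE_I2)
  then have "max 0 (\<integral>x. f x - h x \<partial>leb) \<le> (\<integral>x. f x \<partial>leb)" using Nil by simp
  then show ?case
    using reference_mass[OF Nil(1)] Nil(1) regular_densityD(2)[of \<alpha> g x] \<open>x \<in> {0..1}\<close>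
    by (auto simp: reference_def intro!: mult_right_mono divide_right_mono)
next
  case (Cons b bs)
  have b: "0 < b" "b \<le> \<alpha>" "set bs \<subseteq> {0<..\<alpha>}" using Cons.prems by auto
  show ?case
    unfolding averaged_pos.simps averaged.simps transfer_left_linear transfer_right_linear
    by (intro add_mono Cons.IH reference_transfer[OF Cons.prems(1) b(1,2)] b transfer_left_integrable transfer_right_integrable
        transfer_left_nonneg transfer_right_nonneg Cons.prems)
qed

lemma averaged_integral:
  assumes "reference \<alpha> g" "set bs \<subseteq> {0<..\<alpha>}" "integrable leb f"
  shows averaged_integrable: "integrable leb (averaged bs f g)"
    and integral_averaged: "(\<integral>x. averaged bs f g x \<partial>leb) = (\<integral>x. f x \<partial>leb)"
proof -
  have "integrable leb (averaged bs f g) \<and> (\<integral>x. averaged bs f g x \<partial>leb) = (\<integral>x. f x \<partial>leb)"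
    using assms
  proof (induction bs arbitrary: f g)
    case Nil
    then show ?case using reference_mass[OF Nil(1)] regular_densityD(1)[of \<alpha> g] by (auto simp: reference_def)
  next
    case (Cons b bs)
    have b: "0 < b" "b \<le> \<alpha>" "set bs \<subseteq> {0<..\<alpha>}" using Cons.prems by auto
    note L = Cons.IH[OF reference_transfer_left[OF Cons.prems(1) b(1,2)] b(3) transfer_left_integrable[OF b(1) Cons.prems(3)]]
    note R = Cons.IH[OF reference_transfer_right[OF Cons.prems(1) b(1,2)] b(3) transfer_right_integrable[OF Cons.prems(3)]]
    show ?case using L R
      by (simp add: integral_transfer_left[OF b(1) Cons.prems(3)] integral_transfer_right[OF Cons.prems(3)]
          integral_split_half[OF Cons.prems(3)])
  qed
  then show "integrable leb (averaged bs f g)" "(\<integral>x. averaged bs f g x \<partial>leb) = (\<integral>x. f x \<partial>leb)" by auto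
qed

text \<open>On each cylinder the absolute value of the integral is at most the integral of the
  absolute value; averaging thus does not increase the L^1 norm.\<close>

lemma averaged_pos_mass:
  assumes "reference \<alpha> g" "set bs \<subseteq> {0<..\<alpha>}" "integrable leb f"
  shows "(\<integral>x. averaged_pos bs f g x \<partial>leb) + (\<integral>x. averaged_pos bs (\<lambda>x. - f x) g x \<partial>leb) \<le> (\<integral>x. \<bar>f x\<bar> \<partial>leb)"
  using assms
proof (induction bs arbitrary: f g)
  case Nil
  have "integrable leb g" using Nil by (auto simp: reference_def regular_densityD)
  moreover have "max 0 a + max 0 (- a) = \<bar>a\<bar>" for a :: real by auto
  ultimately show ?case
    using reference_mass[OF Nil(1)] integral_abs_bound[of leb f] by simp
next
  case (Cons b bs)
  have b: "0 < b" "b \<le> \<alpha>" "set bs \<subseteq> {0<..\<alpha>}" using Cons.prems by auto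
  note rL = reference_transfer_left[OF Cons.prems(1) b(1,2)] and rR = reference_transfer_right[OF Cons.prems(1) b(1,2)]
  note iL = regular_densityD(1)[OF regular_averaged_pos[OF rL b(3)]]
    and iR = regular_densityD(1)[OF regular_averaged_pos[OF rR b(3)]]
  have aL: "(\<integral>x. \<bar>transfer_left b f x\<bar> \<partial>leb) = (\<integral>x. transfer_left b (\<lambda>x. \<bar>f x\<bar>) x \<partial>leb)"
  proof (rule Bochner_Integration.integral_cong)
    fix x assume "x \<in> space leb"
    then have "0 < 1 + (1 + b) * (2 * left_inv b x) powr b"
      using b left_inv_in[OF b(1), of x] by (auto intro!: add_pos_nonneg)
    then show "\<bar>transfer_left b f x\<bar> = transfer_left b (\<lambda>x. \<bar>f x\<bar>) x"
      by (simp add: transfer_left_def abs_divide)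
  qed simp
  have aR: "(\<integral>x. \<bar>transfer_right f x\<bar> \<partial>leb) = (\<integral>x. transfer_right (\<lambda>x. \<bar>f x\<bar>) x \<partial>leb)"
    by (simp add: transfer_right_def)
  note L = Cons.IH[OF rL b(3) transfer_left_integrable[OF b(1) Cons.prems(3)]]
  note R = Cons.IH[OF rR b(3) transfer_right_integrable[OF Cons.prems(3)]]
  have ab: "integrable leb (\<lambda>x. \<bar>f x\<bar>)" using Cons.prems by simp
  show ?case using L R unfolding aL aR integral_split_half[OF ab]
    integral_transfer_left[OF b(1) ab] integral_transfer_right[OF ab]
    by (simp add: transfer_left_linear transfer_right_linear iL iR)
qed

text \<open>On a cylinder the mean of \<open>r\<close> differs from \<open>r\<close> by at most its oscillation, and the oscillations of a
  monotone function add up.\<close>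

lemma averaged_error:
  assumes "reference \<alpha> g" "set bs \<subseteq> {0<..\<alpha>}" "r \<in> borel_measurable leb"
    and "\<And>x y. 0 < x \<Longrightarrow> x \<le> y \<Longrightarrow> y \<le> 1 \<Longrightarrow> r y \<le> r x"
    and "\<And>x. 0 < x \<Longrightarrow> x \<le> 1 \<Longrightarrow> s \<le> r x \<and> r x \<le> t" and "integrable leb (\<lambda>x. r x * g x)"
  shows "(\<integral>x. \<bar>push bs (\<lambda>x. r x * g x) x - averaged bs (\<lambda>x. r x * g x) g x\<bar> \<partial>leb)
    \<le> (t - s) * (\<integral>x. indicator {0..left_end bs} x * g x \<partial>leb)"
  using assms
proof (induction bs arbitrary: r g s t)
  case Nil
  have g: "regular_density \<alpha> g" using Nil by (simp add: reference_def)
  note gD = regular_densityD[OF g]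
  define m where "m = (\<integral>x. g x \<partial>leb)"
  define \<rho> where "\<rho> = (\<integral>x. r x * g x \<partial>leb) / m"
  have m: "0 < m" unfolding m_def by (rule reference_mass[OF Nil(1)])
  have "s * m = (\<integral>x. s * g x \<partial>leb)" by (simp add: m_def)
  also have "\<dots> \<le> (\<integral>x. r x * g x \<partial>leb)"
    using gD Nil(5,6) by (intro integral_leb_mono mult_right_mono) auto
  finally have "s \<le> \<rho>" using m by (simp add: \<rho>_def field_simps)
  have "(\<integral>x. r x * g x \<partial>leb) \<le> (\<integral>x. t * g x \<partial>leb)"
    using gD Nil(5,6) by (intro integral_leb_mono mult_right_mono) auto
  also have "\<dots> = t * m" by (simp add: m_def)
  finally have "\<rho> \<le> t" using m by (simp add: \<rho>_def field_simps)
  have "(\<integral>x. \<bar>r x * g x - \<rho> * g x\<bar> \<partial>leb) \<le> (\<integral>x. (t - s) * g x \<partial>leb)"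
  proof (rule integral_leb_mono)
    fix x :: real assume x: "0 < x" "x \<le> 1"
    have "\<bar>r x - \<rho>\<bar> \<le> t - s" using Nil(5)[OF x] \<open>s \<le> \<rho>\<close> \<open>\<rho> \<le> t\<close> by auto
    then have "\<bar>r x - \<rho>\<bar> * g x \<le> (t - s) * g x" using gD(2)[of x] x by (intro mult_right_mono) auto
    then show "\<bar>r x * g x - \<rho> * g x\<bar> \<le> (t - s) * g x"
      using gD(2)[of x] x by (simp add: left_diff_distrib[symmetric] abs_mult)
  qed (use gD Nil(6) in auto)
  also have "\<dots> = (t - s) * (\<integral>x. indicator {0..left_end []} x * g x \<partial>leb)"
  proof -
    have "(\<integral>x. indicator {0..1} x * g x \<partial>leb) = (\<integral>x. g x \<partial>leb)"
      by (rule Bochner_Integration.integral_cong) auto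
    then show ?thesis by simp
  qed
  finally show ?case by (simp add: \<rho>_def m_def)
next
  case (Cons b bs)
  have b: "0 < b" "b \<le> \<alpha>" and bs: "set bs \<subseteq> {0<..\<alpha>}" using Cons.prems by auto
  have g: "regular_density \<alpha> g" using Cons.prems by (simp add: reference_def)
  note gD = regular_densityD[OF g]
  define e where "e = left_end bs"
  have e: "0 < e" "e \<le> 1" using left_end_in[OF positive_parameters[OF bs]] by (auto simp: e_def)
  \<comment> \<open>The value at the branch point splits the oscillation: t - q on the left half and
    q - s on the right. Both halves are charged with the same mass \<open>G\<close> of the leftmost
    cylinder, so the pieces add up to t - s.\<close>
  define q where "q = r (1/2)"
  have q: "s \<le> q" "q \<le> t" using Cons.prems(5)[of "1/2"] by (auto simp: q_def)
  have eL: "transfer_left b (\<lambda>x. r x * g x) = (\<lambda>x. r (left_inv b x) * transfer_left b g x)"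
    by (simp add: transfer_left_def fun_eq_iff)
  have eR: "transfer_right (\<lambda>x. r x * g x) = (\<lambda>x. r ((1 + x) / 2) * transfer_right g x)"
    by (simp add: transfer_right_def fun_eq_iff)
  note iL = transfer_left_integrable[OF b(1) Cons.prems(6)] and iR = transfer_right_integrable[OF Cons.prems(6)]
  have L: "(\<integral>x. \<bar>push bs (transfer_left b (\<lambda>x. r x * g x)) x - averaged bs (transfer_left b (\<lambda>x. r x * g x)) (transfer_left b g) x\<bar> \<partial>leb)
    \<le> (t - q) * (\<integral>x. indicator {0..e} x * transfer_left b g x \<partial>leb)"
    unfolding eL e_def
  proof (rule Cons.IH[OF reference_transfer_left[OF Cons.prems(1) b] bs])
    show "(\<lambda>x. r (left_inv b x)) \<in> borel_measurable leb"
      by (rule measurable_compose[OF left_inv_measurable[OF b(1)] Cons.prems(3)])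
    show "r (left_inv b y) \<le> r (left_inv b x)" if "0 < x" "x \<le> y" "y \<le> 1" for x y
      using left_inv_pos[of b x] left_inv_mono[of b x y] left_inv_in[of b y] that b by (intro Cons.prems(4)) auto
    show "q \<le> r (left_inv b x) \<and> r (left_inv b x) \<le> t" if "0 < x" "x \<le> 1" for x
      using left_inv_pos[of b x] left_inv_in[of b x] that b Cons.prems(4)[of "left_inv b x" "1/2"]
        Cons.prems(5)[of "left_inv b x"] by (auto simp: q_def)
    show "integrable leb (\<lambda>x. r (left_inv b x) * transfer_left b g x)" using iL unfolding eL .
  qed
  have R: "(\<integral>x. \<bar>push bs (transfer_right (\<lambda>x. r x * g x)) x - averaged bs (transfer_right (\<lambda>x. r x * g x)) (transfer_right g) x\<bar> \<partial>leb)
    \<le> (q - s) * (\<integral>x. indicator {0..e} x * transfer_right g x \<partial>leb)"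
    unfolding eR e_def
  proof (rule Cons.IH[OF reference_transfer_right[OF Cons.prems(1) b] bs])
    show "(\<lambda>x. r ((1 + x) / 2)) \<in> borel_measurable leb"
      by (rule measurable_compose[OF right_inv_measurable Cons.prems(3)])
    show "r ((1 + y) / 2) \<le> r ((1 + x) / 2)" if "0 < x" "x \<le> y" "y \<le> 1" for x y
      using that by (intro Cons.prems(4)) auto
    show "s \<le> r ((1 + x) / 2) \<and> r ((1 + x) / 2) \<le> q" if "0 < x" "x \<le> 1" for x
      using that Cons.prems(4)[of "1/2" "(1 + x) / 2"] Cons.prems(5)[of "(1 + x) / 2"] by (auto simp: q_def)
    show "integrable leb (\<lambda>x. r ((1 + x) / 2) * transfer_right g x)" using iR unfolding eR .
  qed
  define l where "l = left_inv b e"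
  have l: "e / 2 \<le> l" "0 < l" "l \<le> 1/2"
    using left_inv_half[OF b(1), of e] left_inv_pos[OF b(1) e] left_inv_in[OF b(1), of e] e by (auto simp: l_def)
  define G where "G = (\<integral>x. indicator {0..l} x * g x \<partial>leb)"
  have GL: "(\<integral>x. indicator {0..e} x * transfer_left b g x \<partial>leb) = G"
    using transfer_left_head[OF b(1) gD(1), of e] e by (simp add: l_def G_def)
  \<comment> \<open>The right image of g is at most g(1/2)/2, so its mass on [0,e] is at most e
    g(1/2)/2 <= l g(1/2). This is below the mass of g on [0,l], since g >= g(1/2) there.\<close>
  have "(\<integral>x. indicator {0..e} x * transfer_right g x \<partial>leb) \<le> (\<integral>x. indicator {0..e} x * (g (1/2) / 2) \<partial>leb)"
    by (rule integral_leb_mono[OF integrable_leb_indicator[OF transfer_right_integrable[OF gD(1)]] integrable_leb_indicator])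
      (use gD(3)[of "1/2"] in \<open>auto simp: transfer_right_def split: split_indicator\<close>)
  also have "\<dots> = e * (g (1/2) / 2)" using e by (intro integral_leb_indicator) auto
  also have "\<dots> \<le> l * g (1/2)" using l gD(2)[of "1/2"] mult_right_mono[of "e/2" l "g (1/2)"] by simp
  also have "\<dots> = (\<integral>x. indicator {0..l} x * g (1/2) \<partial>leb)" using l by (intro integral_leb_indicator[symmetric]) auto
  also have "\<dots> \<le> G" unfolding G_def
    by (rule integral_leb_mono[OF integrable_leb_indicator integrable_leb_indicator[OF gD(1)]])
      (use gD(3)[of _ "1/2"] l in \<open>auto split: split_indicator\<close>)
  finally have GR: "(\<integral>x. indicator {0..e} x * transfer_right g x \<partial>leb) \<le> G" .
  let ?f = "\<lambda>x. r x * g x"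
  let ?L = "\<lambda>x. push bs (transfer_left b ?f) x - averaged bs (transfer_left b ?f) (transfer_left b g) x"
  let ?R = "\<lambda>x. push bs (transfer_right ?f) x - averaged bs (transfer_right ?f) (transfer_right g) x"
  have I: "integrable leb ?L" "integrable leb ?R"
    using push_integrable[OF positive_parameters[OF bs] iL] push_integrable[OF positive_parameters[OF bs] iR]
      averaged_integrable[OF reference_transfer_left[OF Cons.prems(1) b] bs iL]
      averaged_integrable[OF reference_transfer_right[OF Cons.prems(1) b] bs iR] by auto
  have "(\<integral>x. \<bar>push (b # bs) ?f x - averaged (b # bs) ?f g x\<bar> \<partial>leb) = (\<integral>x. \<bar>?L x + ?R x\<bar> \<partial>leb)"
    by (simp add: transfer_def[abs_def] push_linear algebra_simps)
  also have "\<dots> \<le> (\<integral>x. \<bar>?L x\<bar> + \<bar>?R x\<bar> \<partial>leb)"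
    using I by (intro integral_leb_mono) auto
  also have "\<dots> = (\<integral>x. \<bar>?L x\<bar> \<partial>leb) + (\<integral>x. \<bar>?R x\<bar> \<partial>leb)" using I by simp
  also have "\<dots> \<le> (t - q) * G + (q - s) * G"
    using q by (intro add_mono L[unfolded GL] order_trans[OF R mult_left_mono[OF GR]]) simp
  also have "\<dots> = (t - s) * (\<integral>x. indicator {0..left_end (b # bs)} x * g x \<partial>leb)"
    by (simp add: G_def l_def e_def algebra_simps)
  finally show ?case .
qed

lemma doeblin_const_bounds:
  assumes "0 < \<alpha>" "\<alpha> < 1"
  shows "0 < doeblin_const \<alpha>" "doeblin_const \<alpha> < 1"
proof -
  have q: "(1 - \<alpha>)\<^sup>2 / 4 \<le> 1" using assms power_le_one[of "1 - \<alpha>" 2] by auto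
  have "lower_const \<alpha> \<le> 1 / 2"
    unfolding lower_const_def using q assms powr_le1[of "(1 + \<alpha>) / (1 - \<alpha>)" "(1 - \<alpha>)\<^sup>2 / 4"] by simp
  moreover have "(1/2) powr (1 + \<alpha>) \<le> (1::real)" using assms by (intro powr_le1) auto
  ultimately have "doeblin_const \<alpha> \<le> 1 / 2 * 1"
    unfolding doeblin_const_def using lower_const_pos[OF assms] by (intro mult_mono) auto
  then show "doeblin_const \<alpha> < 1" by simp
  show "0 < doeblin_const \<alpha>" using lower_const_pos[OF assms] by (simp add: doeblin_const_def)
qed

text \<open>Capping at the value of the bound A x^(-\<alpha>) at X changes f only on [0,X] and
  removes mass at most \<eta>. The capped density has oscillation at most t, so averaging it over
  cylinders costs at most t X = A X^(1-\<alpha>), again within \<eta>.\<close>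

lemma truncated_density:
  assumes a: "0 < \<alpha>" "\<alpha> < 1" and f: "density_cone \<alpha> A f" and X: "0 < X" "X \<le> 1"
    and bs: "set bs \<subseteq> {0<..\<alpha>}" "left_end bs \<le> X"
    and t: "t = A * X powr - \<alpha>" and \<eta>: "\<eta> = A * (X powr (1 - \<alpha>) / (1 - \<alpha>))"
  shows "integrable leb (\<lambda>x. min (f x) t)" "\<And>x. x \<in> {0..1} \<Longrightarrow> 0 \<le> min (f x) t"
    "(\<integral>x. \<bar>f x - min (f x) t\<bar> \<partial>leb) \<le> \<eta>"
    "(\<integral>x. \<bar>push bs (\<lambda>x. min (f x) t) x - averaged bs (\<lambda>x. min (f x) t) (\<lambda>x. 1) x\<bar> \<partial>leb) \<le> \<eta>"
proof -
  have reg: "regular_density \<alpha> f" and le: "\<And>x. 0 < x \<Longrightarrow> x \<le> 1 \<Longrightarrow> f x \<le> A * x powr - \<alpha>"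
    using f by (auto simp: density_cone_def)
  note fD = regular_densityD[OF reg]
  have A: "0 \<le> A" using order_trans[OF fD(2)[of 1] le[of 1]] by simp
  have t0: "0 \<le> t" using A by (simp add: t)
  show nn: "0 \<le> min (f x) t" if "x \<in> {0..1}" for x using fD(2)[OF that] t0 by simp
  show i: "integrable leb (\<lambda>x. min (f x) t)"
    using fD(1) by (intro integrable_min) auto
  have mono: "min (f y) t \<le> min (f x) t" if "0 < x" "x \<le> y" "y \<le> 1" for x y
    using fD(3)[OF that] by (auto simp: min_def)
  have small: "f x \<le> t" if "X \<le> x" "x \<le> 1" for x
    using fD(3)[of X x] le[of X] X that by (simp add: t)
  have "(\<integral>x. \<bar>f x - min (f x) t\<bar> \<partial>leb) \<le> (\<integral>x. indicator {0..X} x * f x \<partial>leb)"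
    by (rule integral_leb_mono[OF _ integrable_leb_indicator[OF fD(1)]])
      (use fD i small t0 in \<open>auto split: split_indicator simp: min_def not_le\<close>)
  also have "\<dots> \<le> \<eta>" unfolding \<eta> using X by (intro density_cone_head[OF f a]) auto
  finally show "(\<integral>x. \<bar>f x - min (f x) t\<bar> \<partial>leb) \<le> \<eta>" .
  have e: "0 < left_end bs" "left_end bs \<le> 1" using left_end_in[OF positive_parameters[OF bs(1)]] by auto
  have ref: "reference \<alpha> (\<lambda>x. 1)" using regular_density_const[of \<alpha> 1] a by (simp add: reference_def)
  have "(\<integral>x. \<bar>push bs (\<lambda>x. min (f x) t * 1) x - averaged bs (\<lambda>x. min (f x) t * 1) (\<lambda>x. 1) x\<bar> \<partial>leb)
      \<le> (t - 0) * (\<integral>x. indicator {0..left_end bs} x * 1 \<partial>leb)"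
    by (rule averaged_error[OF ref bs(1)])
      (use i nn mono t0 in auto)
  also have "\<dots> = t * left_end bs" using e by (subst integral_leb_indicator) auto
  also have "\<dots> \<le> t * X" using bs t0 by (intro mult_left_mono)
  also have "\<dots> = A * X powr (1 - \<alpha>)" using X by (simp add: t powr_diff powr_minus field_simps)
  also have "\<dots> \<le> \<eta>"
    unfolding \<eta> using A a X by (intro mult_left_mono) (auto simp: field_simps)
  finally show "(\<integral>x. \<bar>push bs (\<lambda>x. min (f x) t) x - averaged bs (\<lambda>x. min (f x) t) (\<lambda>x. 1) x\<bar> \<partial>leb) \<le> \<eta>"
    by simp
qed

text \<open>The word \<open>bs\<close> averages the difference, so that its positive and negative
  parts become regular; the word \<open>cs\<close> then gives both parts a common constant lower
  bound, which cancels. The 10 is 4 for the two truncations and two averaging errors, plus 6 for the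
  imbalance and the heads of the parts.\<close>

lemma l1_contraction:
  assumes a: "0 < \<alpha>" "\<alpha> < 1"
    and f: "density_cone \<alpha> A f1" "density_cone \<alpha> A f2" "(\<integral>x. f1 x \<partial>leb) = (\<integral>x. f2 x \<partial>leb)"
    and X: "0 < X" "X \<le> 1"
    and bs: "set bs \<subseteq> {0<..\<alpha>}" "left_end bs \<le> X" and cs: "set cs \<subseteq> {0<..\<alpha>}" "left_end cs \<le> X"
    and \<eta>: "\<eta> = A * (X powr (1 - \<alpha>) / (1 - \<alpha>))"
  shows "(\<integral>x. \<bar>push (bs @ cs) (\<lambda>x. f1 x - f2 x) x\<bar> \<partial>leb)
    \<le> (1 - doeblin_const \<alpha>) * (\<integral>x. \<bar>f1 x - f2 x\<bar> \<partial>leb) + 10 * \<eta>"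
proof -
  define c where "c = doeblin_const \<alpha>"
  have c: "0 < c" "c < 1" using doeblin_const_bounds[OF a] by (auto simp: c_def)
  define t where "t = A * X powr - \<alpha>"
  define t1 t2 where "t1 = (\<lambda>x. min (f1 x) t)" and "t2 = (\<lambda>x. min (f2 x) t)"
  have T1: "integrable leb t1" "\<And>x. x \<in> {0..1} \<Longrightarrow> 0 \<le> t1 x" "(\<integral>x. \<bar>f1 x - t1 x\<bar> \<partial>leb) \<le> \<eta>"
    "(\<integral>x. \<bar>push bs t1 x - averaged bs t1 (\<lambda>x. 1) x\<bar> \<partial>leb) \<le> \<eta>"
    unfolding t1_def using truncated_density[OF a f(1) X bs t_def \<eta>] by blast+
  have T2: "integrable leb t2" "\<And>x. x \<in> {0..1} \<Longrightarrow> 0 \<le> t2 x" "(\<integral>x. \<bar>f2 x - t2 x\<bar> \<partial>leb) \<le> \<eta>"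
    "(\<integral>x. \<bar>push bs t2 x - averaged bs t2 (\<lambda>x. 1) x\<bar> \<partial>leb) \<le> \<eta>"
    unfolding t2_def using truncated_density[OF a f(2) X bs t_def \<eta>] by blast+
  have r1: "regular_density \<alpha> f1" and r2: "regular_density \<alpha> f2" using f by (auto simp: density_cone_def)
  note D1 = regular_densityD[OF r1] and D2 = regular_densityD[OF r2]
  have pb: "set bs \<subseteq> {0<..}" and pc: "set cs \<subseteq> {0<..}" using bs cs by auto
  \<comment> \<open>Nonnegative parts whose difference is the averaged difference of the truncated
    densities.\<close>
  define u v where "u = averaged_pos bs (\<lambda>x. t1 x - t2 x) (\<lambda>x. 1)"
    and "v = averaged_pos bs (\<lambda>x. t2 x - t1 x) (\<lambda>x. 1)"
  have ref: "reference \<alpha> (\<lambda>x. 1)" using regular_density_const[of \<alpha> 1] a by (simp add: reference_def)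
  have u: "regular_density \<alpha> u" and v: "regular_density \<alpha> v"
    unfolding u_def v_def by (rule regular_averaged_pos[OF ref bs(1)])+
  have iu: "integrable leb u" and iv: "integrable leb v" using u v regular_densityD by auto
  define U V where "U = (\<integral>x. u x \<partial>leb)" and "V = (\<integral>x. v x \<partial>leb)"
  note A1 = averaged_integrable[OF ref bs(1) T1(1)] and A2 = averaged_integrable[OF ref bs(1) T2(1)]
  note P1 = push_integrable[OF pb T1(1)] and P2 = push_integrable[OF pb T2(1)]
  have uv: "u x - v x = averaged bs t1 (\<lambda>x. 1) x - averaged bs t2 (\<lambda>x. 1) x" for x
    using averaged_pos_diff[of bs "\<lambda>x. t1 x - t2 x" "\<lambda>x. 1" x] averaged_diff[OF pb T1(1) T2(1), of "\<lambda>x. 1" x]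
    by (simp add: u_def v_def)
  have mass: "U + V \<le> (\<integral>x. \<bar>f1 x - f2 x\<bar> \<partial>leb)"
  proof -
    have "U + V \<le> (\<integral>x. \<bar>t1 x - t2 x\<bar> \<partial>leb)"
      using averaged_pos_mass[OF ref bs(1), of "\<lambda>x. t1 x - t2 x"] T1(1) T2(1)
      by (simp add: u_def v_def U_def V_def)
    also have "\<dots> \<le> (\<integral>x. \<bar>f1 x - f2 x\<bar> \<partial>leb)"
      using T1(1) T2(1) D1(1) D2(1) by (intro integral_leb_mono) (auto simp: t1_def t2_def)
    finally show ?thesis .
  qed
  \<comment> \<open>Truncation may remove different masses, at most \<eta> each, so the two parts
    need not have equal mass.\<close>
  have balance: "\<bar>U - V\<bar> \<le> 2 * \<eta>"
  proof -
    have "U - V = (\<integral>x. u x - v x \<partial>leb)" using iu iv by (simp add: U_def V_def)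
    also have "\<dots> = (\<integral>x. t1 x \<partial>leb) - (\<integral>x. t2 x \<partial>leb)"
      unfolding uv using A1 A2 integral_averaged[OF ref bs(1)] T1(1) T2(1) by simp
    also have "\<dots> = (\<integral>x. f2 x - t2 x \<partial>leb) - (\<integral>x. f1 x - t1 x \<partial>leb)"
      using T1(1) T2(1) D1(1) D2(1) f(3) by simp
    finally have "U - V = (\<integral>x. f2 x - t2 x \<partial>leb) - (\<integral>x. f1 x - t1 x \<partial>leb)" .
    moreover have "\<bar>\<integral>x. f2 x - t2 x \<partial>leb\<bar> \<le> \<eta>" "\<bar>\<integral>x. f1 x - t1 x \<partial>leb\<bar> \<le> \<eta>"
      using order_trans[OF integral_abs_bound T1(3)] order_trans[OF integral_abs_bound T2(3)]
      by blast+
    ultimately show ?thesis by linarith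
  qed
  define e where "e = left_end cs"
  have e: "0 < e" "e \<le> 1" "e \<le> X" using left_end_in[OF pc] cs by (auto simp: e_def)
  \<comment> \<open>No pointwise bound by x^(-\<alpha>) is at hand for an averaged density. It is
    dominated by the average of \<open>s\<close>, that is within \<eta> in L^1 of the image of
    \<open>s\<close>, and this image lies below the image of the cone density \<open>g\<close>,
    whose head is at most \<eta>.\<close>
  have head: "(\<integral>x. indicator {0..e} x * w x \<partial>leb) \<le> 2 * \<eta>"
    if w: "integrable leb w" "\<And>x. x \<in> {0..1} \<Longrightarrow> w x \<le> averaged bs s (\<lambda>x. 1) x"
      and s: "integrable leb s" "\<And>x. s x \<le> g x" "integrable leb (averaged bs s (\<lambda>x. 1))"
      and err: "(\<integral>x. \<bar>push bs s x - averaged bs s (\<lambda>x. 1) x\<bar> \<partial>leb) \<le> \<eta>"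
      and g: "density_cone \<alpha> A g" for w s g
  proof -
    have ig: "integrable leb (push bs g)"
      using g density_cone_push[OF g bs(1) a(2)] by (auto simp: density_cone_def regular_density_def)
    have is': "integrable leb (push bs s)" by (rule push_integrable[OF pb s(1)])
    have "(\<integral>x. indicator {0..e} x * w x \<partial>leb)
        \<le> (\<integral>x. indicator {0..e} x * push bs g x + \<bar>push bs s x - averaged bs s (\<lambda>x. 1) x\<bar> \<partial>leb)"
    proof (rule integral_leb_mono)
      fix x :: real assume x: "0 < x" "x \<le> 1"
      have "push bs s x \<le> push bs g x" by (rule push_mono[OF pb]) (use s x in auto)
      then show "indicator {0..e} x * w x \<le> indicator {0..e} x * push bs g x + \<bar>push bs s x - averaged bs s (\<lambda>x. 1) x\<bar>"
        using w(2)[of x] x by (auto split: split_indicator)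
    qed (use w ig is' s in \<open>auto intro!: integrable_leb_indicator\<close>)
    also have "\<dots> = (\<integral>x. indicator {0..e} x * push bs g x \<partial>leb) + (\<integral>x. \<bar>push bs s x - averaged bs s (\<lambda>x. 1) x\<bar> \<partial>leb)"
      using ig is' s by (intro Bochner_Integration.integral_add) (auto intro!: integrable_leb_indicator)
    also have "\<dots> \<le> \<eta> + \<eta>"
    proof (rule add_mono[OF _ err])
      have A0: "0 \<le> A"
      proof -
        have "0 \<le> g 1" "g 1 \<le> A" using g unfolding density_cone_def regular_density_def by (auto dest: spec[of _ 1])
        then show ?thesis by simp
      qed
      have "(\<integral>x. indicator {0..e} x * push bs g x \<partial>leb) \<le> A * (e powr (1 - \<alpha>) / (1 - \<alpha>))"
        using e by (intro density_cone_head[OF density_cone_push[OF g bs(1) a(2)] a]) auto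
      also have "\<dots> \<le> \<eta>" unfolding \<eta> using e a A0 by (intro mult_left_mono divide_right_mono powr_mono2) auto
      finally show "(\<integral>x. indicator {0..e} x * push bs g x \<partial>leb) \<le> \<eta>" .
    qed
    finally show ?thesis by simp
  qed
  have hu: "(\<integral>x. indicator {0..e} x * u x \<partial>leb) \<le> 2 * \<eta>"
    by (rule head[OF iu _ T1(1) _ A1 T1(4) f(1)])
      (use averaged_pos_le[OF ref bs(1) T1(1) T2(1) T1(2) T2(2)] in \<open>auto simp: u_def t1_def\<close>)
  have hv: "(\<integral>x. indicator {0..e} x * v x \<partial>leb) \<le> 2 * \<eta>"
    by (rule head[OF iv _ T2(1) _ A2 T2(4) f(2)])
      (use averaged_pos_le[OF ref bs(1) T2(1) T1(1) T2(2) T1(2)] in \<open>auto simp: v_def t2_def\<close>)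
  \<comment> \<open>A lower bound for both images, unrelated to the exponent of the theorem: each
    part has mass at least (U + V)/2 - \<eta>, and its leftmost cylinder takes at most 2\<eta>
    away.\<close>
  define \<kappa> where "\<kappa> = c * ((U + V) / 2 - 3 * \<eta>)"
  have lower: "\<kappa> \<le> push cs u x" "\<kappa> \<le> push cs v x" if x: "x \<in> {0<..1}" for x
  proof -
    have "\<kappa> \<le> c * (U - (\<integral>x. indicator {0..e} x * u x \<partial>leb))"
      unfolding \<kappa>_def
    proof (rule mult_left_mono)
      show "(U + V) / 2 - 3 * \<eta> \<le> U - (\<integral>x. indicator {0..e} x * u x \<partial>leb)"
      proof -
        have ar: "U - V \<le> 2 * \<eta> \<Longrightarrow> V - U \<le> 2 * \<eta> \<Longrightarrow> h \<le> 2 * \<eta> \<Longrightarrow> (U + V) / 2 - 3 * \<eta> \<le> U - h" for h :: real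
          by (simp add: field_simps)
        show ?thesis by (rule ar) (use balance hu in auto)
      qed
    qed (use c in simp)
    also have "\<dots> \<le> push cs u x" using doeblin[OF a u cs(1) x] by (simp add: c_def U_def e_def)
    finally show "\<kappa> \<le> push cs u x" .
    have "\<kappa> \<le> c * (V - (\<integral>x. indicator {0..e} x * v x \<partial>leb))"
      unfolding \<kappa>_def
    proof (rule mult_left_mono)
      show "(U + V) / 2 - 3 * \<eta> \<le> V - (\<integral>x. indicator {0..e} x * v x \<partial>leb)"
      proof -
        have ar: "U - V \<le> 2 * \<eta> \<Longrightarrow> V - U \<le> 2 * \<eta> \<Longrightarrow> h \<le> 2 * \<eta> \<Longrightarrow> (U + V) / 2 - 3 * \<eta> \<le> V - h" for h :: real
          by (simp add: field_simps)
        show ?thesis by (rule ar) (use balance hv in auto)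
      qed
    qed (use c in simp)
    also have "\<dots> \<le> push cs v x" using doeblin[OF a v cs(1) x] by (simp add: c_def V_def e_def)
    finally show "\<kappa> \<le> push cs v x" .
  qed
  have iuv: "integrable leb (push cs u)" "integrable leb (push cs v)"
    using push_integrable[OF pc] iu iv by auto
  have main: "(\<integral>x. \<bar>push cs (\<lambda>x. u x - v x) x\<bar> \<partial>leb) \<le> (1 - c) * (U + V) + 6 * c * \<eta>"
  proof -
    have "(\<integral>x. \<bar>push cs (\<lambda>x. u x - v x) x\<bar> \<partial>leb) \<le> (\<integral>x. push cs u x + push cs v x - 2 * \<kappa> \<partial>leb)"
      unfolding push_linear
    proof (rule integral_leb_mono)
      fix x :: real assume x: "0 < x" "x \<le> 1"
      then show "\<bar>push cs u x - push cs v x\<bar> \<le> push cs u x + push cs v x - 2 * \<kappa>"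
        using lower[of x] by (auto simp: abs_le_iff)
    qed (use iuv in auto)
    also have "\<dots> = U + V - 2 * \<kappa>"
      using iuv integral_push[OF pc] iu iv leb.prob_space by (simp add: U_def V_def)
    also have "\<dots> = (1 - c) * (U + V) + 6 * c * \<eta>" by (simp add: \<kappa>_def algebra_simps)
    finally show ?thesis .
  qed
  \<comment> \<open>The discrepancy between the image of the difference and its averaged version;
    \<open>cs\<close> only contracts it.\<close>
  define w where "w = (\<lambda>x. push bs (\<lambda>x. f1 x - f2 x) x - (u x - v x))"
  have iw: "integrable leb w"
    unfolding w_def using push_integrable[OF pb, of "\<lambda>x. f1 x - f2 x"] D1(1) D2(1) iu iv by simp
  have werr: "(\<integral>x. \<bar>w x\<bar> \<partial>leb) \<le> 4 * \<eta>"
  proof -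
    define d1 where "d1 = (\<lambda>x. f1 x - t1 x)"
    define d2 where "d2 = (\<lambda>x. f2 x - t2 x)"
    define e1 where "e1 = (\<lambda>x. push bs t1 x - averaged bs t1 (\<lambda>x. 1) x)"
    define e2 where "e2 = (\<lambda>x. push bs t2 x - averaged bs t2 (\<lambda>x. 1) x)"
    have id: "integrable leb d1" "integrable leb d2" using T1(1) T2(1) D1(1) D2(1) by (auto simp: d1_def d2_def)
    have ip: "integrable leb (push bs d1)" "integrable leb (push bs d2)" using push_integrable[OF pb] id by auto
    have ie: "integrable leb e1" "integrable leb e2" using P1 P2 A1 A2 by (auto simp: e1_def e2_def)
    have w_eq: "w x = push bs d1 x - push bs d2 x + e1 x - e2 x" for x
      unfolding w_def uv d1_def d2_def e1_def e2_def push_linear by simp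
    have "(\<integral>x. \<bar>w x\<bar> \<partial>leb) \<le> (\<integral>x. \<bar>push bs d1 x\<bar> + \<bar>push bs d2 x\<bar> + \<bar>e1 x\<bar> + \<bar>e2 x\<bar> \<partial>leb)"
      by (rule integral_leb_mono) (use iw ip ie w_eq in auto)
    also have "\<dots> = (\<integral>x. \<bar>push bs d1 x\<bar> \<partial>leb) + (\<integral>x. \<bar>push bs d2 x\<bar> \<partial>leb) + (\<integral>x. \<bar>e1 x\<bar> \<partial>leb) + (\<integral>x. \<bar>e2 x\<bar> \<partial>leb)"
      using ip ie by simp
    also have "\<dots> \<le> \<eta> + \<eta> + \<eta> + \<eta>"
      using order_trans[OF push_contraction[OF pb id(1)]] order_trans[OF push_contraction[OF pb id(2)]]
        T1(3,4) T2(3,4) unfolding d1_def d2_def e1_def e2_def by (intro add_mono) auto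
    finally show ?thesis by simp
  qed
  have decomp: "push (bs @ cs) (\<lambda>x. f1 x - f2 x) = (\<lambda>x. push cs w x + push cs (\<lambda>x. u x - v x) x)"
    unfolding w_def push_linear(1)[symmetric] by simp
  have "(\<integral>x. \<bar>push (bs @ cs) (\<lambda>x. f1 x - f2 x) x\<bar> \<partial>leb)
      \<le> (\<integral>x. \<bar>push cs w x\<bar> + \<bar>push cs (\<lambda>x. u x - v x) x\<bar> \<partial>leb)"
    unfolding decomp using push_integrable[OF pc iw] push_integrable[OF pc, of "\<lambda>x. u x - v x"] iu iv
    by (intro integral_leb_mono) auto
  also have "\<dots> = (\<integral>x. \<bar>push cs w x\<bar> \<partial>leb) + (\<integral>x. \<bar>push cs (\<lambda>x. u x - v x) x\<bar> \<partial>leb)"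
    using push_integrable[OF pc iw] push_integrable[OF pc, of "\<lambda>x. u x - v x"] iu iv by simp
  also have "\<dots> \<le> 4 * \<eta> + ((1 - c) * (U + V) + 6 * c * \<eta>)"
    by (intro add_mono order_trans[OF push_contraction[OF pc iw] werr] main)
  also have "\<dots> \<le> (1 - c) * (\<integral>x. \<bar>f1 x - f2 x\<bar> \<partial>leb) + 10 * \<eta>"
  proof -
    have "0 \<le> \<eta>" using order_trans[OF _ T1(3)] by simp
    then have "c * \<eta> \<le> 1 * \<eta>" using c by (intro mult_right_mono) auto
    moreover have "(1 - c) * (U + V) \<le> (1 - c) * (\<integral>x. \<bar>f1 x - f2 x\<bar> \<partial>leb)"
      using mass c by (intro mult_left_mono) auto
    ultimately show ?thesis by linarith
  qed
  finally show ?thesis by (simp add: c_def)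
qed


text \<open>Each round consumes 2n parameters, n to average and n to contract. Cone invariance keeps
  \<open>A\<close>, hence \<eta>, the same in every round, so the errors form a geometric sum;
  parameters left over at the end only contract.\<close>

lemma l1_iterate:
  assumes a: "0 < \<alpha>" "\<alpha> < 1" and X: "X = (1 + \<alpha> / 3 * real n) powr (- 1 / \<alpha>)"
    and \<eta>: "\<eta> = A * (X powr (1 - \<alpha>) / (1 - \<alpha>))" and c: "c = doeblin_const \<alpha>"
    and "density_cone \<alpha> A f1" "density_cone \<alpha> A f2" "(\<integral>x. f1 x \<partial>leb) = (\<integral>x. f2 x \<partial>leb)"
    and "set bs \<subseteq> {0<..\<alpha>}" "2 * n * k \<le> length bs"
  shows "(\<integral>x. \<bar>push bs (\<lambda>x. f1 x - f2 x) x\<bar> \<partial>leb)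
    \<le> (1 - c) ^ k * (\<integral>x. \<bar>f1 x - f2 x\<bar> \<partial>leb) + 10 * \<eta> * ((1 - (1 - c) ^ k) / c)"
  using assms(6-)
proof (induction k arbitrary: f1 f2 bs)
  case 0
  then have "integrable leb (\<lambda>x. f1 x - f2 x)" by (auto simp: density_cone_def regular_density_def)
  then show ?case using push_contraction[OF positive_parameters[OF 0(4)]] by simp
next
  case (Suc k)
  have cb: "0 < c" "c < 1" using doeblin_const_bounds[OF a] by (auto simp: c)
  define b1 b2 b3 where "b1 = take n bs" and "b2 = take n (drop n bs)" and "b3 = drop n (drop n bs)"
  have bs: "bs = (b1 @ b2) @ b3" by (simp add: b1_def b2_def b3_def del: drop_drop)
  have set: "set b1 \<subseteq> {0<..\<alpha>}" "set b2 \<subseteq> {0<..\<alpha>}" "set b3 \<subseteq> {0<..\<alpha>}" "set (b1 @ b2) \<subseteq> {0<..\<alpha>}"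
    using Suc.prems(4) unfolding bs by auto
  have len: "2 * n + 2 * n * k \<le> length bs" using Suc.prems(5) by (simp add: algebra_simps)
  then have "n \<le> length b1" "n \<le> length b2" by (auto simp: b1_def b2_def)
  then have e: "left_end b1 \<le> X" "left_end b2 \<le> X" unfolding X using left_end_decay[OF a] set by auto
  have X01: "0 < X" "X \<le> 1"
  proof -
    have "1 \<le> 1 + \<alpha> / 3 * real n" using a by simp
    then have "0 < 1 + \<alpha> / 3 * real n" by linarith
    with \<open>1 \<le> 1 + \<alpha> / 3 * real n\<close> show "0 < X" "X \<le> 1" unfolding X using powr_mono2'[of "- 1 / \<alpha>" 1 "1 + \<alpha> / 3 * real n"] a
      by (auto simp: divide_nonpos_pos)
  qed
  define g1 g2 where "g1 = push (b1 @ b2) f1" and "g2 = push (b1 @ b2) f2"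
  have i: "integrable leb f1" "integrable leb f2" using Suc.prems by (auto simp: density_cone_def regular_density_def)
  have g: "density_cone \<alpha> A g1" "density_cone \<alpha> A g2" "(\<integral>x. g1 x \<partial>leb) = (\<integral>x. g2 x \<partial>leb)"
    unfolding g1_def g2_def
    using density_cone_push[OF Suc.prems(1) set(4) a(2)] density_cone_push[OF Suc.prems(2) set(4) a(2)]
      integral_push[OF positive_parameters[OF set(4)] i(1)] integral_push[OF positive_parameters[OF set(4)] i(2)] Suc.prems(3) by simp_all
  have "(\<integral>x. \<bar>push bs (\<lambda>x. f1 x - f2 x) x\<bar> \<partial>leb) = (\<integral>x. \<bar>push b3 (\<lambda>x. g1 x - g2 x) x\<bar> \<partial>leb)"
    unfolding bs g1_def g2_def push_linear push_simps ..
  also have "\<dots> \<le> (1 - c) ^ k * (\<integral>x. \<bar>g1 x - g2 x\<bar> \<partial>leb) + 10 * \<eta> * ((1 - (1 - c) ^ k) / c)"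
    by (rule Suc.IH[OF g set(3)]) (use len in \<open>simp add: b3_def\<close>)
  also have "\<dots> \<le> (1 - c) ^ k * ((1 - c) * (\<integral>x. \<bar>f1 x - f2 x\<bar> \<partial>leb) + 10 * \<eta>) + 10 * \<eta> * ((1 - (1 - c) ^ k) / c)"
  proof (rule add_right_mono[OF mult_left_mono])
    show "(\<integral>x. \<bar>g1 x - g2 x\<bar> \<partial>leb) \<le> (1 - c) * (\<integral>x. \<bar>f1 x - f2 x\<bar> \<partial>leb) + 10 * \<eta>"
      using l1_contraction[OF a Suc.prems(1-3) X01 set(1) e(1) set(2) e(2) \<eta>]
      unfolding g1_def g2_def c push_linear .
  qed (use cb in auto)
  also have "\<dots> = (1 - c) ^ Suc k * (\<integral>x. \<bar>f1 x - f2 x\<bar> \<partial>leb) + 10 * \<eta> * ((1 - (1 - c) ^ Suc k) / c)"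
    using cb by (simp add: field_simps)
  finally show ?case .
qed

text \<open>The logarithm is taken of a bound \<open>N\<close> for the length, so that one
  logarithmic factor serves all time gaps up to a horizon. The condition \<open>3 \<le> N\<close>
  ensures that it is at least 1.\<close>

definition loss_bound :: "real \<Rightarrow> real \<Rightarrow> bool"
  where "loss_bound \<alpha> C \<longleftrightarrow> 0 < C \<and> (\<forall>A N bs f1 f2. 3 \<le> N \<longrightarrow> bs \<noteq> [] \<longrightarrow> length bs \<le> N \<longrightarrow> set bs \<subseteq> {0<..\<alpha>} \<longrightarrow>
    density_cone \<alpha> A f1 \<longrightarrow> density_cone \<alpha> A f2 \<longrightarrow> (\<integral>x. f1 x \<partial>leb) = (\<integral>x. f2 x \<partial>leb) \<longrightarrow>
    (\<integral>x. \<bar>push bs (\<lambda>x. f1 x - f2 x) x\<bar> \<partial>leb) \<le> C * A * (ln (real N) / real (length bs)) powr (1 / \<alpha> - 1))"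

lemma loss_boundD:
  assumes "loss_bound \<alpha> C"
  shows "0 < C" "3 \<le> N \<Longrightarrow> bs \<noteq> [] \<Longrightarrow> length bs \<le> N \<Longrightarrow> set bs \<subseteq> {0<..\<alpha>} \<Longrightarrow>
    density_cone \<alpha> A f1 \<Longrightarrow> density_cone \<alpha> A f2 \<Longrightarrow> (\<integral>x. f1 x \<partial>leb) = (\<integral>x. f2 x \<partial>leb) \<Longrightarrow>
    (\<integral>x. \<bar>push bs (\<lambda>x. f1 x - f2 x) x\<bar> \<partial>leb) \<le> C * A * (ln (real N) / real (length bs)) powr (1 / \<alpha> - 1)"
  using assms unfolding loss_bound_def by blast+

lemma loss_bound_exists:
  assumes a: "0 < \<alpha>" "\<alpha> < 1"
  obtains C where "loss_bound \<alpha> C"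
proof -
  define c where "c = doeblin_const \<alpha>"
  define \<gamma> where "\<gamma> = 1 / \<alpha> - 1"
  define K where "K = \<gamma> / c + 1"
  define C where "C = 1 + 10 / c / (1 - \<alpha>) * (6 * K / \<alpha>) powr \<gamma>"
  have c: "0 < c" "c < 1" using doeblin_const_bounds[OF a] by (auto simp: c_def)
  have \<gamma>: "0 < \<gamma>" using a by (simp add: \<gamma>_def)
  have K: "0 < K" using c \<gamma> by (simp add: K_def add_pos_pos)
  have "loss_bound \<alpha> C"
    unfolding loss_bound_def
  proof (intro conjI allI impI)
    show "0 < C" unfolding C_def using c a by (intro add_pos_nonneg) auto
    fix A :: real and N :: nat and bs f1 f2
    assume N: "3 \<le> N" and bs: "bs \<noteq> []" "length bs \<le> N" "set bs \<subseteq> {0<..\<alpha>}"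
      and f: "density_cone \<alpha> A f1" "density_cone \<alpha> A f2" "(\<integral>x. f1 x \<partial>leb) = (\<integral>x. f2 x \<partial>leb)"
    have r1: "regular_density \<alpha> f1" and r2: "regular_density \<alpha> f2" using f by (auto simp: density_cone_def)
    note D1 = regular_densityD[OF r1] and D2 = regular_densityD[OF r2]
    have "exp 1 \<le> (3 :: real)" by (rule exp_le)
    also have "\<dots> \<le> real N" using N by simp
    finally have lnN: "1 \<le> ln (real N)" using N by (subst ln_ge_iff) auto
    have A0: "0 \<le> A" using f(1) D1(2)[of 1] unfolding density_cone_def by (auto dest: spec[of _ 1])
    define r where "r = real (length bs)"
    have r: "1 \<le> r" "r \<le> real N" using bs by (auto simp: r_def Suc_le_eq)
    \<comment> \<open>Just enough rounds for (1 - c)^k <= N^(-\<gamma>). Each then has about r /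
      (2k) steps per half, and this division by k ~ ln N is the source of the logarithm in the
      rate.\<close>
    define k where "k = nat \<lceil>\<gamma> * ln (real N) / c\<rceil>"
    define n where "n = length bs div (2 * k)"
    define X where "X = (1 + \<alpha> / 3 * real n) powr (- 1 / \<alpha>)"
    define \<eta> where "\<eta> = A * (X powr (1 - \<alpha>) / (1 - \<alpha>))"
    define L where "L = ln (real N) / r"
    have L: "0 < L" unfolding L_def by (rule divide_pos_pos; use lnN r in linarith)
    have g0: "0 < \<gamma> * ln (real N) / c" using \<gamma> c lnN by simp
    have k: "0 < k" "\<gamma> * ln (real N) / c \<le> real k" "real k \<le> K * ln (real N)"
    proof -
      show "0 < k" using g0 by (simp add: k_def)
      show "\<gamma> * ln (real N) / c \<le> real k" using g0 unfolding k_def by linarith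
      have "real k \<le> \<gamma> * ln (real N) / c + 1" using g0 unfolding k_def by linarith
      also have "\<dots> \<le> K * ln (real N)" using lnN by (simp add: K_def algebra_simps)
      finally show "real k \<le> K * ln (real N)" .
    qed
    have "2 * n * k \<le> length bs" unfolding n_def using div_times_less_eq_dividend[of "length bs" "2 * k"] by (simp add: ac_simps)
    from l1_iterate[OF a X_def \<eta>_def c_def f bs(3) this]
    have "(\<integral>x. \<bar>push bs (\<lambda>x. f1 x - f2 x) x\<bar> \<partial>leb)
      \<le> (1 - c) ^ k * (\<integral>x. \<bar>f1 x - f2 x\<bar> \<partial>leb) + 10 * \<eta> * ((1 - (1 - c) ^ k) / c)" .
    also have "\<dots> \<le> L powr \<gamma> * A + 10 * (A / (1 - \<alpha>) * ((6 * K / \<alpha>) powr \<gamma> * L powr \<gamma>)) * (1 / c)"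
    proof (intro add_mono mult_mono)
      have "(1 - c) ^ k \<le> exp (- c) ^ k" using exp_ge_add_one_self[of "- c"] c by (intro power_mono) auto
      also have "\<dots> = exp (- (c * real k))" by (simp add: exp_of_nat_mult[symmetric] mult.commute)
      also have "\<dots> \<le> exp (- (\<gamma> * ln (real N)))" using k(2) c by (simp add: field_simps)
      also have "\<dots> = real N powr - \<gamma>" using N by (simp add: powr_def)
      also have "\<dots> \<le> r powr - \<gamma>" using r \<gamma> by (intro powr_mono2') auto
      also have "\<dots> = (1 / r) powr \<gamma>" using r by (simp add: powr_minus powr_divide inverse_eq_divide)
      also have "\<dots> \<le> L powr \<gamma>" unfolding L_def using r lnN \<gamma> by (intro powr_mono2 divide_right_mono) auto
      finally show "(1 - c) ^ k \<le> L powr \<gamma>" .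
      have "(\<integral>x. \<bar>f1 x - f2 x\<bar> \<partial>leb) \<le> (\<integral>x. f1 x + f2 x \<partial>leb)"
      proof (rule integral_leb_mono)
        fix x :: real assume "0 < x" "x \<le> 1"
        then show "\<bar>f1 x - f2 x\<bar> \<le> f1 x + f2 x" using D1(2)[of x] D2(2)[of x] by auto
      qed (use D1(1) D2(1) in auto)
      also have "\<dots> \<le> (1 - \<alpha>) / 2 * A + (1 - \<alpha>) / 2 * A"
      proof -
        have "(\<integral>x. f1 x \<partial>leb) \<le> (1 - \<alpha>) / 2 * A" "(\<integral>x. f2 x \<partial>leb) \<le> (1 - \<alpha>) / 2 * A"
          using f(1,2) unfolding density_cone_def by blast+
        then show ?thesis using D1(1) D2(1) by (simp add: algebra_simps)
      qed
      also have "\<dots> \<le> A" using a A0 by (simp add: algebra_simps)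
      finally show "(\<integral>x. \<bar>f1 x - f2 x\<bar> \<partial>leb) \<le> A" .
      show "(1 - (1 - c) ^ k) / c \<le> 1 / c" using c by (intro divide_right_mono) auto
      show "0 \<le> (1 - (1 - c) ^ k) / c" using c by (auto simp: power_le_one)
      \<comment> \<open>Working with n + 1 also covers words shorter than 2k, for which n = 0. From
        r <= (1 + n) * 2K ln N the base 1 + \<alpha>n/3 is at least \<alpha>/(6K) * r/ln N, which
        explains the factor \<open>6 * K / \<alpha>\<close>.\<close>
      have "length bs < (n + 1) * (2 * k)"
        unfolding n_def using dividend_less_div_times[of "2 * k" "length bs"] k(1)
        by (simp only: add_mult_distrib mult_1 add.commute)
      then have "r < real ((n + 1) * (2 * k))" unfolding r_def by (subst of_nat_less_iff)
      then have "r \<le> (1 + real n) * (2 * real k)" by (simp add: algebra_simps)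
      also have "\<dots> \<le> (1 + real n) * (2 * (K * ln (real N)))" using k(3) by (intro mult_left_mono) auto
      finally have "r / ln (real N) \<le> (1 + real n) * (2 * K)" using lnN by (simp add: field_simps)
      then have "\<alpha> / (6 * K) * (r / ln (real N)) \<le> \<alpha> / (6 * K) * ((1 + real n) * (2 * K))"
        using a K by (intro mult_left_mono) auto
      also have "\<dots> = \<alpha> / 3 * (1 + real n)" using K by (simp add: field_simps)
      also have "\<dots> \<le> 1 + \<alpha> / 3 * real n" using a by (simp add: algebra_simps)
      finally have le: "\<alpha> / (6 * K) * (r / ln (real N)) \<le> 1 + \<alpha> / 3 * real n" .
      have "0 < \<alpha> / (6 * K) * (r / ln (real N))"
        by (intro mult_pos_pos divide_pos_pos) (use a K r lnN in linarith)+
      then have "(1 + \<alpha> / 3 * real n) powr - \<gamma> \<le> (\<alpha> / (6 * K) * (r / ln (real N))) powr - \<gamma>"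
        using le \<gamma> by (intro powr_mono2') auto
      also have "\<alpha> / (6 * K) * (r / ln (real N)) = inverse (6 * K / \<alpha> * L)" by (simp add: L_def)
      also have "\<dots> powr - \<gamma> = (6 * K / \<alpha> * L) powr \<gamma>"
      proof -
        have *: "inverse y powr - \<gamma> = y powr \<gamma>" if "0 < y" for y :: real
          using that by (simp add: powr_minus inverse_powr)
        show ?thesis by (rule *) (use a K L in simp)
      qed
      also have "\<dots> = (6 * K / \<alpha>) powr \<gamma> * L powr \<gamma>" by (rule powr_mult)
      finally have "(1 + \<alpha> / 3 * real n) powr - \<gamma> \<le> (6 * K / \<alpha>) powr \<gamma> * L powr \<gamma>" .
      moreover have "X powr (1 - \<alpha>) = (1 + \<alpha> / 3 * real n) powr - \<gamma>"
        unfolding X_def powr_powr using a by (simp add: \<gamma>_def field_simps)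
      ultimately have "A * (X powr (1 - \<alpha>) / (1 - \<alpha>)) \<le> A * (((6 * K / \<alpha>) powr \<gamma> * L powr \<gamma>) / (1 - \<alpha>))"
        using a A0 by (intro mult_left_mono divide_right_mono) auto
      then show "\<eta> \<le> A / (1 - \<alpha>) * ((6 * K / \<alpha>) powr \<gamma> * L powr \<gamma>)" by (simp add: \<eta>_def)
      show "0 \<le> 10 * (A / (1 - \<alpha>) * ((6 * K / \<alpha>) powr \<gamma> * L powr \<gamma>))" using a A0 by simp
    qed (use c a A0 in \<open>auto simp: \<eta>_def\<close>)
    also have "\<dots> = C * A * L powr \<gamma>" by (simp add: C_def algebra_simps)
    finally show "(\<integral>x. \<bar>push bs (\<lambda>x. f1 x - f2 x) x\<bar> \<partial>leb) \<le> C * A * (ln (real N) / real (length bs)) powr (1 / \<alpha> - 1)"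
      by (simp add: L_def r_def \<gamma>_def)
  qed
  then show thesis by (rule that)
qed

section \<open>Moments of sequential sums\<close>

lemma power_diff_bound:
  fixes u v X :: real
  assumes "\<bar>u\<bar> \<le> X" "\<bar>v\<bar> \<le> X"
  shows "\<bar>u ^ Suc m - v ^ Suc m\<bar> \<le> real (Suc m) * \<bar>u - v\<bar> * X ^ m"
proof (induction m)
  case (Suc m)
  have X: "0 \<le> X" using assms by linarith
  have "u ^ Suc (Suc m) - v ^ Suc (Suc m) = u * (u ^ Suc m - v ^ Suc m) + (u - v) * v ^ Suc m"
    by (simp add: algebra_simps)
  also have "\<bar>\<dots>\<bar> \<le> \<bar>u\<bar> * \<bar>u ^ Suc m - v ^ Suc m\<bar> + \<bar>u - v\<bar> * \<bar>v ^ Suc m\<bar>"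
    unfolding abs_mult[symmetric] by (rule abs_triangle_ineq)
  also have "\<dots> \<le> X * (real (Suc m) * \<bar>u - v\<bar> * X ^ m) + \<bar>u - v\<bar> * X ^ Suc m"
    using assms X Suc.IH unfolding power_abs by (intro add_mono mult_mono mult_left_mono power_mono) auto
  also have "\<dots> = real (Suc (Suc m)) * \<bar>u - v\<bar> * X ^ Suc m" by (simp add: algebra_simps)
  finally show ?case .
qed simp

text \<open>The remainder e satisfies e' = (w + a)e + (m + 2) a^2 w^(m+1) when the exponent grows by
  one. The square (m + 2)^2 is a convenient majorant, since (m + 2)^2 + (m + 2) <= (m +
  3)^2.\<close>

lemma power_taylor_bound:
  fixes w a X :: real
  assumes "\<bar>w\<bar> \<le> X" "\<bar>w + a\<bar> \<le> X"
  shows "\<bar>(w + a) ^ (m + 2) - w ^ (m + 2) - real (m + 2) * a * w ^ (m + 1)\<bar> \<le> (real (m + 2))\<^sup>2 * a\<^sup>2 * X ^ m"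
proof (induction m)
  case 0
  have "(w + a) ^ 2 - w ^ 2 - 2 * a * w = a\<^sup>2" by (simp add: power2_eq_square algebra_simps)
  then show ?case by (simp add: numeral_2_eq_2)
next
  case (Suc m)
  have X: "0 \<le> X" using assms by linarith
  define e where "e = (w + a) ^ (m + 2) - w ^ (m + 2) - real (m + 2) * a * w ^ (m + 1)"
  have "(w + a) ^ (Suc m + 2) - w ^ (Suc m + 2) - real (Suc m + 2) * a * w ^ (Suc m + 1)
      = (w + a) * e + real (m + 2) * a\<^sup>2 * w ^ (m + 1)"
    by (simp add: e_def power2_eq_square algebra_simps)
  also have "\<bar>\<dots>\<bar> \<le> \<bar>w + a\<bar> * \<bar>e\<bar> + real (m + 2) * a\<^sup>2 * \<bar>w ^ (m + 1)\<bar>"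
    by (rule order_trans[OF abs_triangle_ineq]) (simp add: abs_mult)
  also have "\<dots> \<le> X * ((real (m + 2))\<^sup>2 * a\<^sup>2 * X ^ m) + real (m + 2) * a\<^sup>2 * X ^ (m + 1)"
    using assms X Suc.IH unfolding power_abs e_def[symmetric]
    by (intro add_mono mult_mono mult_left_mono power_mono) auto
  also have "\<dots> = ((real (m + 2))\<^sup>2 + real (m + 2)) * a\<^sup>2 * X ^ Suc m" by (simp add: algebra_simps)
  also have "\<dots> \<le> (real (Suc m + 2))\<^sup>2 * a\<^sup>2 * X ^ Suc m"
    using X by (intro mult_right_mono) (auto simp: power2_eq_square algebra_simps)
  finally show ?case .
qed

lemma even_power_max_le:
  fixes u v :: real
  shows "max \<bar>u\<bar> \<bar>v\<bar> ^ (2 * l) \<le> u ^ (2 * l) + v ^ (2 * l)"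
  by (cases "\<bar>u\<bar> \<le> \<bar>v\<bar>") (auto simp: max_def power_even_abs)

text \<open>Either w^2 <= \<Lambda>, or multiplying by w^2/\<Lambda> only enlarges. It trades a
  lower moment for a deterministic level plus a small multiple of the moment being
  estimated.\<close>

lemma even_power_young:
  fixes w \<Lambda> :: real
  assumes "0 < \<Lambda>"
  shows "w ^ (2 * l) \<le> \<Lambda> ^ l + w ^ (2 * l + 2) / \<Lambda>"
proof (cases "w\<^sup>2 \<le> \<Lambda>")
  case True
  then have "(w\<^sup>2) ^ l \<le> \<Lambda> ^ l" by (intro power_mono) auto
  moreover have "0 \<le> w ^ (2 * l + 2) / \<Lambda>" using assms by (intro divide_nonneg_pos zero_le_even_power) auto
  ultimately show ?thesis by (simp add: power_mult)
next
  case False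
  then have "w ^ (2 * l) * \<Lambda> \<le> w ^ (2 * l) * w\<^sup>2" by (intro mult_left_mono) auto
  also have "\<dots> = w ^ (2 * l + 2)" by (simp add: power_add power2_eq_square)
  finally have "w ^ (2 * l) \<le> w ^ (2 * l + 2) / \<Lambda>" using assms by (simp add: field_simps)
  then show ?thesis using assms by (simp add: add_increasing)
qed

lemma sum_inverse_sqrt_le: "(\<Sum>r=1..n. 1 / sqrt (real r)) \<le> 2 * sqrt (real n)"
proof (induction n)
  case (Suc n)
  have p: "0 < sqrt (real (Suc n))" by simp
  have "sqrt (real n) * sqrt (real (Suc n)) \<le> (real n + real (Suc n)) / 2"
    using arith_geo_mean_sqrt[of "real n" "real (Suc n)"] by (simp add: real_sqrt_mult)
  then have "2 * sqrt (real n) * sqrt (real (Suc n)) + 1 \<le> 2 * (sqrt (real (Suc n)) * sqrt (real (Suc n)))"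
    by simp
  then have "2 * sqrt (real n) + 1 / sqrt (real (Suc n)) \<le> 2 * sqrt (real (Suc n))"
    using p by (simp add: field_simps)
  then show ?case using Suc.IH by simp
qed simp

text \<open>Here \<open>b\<close> and \<open>d\<close> are the exponents 2l + 1 and 2l + 2. The
  value of \<open>K\<close> makes the coefficient (4dbBB' + 2d^2B^2)/K of the maximal moment at most
  1/2; absorbing that half gives the outer factor 2. The added 1 ensures K >= 1.\<close>

definition moment_const :: "nat \<Rightarrow> real \<Rightarrow> real \<Rightarrow> real \<Rightarrow> real"
  where "moment_const l B B' C = (let b = real (2 * l + 1); d = real (2 * l + 2); K = 4 * (2 * d * b * B * B' + d\<^sup>2 * B\<^sup>2) + 1
    in 2 * (2 * d * b * B * C * K ^ l + 2 * d\<^sup>2 * B\<^sup>2 * K ^ l))"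

text \<open>A Rio-type inequality. Telescoping \<open>W 1 ^ (2l + 2)\<close> twice leaves covariances of \<open>a j\<close> with increments
  that only depend on the future; splitting those at the level \<open>K * n powr (3/2) * r powr (1/2)\<close>, where \<open>r\<close> is
  the gap, makes the truncated part summable and lets the remainder be absorbed into the left-hand side.\<close>

lemma (in prob_space) moment_bound:
  fixes a W :: "nat \<Rightarrow> 'a \<Rightarrow> real"
  assumes n: "3 \<le> n" and \<gamma>: "0 < \<gamma>" "2 * \<gamma> \<le> real l"
    and B: "0 \<le> B" "\<And>j x. x \<in> space M \<Longrightarrow> \<bar>a j x\<bar> \<le> B" and meas[measurable]: "\<And>j. a j \<in> borel_measurable M"
    and W: "\<And>j x. W j x = (\<Sum>i\<in>{j..n}. a i x)" and C: "0 \<le> C" and B': "0 \<le> B'"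
    and cov: "\<And>j i \<kappa> \<tau>. 1 \<le> j \<Longrightarrow> j < i \<Longrightarrow> i \<le> n \<Longrightarrow> 0 \<le> \<kappa> \<Longrightarrow> 0 \<le> \<tau> \<Longrightarrow>
      (\<And>x. x \<in> space M \<Longrightarrow> \<bar>W i x ^ (2 * l + 1) - W (Suc i) x ^ (2 * l + 1)\<bar>
        \<le> \<kappa> + \<tau> * (W i x ^ (2 * l + 2) + W (Suc i) x ^ (2 * l + 2))) \<Longrightarrow>
      \<bar>expectation (\<lambda>x. a j x * (W i x ^ (2 * l + 1) - W (Suc i) x ^ (2 * l + 1)))\<bar>
        \<le> \<kappa> * (C * (ln (real n) / real (i - j)) powr \<gamma>)
          + B' * \<tau> * (expectation (\<lambda>x. W i x ^ (2 * l + 2)) + expectation (\<lambda>x. W (Suc i) x ^ (2 * l + 2)))"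
  shows "expectation (\<lambda>x. W 1 x ^ (2 * l + 2)) \<le> moment_const l B B' C * real n powr (real (2 * l + 2) - \<gamma>) * ln (real n) powr \<gamma>"
proof -
  define b d where "b = real (2 * l + 1)" and "d = real (2 * l + 2)"
  define K where "K = 4 * (2 * d * b * B * B' + d\<^sup>2 * B\<^sup>2) + 1"
  define D where "D r = C * (ln (real n) / real r) powr \<gamma>" for r :: nat
  define E where "E j = expectation (\<lambda>x. W j x ^ (2 * l + 2))" for j
  have bd: "0 < b" "0 < d" by (auto simp: b_def d_def)
  have K: "1 \<le> K" using bd B B' by (simp add: K_def)
  have Wmeas[measurable]: "W j \<in> borel_measurable M" for j unfolding W[abs_def] by measurable
  have Wb: "\<bar>W j x\<bar> \<le> real (card {j..n}) * B" if "x \<in> space M" for j x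
    unfolding W using sum_bounded_above[of "{j..n}" "\<lambda>i. \<bar>a i x\<bar>" B] B(2)[OF that] by (intro order_trans[OF sum_abs]) auto
  have int: "integrable M (\<lambda>x. W j x ^ m)" for j m
    by (rule integrable_const_bound[where B="(real (card {j..n}) * B) ^ m"])
      (use Wb in \<open>auto intro!: AE_I2 power_mono simp: power_abs\<close>)
  have inta: "integrable M (\<lambda>x. a j x * W i x ^ m)" for j i m
    by (rule integrable_const_bound[where B="B * (real (card {i..n}) * B) ^ m"])
      (use Wb B in \<open>auto intro!: AE_I2 mult_mono power_mono simp: power_abs abs_mult\<close>)
  have Wrec: "W j x = W (Suc j) x + a j x" if "j \<le> n" for j x
    using that unfolding W by (simp add: sum.atLeast_Suc_atMost add.commute)
  have Wn: "W (Suc n) x = 0" for x unfolding W by simp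
  have E0: "0 \<le> E j" for j unfolding E_def by (intro integral_nonneg_AE AE_I2 zero_le_even_power) simp
  \<comment> \<open>All tail sums are estimated together: each recursion step involves moments of
    other tails, so only the largest moment can be absorbed.\<close>
  define Mx where "Mx = Max (E ` {1..n+1})"
  have Mx: "E j \<le> Mx" if "1 \<le> j" "j \<le> n + 1" for j unfolding Mx_def using that by (intro Max_ge) auto
  have Mx0: "0 \<le> Mx" using order_trans[OF E0 Mx[of 1]] by simp
  have young: "expectation (\<lambda>x. W j x ^ (2 * l)) \<le> \<Lambda> ^ l + Mx / \<Lambda>" if "0 < \<Lambda>" "1 \<le> j" "j \<le> n + 1" for j \<Lambda>
  proof -
    have "expectation (\<lambda>x. W j x ^ (2 * l)) \<le> expectation (\<lambda>x. \<Lambda> ^ l + W j x ^ (2 * l + 2) / \<Lambda>)"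
      by (intro integral_mono even_power_young that Bochner_Integration.integrable_add integrable_const
          Bochner_Integration.integrable_divide int)
    also have "\<dots> = \<Lambda> ^ l + E j / \<Lambda>" unfolding E_def using int[of j "2 * l + 2"] prob_space by (simp del: power_Suc)
    also have "\<dots> \<le> \<Lambda> ^ l + Mx / \<Lambda>" using Mx that by (intro add_left_mono divide_right_mono) auto
    finally show ?thesis .
  qed
  \<comment> \<open>The increment of the power 2l + 1 is at most bB times even powers of degree 2l.
    Splitting these at level \<Lambda> gives the form required by \<open>cov\<close>, with constant
    part 2bB\<Lambda>^l and coefficient bB/\<Lambda>.\<close>
  have step1: "\<bar>expectation (\<lambda>x. a j x * (W i x ^ (2 * l + 1) - W (Suc i) x ^ (2 * l + 1)))\<bar>
      \<le> b * B * (2 * \<Lambda> ^ l * D (i - j) + 2 * B' * (Mx / \<Lambda>))"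
    if ji: "1 \<le> j" "j < i" "i \<le> n" and \<Lambda>: "0 < \<Lambda>" for j i \<Lambda>
  proof -
    have "\<bar>W i x ^ (2 * l + 1) - W (Suc i) x ^ (2 * l + 1)\<bar>
        \<le> 2 * b * B * \<Lambda> ^ l + b * B / \<Lambda> * (W i x ^ (2 * l + 2) + W (Suc i) x ^ (2 * l + 2))" if x: "x \<in> space M" for x
    proof -
      have "\<bar>W i x ^ Suc (2 * l) - W (Suc i) x ^ Suc (2 * l)\<bar>
          \<le> real (Suc (2 * l)) * \<bar>W i x - W (Suc i) x\<bar> * max \<bar>W i x\<bar> \<bar>W (Suc i) x\<bar> ^ (2 * l)"
        by (rule power_diff_bound) auto
      also have "\<dots> \<le> b * B * (W i x ^ (2 * l) + W (Suc i) x ^ (2 * l))"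
        using B(2)[OF x, of i] Wrec[of i x] ji bd B(1)
        by (intro mult_mono even_power_max_le) (auto simp: b_def zero_le_even_power)
      also have "\<dots> \<le> b * B * ((\<Lambda> ^ l + W i x ^ (2 * l + 2) / \<Lambda>) + (\<Lambda> ^ l + W (Suc i) x ^ (2 * l + 2) / \<Lambda>))"
        using bd B by (intro mult_left_mono add_mono even_power_young \<Lambda>) auto
      also have "\<dots> = 2 * b * B * \<Lambda> ^ l + b * B / \<Lambda> * (W i x ^ (2 * l + 2) + W (Suc i) x ^ (2 * l + 2))"
        by (simp add: algebra_simps add_divide_distrib)
      finally show ?thesis by simp
    qed
    from cov[OF ji _ _ this]
    have "\<bar>expectation (\<lambda>x. a j x * (W i x ^ (2 * l + 1) - W (Suc i) x ^ (2 * l + 1)))\<bar>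
        \<le> 2 * b * B * \<Lambda> ^ l * D (i - j) + B' * (b * B / \<Lambda>) * (E i + E (Suc i))"
      unfolding D_def E_def using bd B \<Lambda> by simp
    also have "\<dots> \<le> 2 * b * B * \<Lambda> ^ l * D (i - j) + B' * (b * B / \<Lambda>) * (Mx + Mx)"
      using bd B B' \<Lambda> Mx ji by (intro add_left_mono mult_left_mono add_mono) auto
    also have "\<dots> = b * B * (2 * \<Lambda> ^ l * D (i - j) + 2 * B' * (Mx / \<Lambda>))" by (simp add: algebra_simps)
    finally show ?thesis .
  qed
  \<comment> \<open>The reciprocals of the levels sum over r <= n to at most 2/(Kn), so the n
    telescoping steps together cost only a multiple of Mx/K.\<close>
  define F where "F r = 2 * (K * (real n * sqrt (real n) * sqrt (real r))) ^ l * D r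
    + 2 * B' * (Mx / (K * (real n * sqrt (real n) * sqrt (real r))))" for r :: nat
  have D0: "0 \<le> D r" for r unfolding D_def using C by simp
  have F0: "0 \<le> F r" for r unfolding F_def using D0 B' Mx0 K by simp
  \<comment> \<open>Since W (n + 1) = 0, the power of W (j + 1) is the sum of its increments at i =
    j + 1, ..., n; they are indexed by the gap r = i - j.\<close>
  have step2: "expectation (\<lambda>x. a j x * W (Suc j) x ^ (2 * l + 1)) \<le> b * B * (\<Sum>r=1..n. F r)" if j: "1 \<le> j" "j \<le> n" for j
  proof -
    have tel: "W (Suc j) x ^ (2 * l + 1) = (\<Sum>i\<in>{Suc j..<Suc n}. W i x ^ (2 * l + 1) - W (Suc i) x ^ (2 * l + 1))" for x
    proof -
      have "(\<Sum>i\<in>{Suc j..<Suc n}. W (Suc i) x ^ (2 * l + 1) - W i x ^ (2 * l + 1)) = W (Suc n) x ^ (2 * l + 1) - W (Suc j) x ^ (2 * l + 1)"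
        using j by (intro sum_Suc_diff') auto
      then show ?thesis unfolding Wn by (simp add: sum_subtractf)
    qed
    have "expectation (\<lambda>x. a j x * W (Suc j) x ^ (2 * l + 1))
        = (\<Sum>i\<in>{Suc j..<Suc n}. expectation (\<lambda>x. a j x * (W i x ^ (2 * l + 1) - W (Suc i) x ^ (2 * l + 1))))"
      unfolding tel sum_distrib_left
      by (rule Bochner_Integration.integral_sum) (unfold right_diff_distrib, intro Bochner_Integration.integrable_diff inta)
    also have "\<dots> \<le> (\<Sum>i\<in>{Suc j..<Suc n}. b * B * F (i - j))"
    proof (rule sum_mono)
      fix i assume i: "i \<in> {Suc j..<Suc n}"
      show "expectation (\<lambda>x. a j x * (W i x ^ (2 * l + 1) - W (Suc i) x ^ (2 * l + 1))) \<le> b * B * F (i - j)"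
        unfolding F_def using i j n K by (intro order_trans[OF abs_ge_self step1]) auto
    qed
    also have "\<dots> = b * B * (\<Sum>i\<in>{Suc j..<Suc n}. F (i - j))" by (simp only: sum_distrib_left)
    also have "(\<Sum>i\<in>{Suc j..<Suc n}. F (i - j)) = (\<Sum>r\<in>(\<lambda>i. i - j) ` {Suc j..<Suc n}. F r)"
      by (subst sum.reindex) (auto simp: inj_on_def)
    also have "\<dots> \<le> (\<Sum>r=1..n. F r)" using F0 by (intro sum_mono2) auto
    finally show ?thesis using bd B by (simp add: mult_left_mono)
  qed
  define R where "R = d * (b * B * (\<Sum>r=1..n. F r)) + d\<^sup>2 * B\<^sup>2 * (2 * (K * real n) ^ l + 2 * (Mx / (K * real n)))"
  have step3: "E j - E (Suc j) \<le> R" if j: "1 \<le> j" "j \<le> n" for j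
  proof -
    \<comment> \<open>The first-order Taylor term is the covariance of the previous step. The
      second-order term is of degree 2l and is split at the level Kn.\<close>
    have pt: "W j x ^ (2 * l + 2) - W (Suc j) x ^ (2 * l + 2)
        \<le> d * (a j x * W (Suc j) x ^ (2 * l + 1)) + d\<^sup>2 * B\<^sup>2 * (W j x ^ (2 * l) + W (Suc j) x ^ (2 * l))" if x: "x \<in> space M" for x
    proof -
      have "W j x ^ (2 * l + 2) - W (Suc j) x ^ (2 * l + 2) - d * a j x * W (Suc j) x ^ (2 * l + 1)
          \<le> d\<^sup>2 * (a j x)\<^sup>2 * max \<bar>W (Suc j) x\<bar> \<bar>W j x\<bar> ^ (2 * l)"
        using power_taylor_bound[of "W (Suc j) x" "max \<bar>W (Suc j) x\<bar> \<bar>W j x\<bar>" "a j x" "2 * l"] Wrec[of j x] j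
        by (simp add: d_def)
      also have "\<dots> \<le> d\<^sup>2 * B\<^sup>2 * (W (Suc j) x ^ (2 * l) + W j x ^ (2 * l))"
        using B(2)[OF x, of j] B(1) by (intro mult_mono even_power_max_le mult_left_mono) (auto simp: abs_le_square_iff[symmetric])
      finally show ?thesis by (simp add: algebra_simps)
    qed
    have "E j - E (Suc j) = expectation (\<lambda>x. W j x ^ (2 * l + 2) - W (Suc j) x ^ (2 * l + 2))"
      unfolding E_def by (rule Bochner_Integration.integral_diff[symmetric]) (rule int)+
    also have "\<dots> \<le> expectation (\<lambda>x. d * (a j x * W (Suc j) x ^ (2 * l + 1)) + d\<^sup>2 * B\<^sup>2 * (W j x ^ (2 * l) + W (Suc j) x ^ (2 * l)))"
      by (intro integral_mono pt Bochner_Integration.integrable_add Bochner_Integration.integrable_diff integrable_mult_right int inta)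
    also have "\<dots> = d * expectation (\<lambda>x. a j x * W (Suc j) x ^ (2 * l + 1))
        + d\<^sup>2 * B\<^sup>2 * (expectation (\<lambda>x. W j x ^ (2 * l)) + expectation (\<lambda>x. W (Suc j) x ^ (2 * l)))"
    proof -
      have "integrable M (\<lambda>x. W j x ^ (2 * l))" "integrable M (\<lambda>x. W (Suc j) x ^ (2 * l))"
        "integrable M (\<lambda>x. a j x * W (Suc j) x ^ (2 * l + 1))" by (rule int inta)+
      then show ?thesis by (simp del: power_Suc)
    qed
    also have "\<dots> \<le> d * (b * B * (\<Sum>r=1..n. F r)) + d\<^sup>2 * B\<^sup>2 * (((K * real n) ^ l + Mx / (K * real n)) + ((K * real n) ^ l + Mx / (K * real n)))"
      using bd j K n by (intro add_mono mult_left_mono step2 young) auto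
    also have "\<dots> = R" by (simp add: R_def)
    finally show ?thesis .
  qed
  have R0: "0 \<le> R" unfolding R_def using bd B K Mx0 F0 by (intro add_nonneg_nonneg mult_nonneg_nonneg sum_nonneg) auto
  have step4: "E m \<le> real n * R" if m: "1 \<le> m" "m \<le> n + 1" for m
  proof -
    have "(\<Sum>j\<in>{m..<Suc n}. E (Suc j) - E j) = E (Suc n) - E m" using m by (intro sum_Suc_diff') auto
    moreover have "E (Suc n) = 0" unfolding E_def Wn by simp
    ultimately have "E m = (\<Sum>j\<in>{m..<Suc n}. E j - E (Suc j))" by (simp add: sum_subtractf)
    also have "\<dots> \<le> (\<Sum>j\<in>{m..<Suc n}. R)" using m by (intro sum_mono step3) auto
    also have "\<dots> \<le> real n * R" using m R0 by (auto intro!: mult_right_mono)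
    finally show ?thesis .
  qed
  have "Mx \<le> real n * R" unfolding Mx_def using step4 by (intro Max.boundedI) auto
  define L where "L = ln (real n) powr \<gamma>"
  define P where "P = real n powr (d - \<gamma>)"
  have n0: "0 < real n" "1 \<le> real n" using n by auto
  have lnn: "1 \<le> ln (real n)"
  proof -
    have "exp 1 \<le> (3 :: real)" by (rule exp_le)
    also have "\<dots> \<le> real n" using n by simp
    finally show ?thesis using n by (subst ln_ge_iff) auto
  qed
  have L1: "1 \<le> L" unfolding L_def using lnn \<gamma> by (intro ge_one_powr_ge_zero) auto
  have sumF: "real n * (\<Sum>r=1..n. F r) \<le> 2 * C * K ^ l * (P * L) + 4 * B' * Mx / K"
  proof -
    have Fr: "F r \<le> 2 * C * K ^ l * L * real n powr (real (2 * l) - \<gamma>) + 2 * B' * Mx / (K * (real n * sqrt (real n))) * (1 / sqrt (real r))"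
      if r: "r \<in> {1..n}" for r
    proof -
      have r0: "0 < real r" "real r \<le> real n" using r by auto
      have "(K * (real n * sqrt (real n) * sqrt (real r))) ^ l * D r
          = C * K ^ l * L * ((real n * sqrt (real n)) ^ l * (sqrt (real r) ^ l * real r powr - \<gamma>))"
        unfolding D_def L_def using lnn r0 by (simp add: power_mult_distrib powr_divide powr_minus field_simps)
      also have "sqrt (real r) ^ l * real r powr - \<gamma> = real r powr (real l / 2 - \<gamma>)"
        using r0 by (simp add: powr_half_sqrt[symmetric] powr_realpow[symmetric] powr_powr powr_add[symmetric])
      also have "(real n * sqrt (real n)) ^ l = real n powr (3 / 2 * real l)"
        using n0 by (simp add: powr_half_sqrt[symmetric] powr_realpow[symmetric] powr_powr powr_add[symmetric] powr_mult_base)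
      \<comment> \<open>Here 2\<gamma> <= l enters: the exponent l/2 - \<gamma> is nonnegative, so
        each gap may be replaced by the largest one.\<close>
      also have "C * K ^ l * L * (real n powr (3 / 2 * real l) * real r powr (real l / 2 - \<gamma>))
          \<le> C * K ^ l * L * (real n powr (3 / 2 * real l) * real n powr (real l / 2 - \<gamma>))"
        using r0 \<gamma> C K L1 by (intro mult_left_mono powr_mono2) auto
      also have "real n powr (3 / 2 * real l) * real n powr (real l / 2 - \<gamma>) = real n powr (real (2 * l) - \<gamma>)"
        by (simp add: powr_add[symmetric])
      finally have "2 * (K * (real n * sqrt (real n) * sqrt (real r))) ^ l * D r \<le> 2 * C * K ^ l * L * real n powr (real (2 * l) - \<gamma>)"
        by simp
      moreover have "2 * B' * (Mx / (K * (real n * sqrt (real n) * sqrt (real r)))) = 2 * B' * Mx / (K * (real n * sqrt (real n))) * (1 / sqrt (real r))"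
        by simp
      ultimately show ?thesis unfolding F_def by linarith
    qed
    have "(\<Sum>r=1..n. F r) \<le> (\<Sum>r=1..n. 2 * C * K ^ l * L * real n powr (real (2 * l) - \<gamma>) + 2 * B' * Mx / (K * (real n * sqrt (real n))) * (1 / sqrt (real r)))"
      by (intro sum_mono Fr)
    also have "\<dots> = real n * (2 * C * K ^ l * L * real n powr (real (2 * l) - \<gamma>)) + 2 * B' * Mx / (K * (real n * sqrt (real n))) * (\<Sum>r=1..n. 1 / sqrt (real r))"
      by (simp add: sum.distrib sum_distrib_left)
    also have "\<dots> \<le> real n * (2 * C * K ^ l * L * real n powr (real (2 * l) - \<gamma>)) + 2 * B' * Mx / (K * (real n * sqrt (real n))) * (2 * sqrt (real n))"
      using B' Mx0 K n0 by (intro add_left_mono mult_left_mono sum_inverse_sqrt_le) auto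
    finally have "real n * (\<Sum>r=1..n. F r) \<le> real n * (real n * (2 * C * K ^ l * L * real n powr (real (2 * l) - \<gamma>)) + 2 * B' * Mx / (K * (real n * sqrt (real n))) * (2 * sqrt (real n)))"
      using n0 by (intro mult_left_mono) auto
    also have "\<dots> = 2 * C * K ^ l * L * (real n * real n * real n powr (real (2 * l) - \<gamma>)) + 4 * B' * Mx / K"
      using n0 K by (simp add: field_simps)
    also have "real n * real n * real n powr (real (2 * l) - \<gamma>) = P"
    proof -
      have "P = real n powr 2 * real n powr (real (2 * l) - \<gamma>)"
        unfolding P_def d_def powr_add[symmetric] by (simp add: algebra_simps)
      then show ?thesis using n0 by (simp add: power2_eq_square)
    qed
    finally show ?thesis by (simp add: mult.commute mult.left_commute)
  qed
  \<comment> \<open>The second-order terms have order n^(l+1), and l + 1 <= 2l + 2 -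
    \<gamma>.\<close>
  have pow: "real n * (K * real n) ^ l \<le> K ^ l * (P * L)"
  proof -
    have "real n * (K * real n) ^ l = K ^ l * real n powr (real l + 1)"
      using n0 by (simp add: power_mult_distrib powr_add powr_realpow)
    also have "\<dots> \<le> K ^ l * (P * 1)" unfolding P_def d_def using K n0 \<gamma> by (auto intro!: mult_left_mono powr_mono)
    also have "\<dots> \<le> K ^ l * (P * L)" using K L1 by (intro mult_left_mono) (auto simp: P_def)
    finally show ?thesis .
  qed
  have "Mx \<le> d * b * B * (real n * (\<Sum>r=1..n. F r)) + d\<^sup>2 * B\<^sup>2 * (2 * (real n * (K * real n) ^ l) + 2 * Mx / K)"
    using \<open>Mx \<le> real n * R\<close> n0 K by (simp add: R_def algebra_simps)
  also have "\<dots> \<le> d * b * B * (2 * C * K ^ l * (P * L) + 4 * B' * Mx / K) + d\<^sup>2 * B\<^sup>2 * (2 * (K ^ l * (P * L)) + 2 * Mx / K)"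
    using bd B sumF pow by (intro add_mono mult_left_mono order_refl) auto
  also have "\<dots> = (2 * d * b * B * C * K ^ l + 2 * d\<^sup>2 * B\<^sup>2 * K ^ l) * (P * L) + (4 * d * b * B * B' + 2 * d\<^sup>2 * B\<^sup>2) / K * Mx"
    by (simp add: algebra_simps add_divide_distrib)
  also have "\<dots> \<le> (2 * d * b * B * C * K ^ l + 2 * d\<^sup>2 * B\<^sup>2 * K ^ l) * (P * L) + 1 / 2 * Mx"
    using K Mx0 by (intro add_left_mono mult_right_mono) (auto simp: K_def field_simps)
  finally have fin: "Mx \<le> (2 * d * b * B * C * K ^ l + 2 * d\<^sup>2 * B\<^sup>2 * K ^ l) * (P * L) + 1 / 2 * Mx" .
  have "Mx \<le> q + 1 / 2 * Mx \<Longrightarrow> Mx \<le> 2 * q" for q by simp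
  from this[OF fin] have "Mx \<le> 2 * (2 * d * b * B * C * K ^ l + 2 * d\<^sup>2 * B\<^sup>2 * K ^ l) * (P * L)"
    by (simp only: mult.assoc)
  also have "\<dots> = moment_const l B B' C * P * L"
    unfolding moment_const_def Let_def b_def d_def K_def by (simp only: mult.assoc)
  finally show ?thesis using Mx[of 1] by (simp add: E_def P_def L_def d_def)
qed

section \<open>Covariances and moments along a fixed parameter sequence\<close>

lemma orbit_fold: "orbit \<omega> j x = fold intermittent_map (map \<omega> [0..<j]) x"
  by (induction j) auto

lemma orbit_split: "j \<le> i \<Longrightarrow> orbit \<omega> i x = fold intermittent_map (map \<omega> [j..<i]) (orbit \<omega> j x)"
  unfolding orbit_fold using upt_add_eq_append[of 0 j "i - j"] by simp

text \<open>Stands in for continuous differentiability: the class contains the observable and its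
  centred versions, and it approximates arbitrary integrable functions in L^1.\<close>

definition lipschitz_bounded :: "real \<Rightarrow> real \<Rightarrow> (real \<Rightarrow> real) \<Rightarrow> bool"
  where "lipschitz_bounded B \<Lambda> g \<longleftrightarrow> 0 \<le> \<Lambda> \<and> (\<forall>x\<in>{0..1}. \<bar>g x\<bar> \<le> B) \<and>
    (\<forall>x\<in>{0..1}. \<forall>y\<in>{0..1}. \<bar>g x - g y\<bar> \<le> \<Lambda> * \<bar>x - y\<bar>)"

lemma lipschitz_boundedD:
  assumes "lipschitz_bounded B \<Lambda> g"
  shows "0 \<le> \<Lambda>" "x \<in> {0..1} \<Longrightarrow> \<bar>g x\<bar> \<le> B" "x \<in> {0..1} \<Longrightarrow> y \<in> {0..1} \<Longrightarrow> \<bar>g x - g y\<bar> \<le> \<Lambda> * \<bar>x - y\<bar>" "0 \<le> B"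
  using assms order_trans[OF abs_ge_zero, of "g 0" B] unfolding lipschitz_bounded_def by auto

lemma lipschitz_measurable:
  assumes "lipschitz_bounded B \<Lambda> g"
  shows "g \<in> borel_measurable leb"
proof -
  have "\<Lambda>-lipschitz_on {0..1} g"
    using lipschitz_boundedD[OF assms] by (intro lipschitz_onI) (auto simp: dist_real_def)
  then have "continuous_on {0..1} g" by (rule lipschitz_on_continuous_on)
  then show ?thesis unfolding measurable_leb_cong by (rule borel_measurable_continuous_on_restrict)
qed

text \<open>Multiplication by \<psi> can spoil only the increasing condition, by at most \<Lambda>
  y^(1+\<alpha>) f(y)(y - x) <= \<Lambda> M y^\<alpha> (y - x), where M is the mass of f. The added
  constant \<Lambda>M gains \<Lambda>M(y^(1+\<alpha>) - x^(1+\<alpha>)), which is at least as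
  much.\<close>

lemma density_cone_mult:
  assumes a: "0 < \<alpha>" "\<alpha> < 1" and f: "density_cone \<alpha> A f" and m: "\<psi> \<in> borel_measurable leb"
    and \<psi>: "\<And>x. x \<in> {0..1} \<Longrightarrow> 0 \<le> \<psi> x \<and> \<psi> x \<le> \<Psi>"
    and dec: "\<And>x y. 0 < x \<Longrightarrow> x \<le> y \<Longrightarrow> y \<le> 1 \<Longrightarrow> \<psi> y \<le> \<psi> x \<and> \<psi> x - \<psi> y \<le> \<Lambda> * (y - x)" and \<Lambda>: "0 \<le> \<Lambda>"
  shows "density_cone \<alpha> ((\<Psi> + \<Lambda>) * A) (\<lambda>x. f x * \<psi> x + \<Lambda> * (\<integral>x. f x \<partial>leb))"
proof -
  have reg: "regular_density \<alpha> f" and le: "\<And>x. 0 < x \<Longrightarrow> x \<le> 1 \<Longrightarrow> f x \<le> A * x powr - \<alpha>"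
    and mass: "(\<integral>x. f x \<partial>leb) \<le> (1 - \<alpha>) / 2 * A" using f by (auto simp: density_cone_def)
  note fD = regular_densityD[OF reg]
  define M where "M = (\<integral>x. f x \<partial>leb)"
  have M: "0 \<le> M" unfolding M_def using fD(2) by (intro integral_nonneg_AE AE_I2) auto
  have A: "0 \<le> A" using order_trans[OF fD(2)[of 1] le[of 1]] by simp
  have MA: "M \<le> A" using mass A a mult_right_mono[of "(1 - \<alpha>) / 2" 1 A] by (simp add: M_def)
  have P: "0 \<le> \<Psi>" using \<psi>[of 0] by auto
  have i: "integrable leb (\<lambda>x. f x * \<psi> x)" by (rule integrable_mult_bounded[OF fD(1) m, of \<Psi>]) (use \<psi> in auto)
  show ?thesis
    unfolding density_cone_def regular_density_def M_def[symmetric]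
  proof (intro conjI allI impI ballI)
    show "integrable leb (\<lambda>x. f x * \<psi> x + \<Lambda> * M)" using i by simp
    show "0 \<le> f x * \<psi> x + \<Lambda> * M" if "x \<in> {0..1}" for x using fD(2)[OF that] \<psi>[OF that] \<Lambda> M by simp
    show "f x * \<psi> x + \<Lambda> * M \<le> (\<Psi> + \<Lambda>) * A * x powr - \<alpha>" if x: "0 < x" "x \<le> 1" for x
    proof -
      have "f x * \<psi> x \<le> A * x powr - \<alpha> * \<Psi>" using le[OF x] \<psi>[of x] x A fD(2)[of x] by (intro mult_mono) auto
      moreover have "1 \<le> x powr - \<alpha>" using x a powr_mono2'[of "- \<alpha>" x 1] by simp
      then have "\<Lambda> * M * 1 \<le> \<Lambda> * A * x powr - \<alpha>" using MA \<Lambda> M A by (intro mult_mono) auto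
      ultimately show ?thesis by (simp add: algebra_simps)
    qed
    have "(\<integral>x. f x * \<psi> x + \<Lambda> * M \<partial>leb) = (\<integral>x. f x * \<psi> x \<partial>leb) + \<Lambda> * M" using i leb.prob_space by simp
    also have "\<dots> \<le> (\<integral>x. f x * \<Psi> \<partial>leb) + \<Lambda> * M"
      by (intro add_right_mono integral_leb_mono i mult_left_mono) (use fD \<psi> in auto)
    also have "\<dots> = (\<Psi> + \<Lambda>) * M" by (simp add: M_def algebra_simps)
    also have "\<dots> \<le> (\<Psi> + \<Lambda>) * ((1 - \<alpha>) / 2 * A)" using mass P \<Lambda> by (intro mult_left_mono) (auto simp: M_def)
    finally show "(\<integral>x. f x * \<psi> x + \<Lambda> * M \<partial>leb) \<le> (1 - \<alpha>) / 2 * ((\<Psi> + \<Lambda>) * A)" by (simp add: mult.commute mult.left_commute)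
    fix x y :: real assume xy: "0 < x" "x \<le> y" "y \<le> 1"
    show "f y * \<psi> y + \<Lambda> * M \<le> f x * \<psi> x + \<Lambda> * M"
      using fD(3)[OF xy] dec[OF xy] \<psi>[of y] fD(2)[of x] xy by (intro add_right_mono mult_mono) auto
    have "x powr (1 + \<alpha>) * f x * \<psi> x \<le> y powr (1 + \<alpha>) * f y * \<psi> x"
      using fD(4)[OF xy] \<psi>[of x] xy by (intro mult_right_mono) auto
    also have "\<dots> \<le> y powr (1 + \<alpha>) * f y * (\<psi> y + \<Lambda> * (y - x))"
      using dec[OF xy] fD(2)[of y] xy by (intro mult_left_mono) auto
    finally have 1: "x powr (1 + \<alpha>) * (f x * \<psi> x) \<le> y powr (1 + \<alpha>) * (f y * \<psi> y) + y powr (1 + \<alpha>) * f y * (\<Lambda> * (y - x))"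
      by (simp add: algebra_simps)
    have "y powr (1 + \<alpha>) * f y * (\<Lambda> * (y - x)) = y powr \<alpha> * (\<Lambda> * (y - x)) * (y * f y)"
      using xy by (simp add: powr_add)
    also have "\<dots> \<le> y powr \<alpha> * (\<Lambda> * (y - x)) * M"
      unfolding M_def using regular_density_le_mass[OF reg, of y] xy \<Lambda> by (intro mult_left_mono) auto
    finally have 2: "y powr (1 + \<alpha>) * f y * (\<Lambda> * (y - x)) \<le> \<Lambda> * M * (y powr \<alpha> * (y - x))"
      by (simp add: mult_ac)
    have "x powr (1 + \<alpha>) + y powr \<alpha> * (y - x) \<le> y powr (1 + \<alpha>)"
      using powr_mono2[of \<alpha> x y] xy a mult_left_mono[of "x powr \<alpha>" "y powr \<alpha>" x] by (simp add: powr_add algebra_simps)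
    then have "\<Lambda> * M * (x powr (1 + \<alpha>) + y powr \<alpha> * (y - x)) \<le> \<Lambda> * M * y powr (1 + \<alpha>)"
      using \<Lambda> M by (intro mult_left_mono) auto
    with 1 2 show "x powr (1 + \<alpha>) * (f x * \<psi> x + \<Lambda> * M) \<le> y powr (1 + \<alpha>) * (f y * \<psi> y + \<Lambda> * M)"
      by (simp add: algebra_simps)
  qed
qed

text \<open>Write g as (g - \<Lambda>x + B + \<Lambda>) - (B + \<Lambda> - \<Lambda>x), two
  nonnegative decreasing factors bounded by 2B + \<Lambda>. Both are treated with Lipschitz constant
  2\<Lambda>, so that the added constants cancel in the difference.\<close>

lemma lipschitz_mult_split:
  assumes a: "0 < \<alpha>" "\<alpha> < 1" and f: "density_cone \<alpha> A f" and g: "lipschitz_bounded B \<Lambda> g"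
  obtains f1 f2 where "density_cone \<alpha> ((2 * B + 3 * \<Lambda>) * A) f1" "density_cone \<alpha> ((2 * B + 3 * \<Lambda>) * A) f2"
    "\<And>x. f1 x - f2 x = f x * g x"
proof
  note gD = lipschitz_boundedD[OF g]
  have m: "g \<in> borel_measurable leb" by (rule lipschitz_measurable[OF g])
  have e: "2 * B + \<Lambda> + 2 * \<Lambda> = 2 * B + 3 * \<Lambda>" by simp
  have bnd: "0 \<le> \<Lambda> * x \<and> \<Lambda> * x \<le> \<Lambda>" if "x \<in> {0..1}" for x using that gD(1) by (auto simp: mult_left_le)
  show "density_cone \<alpha> ((2 * B + 3 * \<Lambda>) * A) (\<lambda>x. f x * (g x - \<Lambda> * x + (B + \<Lambda>)) + 2 * \<Lambda> * (\<integral>x. f x \<partial>leb))"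
    unfolding e[symmetric]
  proof (rule density_cone_mult[OF a f])
    show "(\<lambda>x. g x - \<Lambda> * x + (B + \<Lambda>)) \<in> borel_measurable leb" using m by measurable
    show "0 \<le> g x - \<Lambda> * x + (B + \<Lambda>) \<and> g x - \<Lambda> * x + (B + \<Lambda>) \<le> 2 * B + \<Lambda>" if "x \<in> {0..1}" for x
      using gD(2)[OF that] bnd[OF that] by auto
    show "g y - \<Lambda> * y + (B + \<Lambda>) \<le> g x - \<Lambda> * x + (B + \<Lambda>) \<and>
      g x - \<Lambda> * x + (B + \<Lambda>) - (g y - \<Lambda> * y + (B + \<Lambda>)) \<le> 2 * \<Lambda> * (y - x)" if "0 < x" "x \<le> y" "y \<le> 1" for x y
      using gD(3)[of x y] that by (auto simp: abs_le_iff algebra_simps)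
  qed (use gD in auto)
  show "density_cone \<alpha> ((2 * B + 3 * \<Lambda>) * A) (\<lambda>x. f x * (B + \<Lambda> - \<Lambda> * x) + 2 * \<Lambda> * (\<integral>x. f x \<partial>leb))"
    unfolding e[symmetric]
  proof (rule density_cone_mult[OF a f])
    show "(\<lambda>x. B + \<Lambda> - \<Lambda> * x) \<in> borel_measurable leb" by measurable
    show "0 \<le> B + \<Lambda> - \<Lambda> * x \<and> B + \<Lambda> - \<Lambda> * x \<le> 2 * B + \<Lambda>" if "x \<in> {0..1}" for x
      using gD(4) bnd[OF that] by auto
    show "B + \<Lambda> - \<Lambda> * y \<le> B + \<Lambda> - \<Lambda> * x \<and> B + \<Lambda> - \<Lambda> * x - (B + \<Lambda> - \<Lambda> * y) \<le> 2 * \<Lambda> * (y - x)"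
      if "0 < x" "x \<le> y" "y \<le> 1" for x y
      using that gD(1) mult_left_mono[of x y \<Lambda>] by (auto simp: algebra_simps)
  qed (use gD in auto)
qed (simp add: algebra_simps)

text \<open>Zero mean says that the two cone densities of the splitting have equal mass, so loss of
  memory applies to them.\<close>

lemma push_lipschitz_decay:
  assumes a: "0 < \<alpha>" "\<alpha> < 1" and C: "loss_bound \<alpha> C" and f: "density_cone \<alpha> A f" and g: "lipschitz_bounded B \<Lambda> g"
    and zero: "(\<integral>x. f x * g x \<partial>leb) = 0" and N: "3 \<le> N" and bs: "bs \<noteq> []" "length bs \<le> N" "set bs \<subseteq> {0<..\<alpha>}"
  shows "(\<integral>x. \<bar>push bs (\<lambda>x. f x * g x) x\<bar> \<partial>leb) \<le> C * ((2 * B + 3 * \<Lambda>) * A) * (ln (real N) / real (length bs)) powr (1 / \<alpha> - 1)"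
proof -
  obtain f1 f2 where s: "density_cone \<alpha> ((2 * B + 3 * \<Lambda>) * A) f1" "density_cone \<alpha> ((2 * B + 3 * \<Lambda>) * A) f2"
    "\<And>x. f1 x - f2 x = f x * g x" using lipschitz_mult_split[OF a f g] by metis
  have i: "integrable leb f1" "integrable leb f2" using s by (auto simp: density_cone_def regular_density_def)
  have "(\<integral>x. f1 x \<partial>leb) - (\<integral>x. f2 x \<partial>leb) = (\<integral>x. f1 x - f2 x \<partial>leb)" using i by simp
  then have "(\<integral>x. f1 x \<partial>leb) = (\<integral>x. f2 x \<partial>leb)" unfolding s(3) zero by simp
  from loss_boundD(2)[OF C N bs s(1,2) this] show ?thesis unfolding s(3) .
qed

text \<open>The past \<open>as\<close> turns Lebesgue measure into a cone density \<rho>; \<rho>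
  times the centred observable has mean zero, and its image h under \<open>bs\<close> is small in
  L^1. The bounded part \<kappa> of g is integrated against this decay. On the part v only |h| <= 2B
  times the image of \<rho> is used, which costs the expectation of v. The 4B arises because
  centring doubles the bound on the observable.\<close>

lemma covariance_bound:
  assumes a: "0 < \<alpha>" "\<alpha> < 1" and C: "loss_bound \<alpha> C" and \<phi>: "lipschitz_bounded B \<Lambda> \<phi>"
    and as: "set as \<subseteq> {0<..\<alpha>}" and N: "3 \<le> N" and bs: "bs \<noteq> []" "length bs \<le> N" "set bs \<subseteq> {0<..\<alpha>}"
    and g: "g \<in> borel_measurable leb" "\<And>x. x \<in> {0..1} \<Longrightarrow> \<bar>g x\<bar> \<le> \<kappa> + v x"
    and v: "v \<in> borel_measurable leb" "\<And>x. x \<in> {0..1} \<Longrightarrow> 0 \<le> v x \<and> v x \<le> V" and \<kappa>: "0 \<le> \<kappa>"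
  shows "\<bar>\<integral>x. (\<phi> (fold intermittent_map as x) - (\<integral>x. \<phi> (fold intermittent_map as x) \<partial>leb))
      * g (fold intermittent_map bs (fold intermittent_map as x)) \<partial>leb\<bar>
    \<le> \<kappa> * (C * ((4 * B + 3 * \<Lambda>) * (2 / (1 - \<alpha>))) * (ln (real N) / real (length bs)) powr (1 / \<alpha> - 1))
      + 2 * B * (\<integral>x. v (fold intermittent_map bs (fold intermittent_map as x)) \<partial>leb)"
proof -
  define c where "c = (\<integral>x. \<phi> (fold intermittent_map as x) \<partial>leb)"
  define \<rho> where "\<rho> = push as (\<lambda>x. 1)"
  define \<psi> where "\<psi> = (\<lambda>x. \<phi> x - c)"
  define h where "h = push bs (\<lambda>x. \<rho> x * \<psi> x)"
  note \<phi>D = lipschitz_boundedD[OF \<phi>] and pa = positive_parameters[OF as] and pb = positive_parameters[OF bs(3)]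
  have \<phi>m: "\<phi> \<in> borel_measurable leb" by (rule lipschitz_measurable[OF \<phi>])
  have \<rho>: "density_cone \<alpha> (2 / (1 - \<alpha>)) \<rho>" unfolding \<rho>_def by (rule density_cone_push[OF density_cone_one[OF a] as a(2)])
  have i1: "integrable leb (\<lambda>x. 1 :: real)" by simp
  have i\<rho>: "integrable leb \<rho>" unfolding \<rho>_def by (rule push_integrable[OF pa i1])
  have \<rho>1: "(\<integral>x. \<rho> x \<partial>leb) = 1" unfolding \<rho>_def using integral_push[OF pa i1] leb.prob_space by simp
  have \<rho>0: "0 \<le> \<rho> x" if "x \<in> {0..1}" for x
    using \<rho> that by (auto simp: density_cone_def regular_density_def)
  have dual: "(\<integral>x. \<rho> x * q x \<partial>leb) = (\<integral>x. q (fold intermittent_map as x) \<partial>leb)"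
    if "q \<in> borel_measurable leb" "\<And>x. x \<in> {0..1} \<Longrightarrow> \<bar>q x\<bar> \<le> Q" for q Q
    using push_dual[OF pa i1 that] by (simp add: \<rho>_def)
  have c\<rho>: "c = (\<integral>x. \<rho> x * \<phi> x \<partial>leb)" unfolding c_def using dual[OF \<phi>m \<phi>D(2)] ..
  have i\<phi>: "integrable leb (\<lambda>x. \<rho> x * \<phi> x)" by (rule integrable_mult_bounded[OF i\<rho> \<phi>m \<phi>D(2)])
  have cB: "\<bar>c\<bar> \<le> B"
  proof -
    have "\<bar>c\<bar> \<le> (\<integral>x. \<bar>\<rho> x * \<phi> x\<bar> \<partial>leb)" unfolding c\<rho> by (rule integral_abs_bound)
    also have "\<dots> \<le> (\<integral>x. \<rho> x * B \<partial>leb)"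
      by (rule integral_leb_mono[OF integrable_abs[OF i\<phi>]])
        (use i\<rho> \<rho>0 \<phi>D(2) in \<open>auto simp: abs_mult intro!: mult_left_mono\<close>)
    finally show ?thesis using \<rho>1 by simp
  qed
  have \<psi>L: "lipschitz_bounded (2 * B) \<Lambda> \<psi>"
    unfolding lipschitz_bounded_def \<psi>_def
  proof (intro conjI ballI)
    fix x :: real assume x: "x \<in> {0..1}"
    show "\<bar>\<phi> x - c\<bar> \<le> 2 * B" using \<phi>D(2)[OF x] cB by linarith
  qed (use \<phi>D in auto)
  note \<psi>D = lipschitz_boundedD[OF \<psi>L]
  have \<psi>m: "\<psi> \<in> borel_measurable leb" by (rule lipschitz_measurable[OF \<psi>L])
  have i\<psi>: "integrable leb (\<lambda>x. \<rho> x * \<psi> x)" by (rule integrable_mult_bounded[OF i\<rho> \<psi>m \<psi>D(2)])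
  have zero: "(\<integral>x. \<rho> x * \<psi> x \<partial>leb) = 0"
    unfolding \<psi>_def right_diff_distrib using i\<phi> i\<rho> c\<rho> \<rho>1 by simp
  have ih: "integrable leb h" unfolding h_def by (rule push_integrable[OF pb i\<psi>])
  have G: "\<bar>g x\<bar> \<le> \<kappa> + V" if "x \<in> {0..1}" for x using g(2)[OF that] v(2)[OF that] by linarith
  have "(\<integral>x. \<psi> (fold intermittent_map as x) * g (fold intermittent_map bs (fold intermittent_map as x)) \<partial>leb)
      = (\<integral>x. \<rho> x * (\<psi> x * g (fold intermittent_map bs x)) \<partial>leb)"
  proof (rule dual[symmetric, where Q="2 * B * (\<kappa> + V)"])
    show "(\<lambda>x. \<psi> x * g (fold intermittent_map bs x)) \<in> borel_measurable leb"
      using \<psi>m measurable_compose[OF fold_intermittent_measurable[OF pb] g(1)] by measurable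
    fix x :: real assume x: "x \<in> {0..1}"
    show "\<bar>\<psi> x * g (fold intermittent_map bs x)\<bar> \<le> 2 * B * (\<kappa> + V)"
      unfolding abs_mult using \<psi>D(2)[OF x] G[OF fold_intermittent_in[OF pb x]] \<psi>D(4) by (intro mult_mono) auto
  qed
  also have "\<dots> = (\<integral>x. h x * g x \<partial>leb)"
    using push_dual[OF pb i\<psi> g(1) G] by (simp add: h_def mult.assoc)
  finally have eq: "(\<integral>x. \<psi> (fold intermittent_map as x) * g (fold intermittent_map bs (fold intermittent_map as x)) \<partial>leb)
    = (\<integral>x. h x * g x \<partial>leb)" .
  have ihv: "integrable leb (\<lambda>x. \<bar>h x\<bar> * v x)"
    by (rule integrable_mult_bounded[OF integrable_abs[OF ih] v(1), of V]) (use v(2) in auto)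
  have "\<bar>\<integral>x. h x * g x \<partial>leb\<bar> \<le> (\<integral>x. \<bar>h x * g x\<bar> \<partial>leb)" by (rule integral_abs_bound)
  also have "\<dots> \<le> (\<integral>x. \<kappa> * \<bar>h x\<bar> + \<bar>h x\<bar> * v x \<partial>leb)"
  proof (rule integral_leb_mono)
    show "integrable leb (\<lambda>x. \<bar>h x * g x\<bar>)" using integrable_mult_bounded[OF ih g(1) G] by simp
    show "integrable leb (\<lambda>x. \<kappa> * \<bar>h x\<bar> + \<bar>h x\<bar> * v x)" using ih ihv by simp
    fix x :: real assume "0 < x" "x \<le> 1"
    then have "\<bar>h x\<bar> * \<bar>g x\<bar> \<le> \<bar>h x\<bar> * (\<kappa> + v x)" using g(2)[of x] by (intro mult_left_mono) auto
    then show "\<bar>h x * g x\<bar> \<le> \<kappa> * \<bar>h x\<bar> + \<bar>h x\<bar> * v x" by (simp add: abs_mult algebra_simps)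
  qed
  also have "\<dots> = \<kappa> * (\<integral>x. \<bar>h x\<bar> \<partial>leb) + (\<integral>x. \<bar>h x\<bar> * v x \<partial>leb)" using ih ihv by simp
  also have "\<dots> \<le> \<kappa> * (C * ((2 * (2 * B) + 3 * \<Lambda>) * (2 / (1 - \<alpha>))) * (ln (real N) / real (length bs)) powr (1 / \<alpha> - 1))
      + 2 * B * (\<integral>x. v (fold intermittent_map bs (fold intermittent_map as x)) \<partial>leb)"
  proof (intro add_mono mult_left_mono \<kappa>)
    show "(\<integral>x. \<bar>h x\<bar> \<partial>leb) \<le> C * ((2 * (2 * B) + 3 * \<Lambda>) * (2 / (1 - \<alpha>))) * (ln (real N) / real (length bs)) powr (1 / \<alpha> - 1)"
      unfolding h_def by (rule push_lipschitz_decay[OF a C \<rho> \<psi>L zero N bs])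
    have i\<rho>': "integrable leb (push bs \<rho>)" by (rule push_integrable[OF pb i\<rho>])
    have iv: "integrable leb (\<lambda>x. push bs \<rho> x * v x)"
      by (rule integrable_mult_bounded[OF i\<rho>' v(1), of V]) (use v(2) in auto)
    have hle: "\<bar>h x\<bar> \<le> 2 * B * push bs \<rho> x" if x: "x \<in> {0<..1}" for x
    proof -
      have "\<bar>h x\<bar> \<le> push bs (\<lambda>x. \<bar>\<rho> x * \<psi> x\<bar>) x" unfolding h_def by (rule push_abs[OF pb x])
      also have "\<dots> \<le> push bs (\<lambda>x. 2 * B * \<rho> x) x"
      proof (rule push_mono[OF pb _ x])
        fix z :: real assume z: "z \<in> {0<..1}"
        then have "\<bar>\<psi> z\<bar> * \<rho> z \<le> 2 * B * \<rho> z" using \<psi>D(2)[of z] \<rho>0[of z] by (intro mult_right_mono) auto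
        then show "\<bar>\<rho> z * \<psi> z\<bar> \<le> 2 * B * \<rho> z" using \<rho>0[of z] z by (simp add: abs_mult mult.commute)
      qed
      finally show ?thesis unfolding push_linear .
    qed
    have "(\<integral>x. \<bar>h x\<bar> * v x \<partial>leb) \<le> (\<integral>x. 2 * B * (push bs \<rho> x * v x) \<partial>leb)"
    proof (rule integral_leb_mono)
      fix x :: real assume x: "0 < x" "x \<le> 1"
      then have "\<bar>h x\<bar> * v x \<le> 2 * B * push bs \<rho> x * v x" using hle[of x] v(2)[of x] by (intro mult_right_mono) auto
      then show "\<bar>h x\<bar> * v x \<le> 2 * B * (push bs \<rho> x * v x)" by simp
    qed (use ihv iv in auto)
    also have "\<dots> = 2 * B * (\<integral>x. push bs \<rho> x * v x \<partial>leb)" by simp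
    also have "(\<integral>x. push bs \<rho> x * v x \<partial>leb) = (\<integral>x. \<rho> x * v (fold intermittent_map bs x) \<partial>leb)"
      by (rule push_dual[OF pb i\<rho> v(1), of V]) (use v(2) in auto)
    also have "\<dots> = (\<integral>x. v (fold intermittent_map bs (fold intermittent_map as x)) \<partial>leb)"
      by (rule dual[of _ V])
        (use v fold_intermittent_in[OF pb] measurable_compose[OF fold_intermittent_measurable[OF pb] v(1)] in auto)
    finally show "(\<integral>x. \<bar>h x\<bar> * v x \<partial>leb) \<le> 2 * B * (\<integral>x. v (fold intermittent_map bs (fold intermittent_map as x)) \<partial>leb)" .
  qed
  finally have "\<bar>\<integral>x. h x * g x \<partial>leb\<bar> \<le> \<dots>" .
  then show ?thesis unfolding c_def[symmetric] eq[symmetric, unfolded \<psi>_def] by simp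
qed

text \<open>In \<open>moment_bound\<close> both \<open>B\<close> and \<open>B'\<close> become 2B:
  the first bounds the centred observable, the second is the coefficient of the v term in
  \<open>covariance_bound\<close>.\<close>

lemma sequential_moment:
  assumes a: "0 < \<alpha>" "\<alpha> < 1" and C: "loss_bound \<alpha> C" and \<phi>: "lipschitz_bounded B \<Lambda> \<phi>"
    and \<omega>: "\<And>i. \<omega> i \<in> {0<..\<alpha>}" and n: "3 \<le> n" and l: "2 * (1 / \<alpha> - 1) \<le> real l"
  shows "(\<integral>x. (\<Sum>j=1..n. \<phi> (orbit \<omega> j x) - (\<integral>x. \<phi> (orbit \<omega> j x) \<partial>leb)) ^ (2 * l + 2) \<partial>leb)
    \<le> moment_const l (2 * B) (2 * B) (C * ((4 * B + 3 * \<Lambda>) * (2 / (1 - \<alpha>))))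
      * real n powr (real (2 * l + 2) - (1 / \<alpha> - 1)) * ln (real n) powr (1 / \<alpha> - 1)"
proof -
  define c where "c j = (\<integral>x. \<phi> (orbit \<omega> j x) \<partial>leb)" for j
  define a' where "a' j x = \<phi> (orbit \<omega> j x) - c j" for j x
  note \<phi>D = lipschitz_boundedD[OF \<phi>]
  have \<phi>m: "\<phi> \<in> borel_measurable leb" by (rule lipschitz_measurable[OF \<phi>])
  have adm: "set (map \<omega> xs) \<subseteq> {0<..\<alpha>}" for xs using \<omega> by auto
  note pos = positive_parameters[OF adm]
  have fm: "(\<lambda>x. \<phi> (fold intermittent_map (map \<omega> xs) x)) \<in> borel_measurable leb" for xs
    by (rule measurable_compose[OF fold_intermittent_measurable[OF pos] \<phi>m])
  have fb: "\<bar>\<phi> (fold intermittent_map (map \<omega> xs) x)\<bar> \<le> B" if "x \<in> {0..1}" for xs x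
    by (rule \<phi>D(2)[OF fold_intermittent_in[OF pos that]])
  have cB: "\<bar>c j\<bar> \<le> B" for j
  proof -
    have i: "integrable leb (\<lambda>x. \<phi> (orbit \<omega> j x))"
      unfolding orbit_fold by (rule leb.integrable_const_bound[where B=B]) (use fm fb in auto)
    have "\<bar>c j\<bar> \<le> (\<integral>x. \<bar>\<phi> (orbit \<omega> j x)\<bar> \<partial>leb)" unfolding c_def by (rule integral_abs_bound)
    also have "\<dots> \<le> (\<integral>x. B \<partial>leb)"
      by (rule integral_leb_mono) (use i fb in \<open>auto simp: orbit_fold\<close>)
    finally show ?thesis using leb.prob_space by simp
  qed
  have bound: "\<bar>\<phi> (fold intermittent_map (map \<omega> xs) x) - c j\<bar> \<le> 2 * B" if "x \<in> {0..1}" for xs x j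
    using fb[OF that, of xs] cB[of j] by linarith
  have "(\<integral>x. (\<Sum>j\<in>{1..n}. a' j x) ^ (2 * l + 2) \<partial>leb)
    \<le> moment_const l (2 * B) (2 * B) (C * ((4 * B + 3 * \<Lambda>) * (2 / (1 - \<alpha>))))
      * real n powr (real (2 * l + 2) - (1 / \<alpha> - 1)) * ln (real n) powr (1 / \<alpha> - 1)"
  proof (rule leb.moment_bound[OF n, where a=a' and W="\<lambda>j x. \<Sum>i\<in>{j..n}. a' i x"])
    show "0 < 1 / \<alpha> - 1" using a by simp
    show "\<bar>a' j x\<bar> \<le> 2 * B" if "x \<in> space leb" for j x
      unfolding a'_def orbit_fold using bound that by simp
    show "a' j \<in> borel_measurable leb" for j
      unfolding a'_def[abs_def] orbit_fold using fm by measurable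
    show "0 \<le> C * ((4 * B + 3 * \<Lambda>) * (2 / (1 - \<alpha>)))" using loss_boundD(1)[OF C] \<phi>D(1,4) a by simp
    fix j i :: nat and \<kappa> \<tau> :: real
    assume ji: "1 \<le> j" "j < i" "i \<le> n" and \<kappa>: "0 \<le> \<kappa>" and \<tau>: "0 \<le> \<tau>"
      and H: "\<And>x. x \<in> space leb \<Longrightarrow> \<bar>(\<Sum>i\<in>{i..n}. a' i x) ^ (2 * l + 1) - (\<Sum>i\<in>{Suc i..n}. a' i x) ^ (2 * l + 1)\<bar>
        \<le> \<kappa> + \<tau> * ((\<Sum>i\<in>{i..n}. a' i x) ^ (2 * l + 2) + (\<Sum>i\<in>{Suc i..n}. a' i x) ^ (2 * l + 2))"
    define as bs where "as = map \<omega> [0..<j]" and "bs = map \<omega> [j..<i]"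
    \<comment> \<open>For p >= i the tail sums depend on x only through its position y at time
      i.\<close>
    define w where "w p y = (\<Sum>m\<in>{p..n}. \<phi> (fold intermittent_map (map \<omega> [i..<m]) y) - c m)" for p y
    define g where "g y = w i y ^ (2 * l + 1) - w (Suc i) y ^ (2 * l + 1)" for y
    define v where "v y = \<tau> * (w i y ^ (2 * l + 2) + w (Suc i) y ^ (2 * l + 2))" for y
    have T: "fold intermittent_map bs (fold intermittent_map as x) = orbit \<omega> i x" for x
      unfolding as_def bs_def using orbit_split[of j i \<omega> x] ji by (simp add: orbit_fold)
    have aw: "(\<Sum>m\<in>{p..n}. a' m x) = w p (orbit \<omega> i x)" if "i \<le> p" for p x
      unfolding w_def a'_def
    proof (rule sum.cong[OF refl])
      fix m assume "m \<in> {p..n}"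
      then have "i \<le> m" using that by simp
      show "\<phi> (orbit \<omega> m x) - c m = \<phi> (fold intermittent_map (map \<omega> [i..<m]) (orbit \<omega> i x)) - c m"
        unfolding orbit_split[OF \<open>i \<le> m\<close>, of \<omega> x] ..
    qed
    have wm: "w p \<in> borel_measurable leb" for p unfolding w_def[abs_def] using fm by measurable
    have wb: "\<bar>w p y\<bar> \<le> real n * (2 * B)" if "y \<in> {0..1}" "1 \<le> p" for p y
    proof -
      have "\<bar>w p y\<bar> \<le> (\<Sum>m\<in>{p..n}. 2 * B)"
        unfolding w_def by (rule order_trans[OF sum_abs sum_mono]) (use bound that in auto)
      also have "\<dots> \<le> real n * (2 * B)" using that \<phi>D(4) by (auto intro!: mult_right_mono)
      finally show ?thesis .
    qed
    have even: "0 \<le> z ^ (2 * l + 2)" for z :: real by (rule zero_le_even_power) simp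
    have V: "0 \<le> v y \<and> v y \<le> \<tau> * (2 * (real n * (2 * B)) ^ (2 * l + 2))" if y: "y \<in> {0..1}" for y
    proof -
      have "w p y ^ (2 * l + 2) \<le> (real n * (2 * B)) ^ (2 * l + 2)" if "1 \<le> p" for p
      proof -
        have "w p y ^ (2 * l + 2) = \<bar>w p y\<bar> ^ (2 * l + 2)" by (rule power_even_abs[symmetric]) simp
        also have "\<dots> \<le> (real n * (2 * B)) ^ (2 * l + 2)" using wb[OF y that] by (intro power_mono) auto
        finally show ?thesis .
      qed
      from this[of i] this[of "Suc i"] have "w i y ^ (2 * l + 2) + w (Suc i) y ^ (2 * l + 2) \<le> 2 * (real n * (2 * B)) ^ (2 * l + 2)"
        using ji by (simp del: power_Suc add: add_mono)
      then show ?thesis unfolding v_def using \<tau> even by (intro conjI mult_nonneg_nonneg add_nonneg_nonneg mult_left_mono)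
    qed
    \<comment> \<open>The hypothesis speaks of points x and their orbits; every y in the interval is
      the position at time i of some x.\<close>
    have gv: "\<bar>g y\<bar> \<le> \<kappa> + v y" if y: "y \<in> {0..1}" for y
    proof -
      have "set (as @ bs) \<subseteq> {0<..}" using \<omega> by (auto simp: as_def bs_def)
      from fold_intermittent_surj[OF this y] obtain x where x: "x \<in> {0..1}" "orbit \<omega> i x = y"
        using T by auto
      show ?thesis using H[of x] x unfolding g_def v_def aw[OF order_refl] aw[OF le_SucI[OF order_refl]] by simp
    qed
    have len: "bs \<noteq> []" "length bs \<le> n" "length bs = i - j" using ji by (auto simp: bs_def)
    have adm': "set as \<subseteq> {0<..\<alpha>}" "set bs \<subseteq> {0<..\<alpha>}" unfolding as_def bs_def by (rule adm)+
    have gm: "g \<in> borel_measurable leb" and vm: "v \<in> borel_measurable leb"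
      unfolding g_def[abs_def] v_def[abs_def] using wm by measurable
    from covariance_bound[OF a C \<phi> adm'(1) n len(1,2) adm'(2) gm gv vm V \<kappa>]
    have "\<bar>\<integral>x. (\<phi> (orbit \<omega> j x) - c j) * g (orbit \<omega> i x) \<partial>leb\<bar>
      \<le> \<kappa> * (C * ((4 * B + 3 * \<Lambda>) * (2 / (1 - \<alpha>))) * (ln (real n) / real (i - j)) powr (1 / \<alpha> - 1))
        + 2 * B * (\<integral>x. v (orbit \<omega> i x) \<partial>leb)"
      unfolding T len(3) c_def orbit_fold[of \<omega> j, folded as_def] .
    moreover have "(\<integral>x. v (orbit \<omega> i x) \<partial>leb)
      = \<tau> * ((\<integral>x. (\<Sum>i\<in>{i..n}. a' i x) ^ (2 * l + 2) \<partial>leb) + (\<integral>x. (\<Sum>i\<in>{Suc i..n}. a' i x) ^ (2 * l + 2) \<partial>leb))"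
    proof -
      have "integrable leb (\<lambda>x. w p (orbit \<omega> i x) ^ (2 * l + 2))" if "1 \<le> p" for p
      proof (rule leb.integrable_const_bound[where B="(real n * (2 * B)) ^ (2 * l + 2)"])
        have "(\<lambda>x. w p (orbit \<omega> i x)) \<in> borel_measurable leb"
          unfolding orbit_fold by (rule measurable_compose[OF fold_intermittent_measurable[OF pos] wm])
        then show "(\<lambda>x. w p (orbit \<omega> i x) ^ (2 * l + 2)) \<in> borel_measurable leb" by measurable
        show "AE x in leb. norm (w p (orbit \<omega> i x) ^ (2 * l + 2)) \<le> (real n * (2 * B)) ^ (2 * l + 2)"
        proof (rule AE_I2)
          fix x assume "x \<in> space leb"
          then have "orbit \<omega> i x \<in> {0..1}" unfolding orbit_fold using fold_intermittent_in[OF pos] by simp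
          from wb[OF this that] show "norm (w p (orbit \<omega> i x) ^ (2 * l + 2)) \<le> (real n * (2 * B)) ^ (2 * l + 2)"
            unfolding real_norm_def power_abs by (intro power_mono) auto
        qed
      qed
      from this[of i] this[of "Suc i"] show ?thesis
        using ji unfolding v_def aw[OF order_refl] aw[OF le_SucI[OF order_refl]] by (simp del: power_Suc)
    qed
    ultimately show "\<bar>\<integral>x. a' j x * ((\<Sum>i\<in>{i..n}. a' i x) ^ (2 * l + 1) - (\<Sum>i\<in>{Suc i..n}. a' i x) ^ (2 * l + 1)) \<partial>leb\<bar>
      \<le> \<kappa> * (C * ((4 * B + 3 * \<Lambda>) * (2 / (1 - \<alpha>))) * (ln (real n) / real (i - j)) powr (1 / \<alpha> - 1))
        + 2 * B * \<tau> * ((\<integral>x. (\<Sum>i\<in>{i..n}. a' i x) ^ (2 * l + 2) \<partial>leb) + (\<integral>x. (\<Sum>i\<in>{Suc i..n}. a' i x) ^ (2 * l + 2) \<partial>leb))"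
      unfolding aw[OF order_refl] aw[OF le_SucI[OF order_refl]]
      unfolding a'_def g_def by (simp del: power_Suc add: mult.assoc)
  qed (use l \<phi>D in auto)
  then show ?thesis by (simp add: a'_def c_def)
qed

section \<open>Random compositions\<close>

text \<open>Expectation over r independent parameters as a finite sum, so that linearity,
  conditioning on a prefix and exchange of averages are algebra. The first letter is averaged
  outermost; \<open>integral_prefix\<close> connects this with the product measure.\<close>

primrec word_mean :: "real set \<Rightarrow> (real \<Rightarrow> real) \<Rightarrow> nat \<Rightarrow> (real list \<Rightarrow> real) \<Rightarrow> real"
  where
    "word_mean \<Omega> P 0 G = G []"
  | "word_mean \<Omega> P (Suc r) G = (\<Sum>\<beta>\<in>\<Omega>. P \<beta> * word_mean \<Omega> P r (\<lambda>w. G (\<beta> # w)))"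

lemma word_mean_add: "word_mean \<Omega> P r (\<lambda>w. G w + H w) = word_mean \<Omega> P r G + word_mean \<Omega> P r H"
  by (induction r arbitrary: G H) (simp_all add: algebra_simps sum.distrib)

lemma word_mean_cmult: "word_mean \<Omega> P r (\<lambda>w. c * G w) = c * word_mean \<Omega> P r G"
  by (induction r arbitrary: G) (simp_all add: sum_distrib_left mult.left_commute)

lemma word_mean_diff: "word_mean \<Omega> P r (\<lambda>w. G w - H w) = word_mean \<Omega> P r G - word_mean \<Omega> P r H"
  using word_mean_add[of \<Omega> P r G "\<lambda>w. - 1 * H w"] word_mean_cmult[of \<Omega> P r "- 1" H] by simp

lemma word_mean_const: "prob_weights \<Omega> P \<Longrightarrow> word_mean \<Omega> P r (\<lambda>w. c) = c"
  by (induction r) (simp_all add: prob_weights_def sum_distrib_right[symmetric])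

lemma word_mean_sum: "word_mean \<Omega> P r (\<lambda>w. \<Sum>i\<in>I. G i w) = (\<Sum>i\<in>I. word_mean \<Omega> P r (G i))"
proof (induction r arbitrary: G)
  case (Suc r)
  show ?case unfolding word_mean.simps Suc.IH sum_distrib_left by (rule sum.swap)
qed simp

lemma word_mean_mono:
  assumes "prob_weights \<Omega> P" "\<And>w. set w \<subseteq> \<Omega> \<Longrightarrow> length w = r \<Longrightarrow> G w \<le> H w"
  shows "word_mean \<Omega> P r G \<le> word_mean \<Omega> P r H"
  using assms(2)
proof (induction r arbitrary: G H)
  case (Suc r)
  then show ?case using assms(1) by (auto simp: prob_weights_def intro!: sum_mono mult_left_mono Suc.IH)
qed simp

lemma word_mean_cong:
  assumes "prob_weights \<Omega> P" "\<And>w. set w \<subseteq> \<Omega> \<Longrightarrow> length w = r \<Longrightarrow> G w = H w"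
  shows "word_mean \<Omega> P r G = word_mean \<Omega> P r H"
  using word_mean_mono[OF assms(1), of r G H] word_mean_mono[OF assms(1), of r H G] assms(2) by fastforce

lemma word_mean_abs:
  assumes "prob_weights \<Omega> P" "\<And>w. set w \<subseteq> \<Omega> \<Longrightarrow> length w = r \<Longrightarrow> \<bar>G w\<bar> \<le> c"
  shows "\<bar>word_mean \<Omega> P r G\<bar> \<le> c"
proof -
  have "word_mean \<Omega> P r G \<le> word_mean \<Omega> P r (\<lambda>w. c)" "word_mean \<Omega> P r (\<lambda>w. - c) \<le> word_mean \<Omega> P r G"
    using assms(2) by (intro word_mean_mono[OF assms(1)]; fastforce simp: abs_le_iff)+
  then show ?thesis unfolding word_mean_const[OF assms(1)] by (simp add: abs_le_iff)
qed

lemma word_mean_append: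
  "word_mean \<Omega> P (i + r) G = word_mean \<Omega> P i (\<lambda>u. word_mean \<Omega> P r (\<lambda>v. G (u @ v)))"
  by (induction i arbitrary: G) simp_all

lemma word_mean_take:
  assumes "prob_weights \<Omega> P" "j \<le> n"
  shows "word_mean \<Omega> P n (\<lambda>w. G (take j w)) = word_mean \<Omega> P j G"
proof -
  obtain r where n: "n = j + r" using assms(2) le_Suc_ex by blast
  show ?thesis unfolding n word_mean_append
  proof (rule word_mean_cong[OF assms(1)])
    fix w :: "real list" assume "length w = j"
    then show "word_mean \<Omega> P r (\<lambda>v. G (take j (w @ v))) = G w" by (simp add: word_mean_const[OF assms(1)])
  qed
qed

section \<open>Prefixes under the product measure, and stationarity\<close>

abbreviation weight_measure :: "real set \<Rightarrow> (real \<Rightarrow> real) \<Rightarrow> real measure"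
  where "weight_measure \<Omega> P \<equiv> point_measure \<Omega> (\<lambda>\<beta>. ennreal (P \<beta>))"

lemma prob_space_weight_measure:
  assumes "prob_weights \<Omega> P"
  shows "prob_space (weight_measure \<Omega> P)"
proof (rule prob_space_point_measure)
  have "(\<Sum>s\<in>\<Omega>. ennreal (P s)) = ennreal (\<Sum>s\<in>\<Omega>. P s)" using assms by (intro sum_ennreal) (auto simp: prob_weights_def)
  then show "(\<Sum>s\<in>\<Omega>. ennreal (P s)) = 1" using assms by (simp add: prob_weights_def)
qed (use assms in \<open>auto simp: prob_weights_def\<close>)

lemma integral_weight_measure:
  assumes "prob_weights \<Omega> P"
  shows "(\<integral>\<beta>. f \<beta> \<partial>weight_measure \<Omega> P) = (\<Sum>\<beta>\<in>\<Omega>. P \<beta> * (f \<beta> :: real))"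
  using assms lebesgue_integral_point_measure_finite[of \<Omega> P f] by (simp add: prob_weights_def)

lemma measurable_prefix:
  assumes fin: "finite \<Omega>"
  shows "(\<lambda>\<omega>. G (map \<omega> [0..<n]) :: real) \<in> borel_measurable (sequence_measure \<Omega> P)"
proof (induction n arbitrary: G)
  case (Suc n)
  have "(\<lambda>\<omega>. \<omega> n) \<in> measurable (sequence_measure \<Omega> P) (weight_measure \<Omega> P)"
    unfolding sequence_measure_def by (rule measurable_component_singleton) simp
  then have "(\<lambda>\<omega>. \<omega> n) \<in> measurable (sequence_measure \<Omega> P) (count_space \<Omega>)"
    by (subst (asm) measurable_cong_sets[OF refl sets_point_measure_count_space])
  from measurable_compose_countable'[OF Suc.IH this countable_finite[OF fin], of "\<lambda>\<beta> w. G (w @ [\<beta>])"]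
  show ?case by simp
qed simp

lemma prefix_bounded:
  fixes G :: "real list \<Rightarrow> real"
  assumes "finite \<Omega>"
  obtains c where "\<And>\<omega>. \<omega> \<in> space (sequence_measure \<Omega> P) \<Longrightarrow> \<bar>G (map \<omega> [0..<n])\<bar> \<le> c"
proof -
  define S where "S = {w. set w \<subseteq> \<Omega> \<and> length w = n}"
  have fS: "finite S" unfolding S_def by (rule finite_lists_length_eq[OF assms])
  have "\<bar>G (map \<omega> [0..<n])\<bar> \<le> (\<Sum>w\<in>S. \<bar>G w\<bar>)" if "\<omega> \<in> space (sequence_measure \<Omega> P)" for \<omega>
  proof -
    have "map \<omega> [0..<n] \<in> S"
      using that by (auto simp: S_def sequence_measure_def space_PiM space_point_measure)
    then show ?thesis using fS by (intro member_le_sum) auto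
  qed
  then show thesis by (rule that)
qed

text \<open>The product measure is the image of M x M^N under prepending a coordinate; Fubini then
  peels off the first letter, as the recursion of \<open>word_mean\<close> does.\<close>

lemma integral_prefix:
  fixes G :: "real list \<Rightarrow> real"
  assumes P: "prob_weights \<Omega> P"
  shows "(\<integral>\<omega>. G (map \<omega> [0..<n]) \<partial>sequence_measure \<Omega> P) = word_mean \<Omega> P n G"
proof -
  define M where "M = weight_measure \<Omega> P"
  have fin: "finite \<Omega>" using P by (simp add: prob_weights_def)
  interpret M: prob_space M unfolding M_def by (rule prob_space_weight_measure[OF P])
  interpret S: sequence_space M by unfold_locales
  have S: "sequence_measure \<Omega> P = PiM UNIV (\<lambda>_. M)" by (simp add: sequence_measure_def M_def)
  interpret SP: prob_space "PiM UNIV (\<lambda>_. M)" by (rule prob_space_PiM) (rule M.prob_space_axioms)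
  interpret MS: pair_prob_space M "PiM UNIV (\<lambda>_. M)" by unfold_locales
  show ?thesis
  proof (induction n arbitrary: G)
    case 0
    show ?case unfolding S using S.P.prob_space by simp
  next
    case (Suc n)
    note meas = measurable_prefix[OF fin, where P=P and n="Suc n" and G=G, unfolded S]
    obtain c where c: "\<And>\<omega>. \<omega> \<in> space (PiM UNIV (\<lambda>_. M)) \<Longrightarrow> \<bar>G (map \<omega> [0..<Suc n])\<bar> \<le> c"
      using prefix_bounded[OF fin, of P G "Suc n"] unfolding S by metis
    have h: "(\<lambda>(s, \<omega>). case_nat s \<omega>) \<in> measurable (M \<Otimes>\<^sub>M PiM UNIV (\<lambda>_. M)) (PiM UNIV (\<lambda>_. M))"
      by measurable
    have hc: "map (case_nat s \<omega>) [0..<Suc n] = s # map \<omega> [0..<n]" for s and \<omega> :: "nat \<Rightarrow> real"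
      by (simp only: map_upt_Suc nat.case)
    have meas2: "(\<lambda>p. G (fst p # map (snd p) [0..<n])) \<in> borel_measurable (M \<Otimes>\<^sub>M PiM UNIV (\<lambda>_. M))"
      using measurable_compose[OF h meas] unfolding split_beta hc .
    have int: "integrable (M \<Otimes>\<^sub>M PiM UNIV (\<lambda>_. M)) (\<lambda>p. G (fst p # map (snd p) [0..<n]))"
    proof (rule MS.P.integrable_const_bound[OF _ meas2, where B=c])
      show "AE p in M \<Otimes>\<^sub>M PiM UNIV (\<lambda>_. M). norm (G (fst p # map (snd p) [0..<n])) \<le> c"
        using c[OF measurable_space[OF h]] unfolding split_beta hc by (intro AE_I2) auto
    qed
    have "(\<integral>\<omega>. G (map \<omega> [0..<Suc n]) \<partial>PiM UNIV (\<lambda>_. M))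
        = (\<integral>\<omega>. G (map \<omega> [0..<Suc n]) \<partial>distr (M \<Otimes>\<^sub>M PiM UNIV (\<lambda>_. M)) (PiM UNIV (\<lambda>_. M)) (\<lambda>(s, \<omega>). case_nat s \<omega>))"
      unfolding S.PiM_iter ..
    also have "\<dots> = (\<integral>p. G (fst p # map (snd p) [0..<n]) \<partial>(M \<Otimes>\<^sub>M PiM UNIV (\<lambda>_. M)))"
      unfolding integral_distr[OF h meas] unfolding split_beta hc ..
    also have "\<dots> = (\<integral>s. (\<integral>\<omega>. G (s # map \<omega> [0..<n]) \<partial>PiM UNIV (\<lambda>_. M)) \<partial>M)"
      using MS.integral_fst'[OF int] by simp
    also have "\<dots> = (\<integral>s. word_mean \<Omega> P n (\<lambda>w. G (s # w)) \<partial>M)"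
      by (simp only: Suc.IH[of "\<lambda>w. G (_ # w)", unfolded S])
    also have "\<dots> = word_mean \<Omega> P (Suc n) G" unfolding M_def integral_weight_measure[OF P] by simp
    finally show ?case unfolding S .
  qed
qed

text \<open>Stationarity says that \<mu> is the image of the product of the weights with \<mu> under
  (\<beta>, x) -> T_\<beta>(x). This form passes from sets to bounded functions at once, by the
  transformation formula and Fubini.\<close>

lemma stationary_integral:
  assumes P: "prob_weights \<Omega> P" and \<Omega>: "\<Omega> \<subseteq> {0<..}" and \<mu>: "stationary \<Omega> P \<mu>"
    and g: "g \<in> borel_measurable leb" "\<And>x. x \<in> {0..1} \<Longrightarrow> \<bar>g x\<bar> \<le> B"
  shows "(\<integral>x. g x \<partial>\<mu>) = (\<Sum>\<beta>\<in>\<Omega>. P \<beta> * (\<integral>x. g (intermittent_map \<beta> x) \<partial>\<mu>))"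
proof -
  define M where "M = weight_measure \<Omega> P"
  have fin: "finite \<Omega>" and P0: "\<And>\<beta>. \<beta> \<in> \<Omega> \<Longrightarrow> 0 \<le> P \<beta>" using P by (auto simp: prob_weights_def)
  interpret M: prob_space M unfolding M_def by (rule prob_space_weight_measure[OF P])
  interpret \<mu>: prob_space \<mu> using \<mu> by (simp add: stationary_def)
  interpret M\<mu>: pair_prob_space M \<mu> by unfold_locales
  have sets: "sets \<mu> = sets leb" using \<mu> by (simp add: stationary_def sets_leb)
  have sp: "space \<mu> = {0..1}" using sets_eq_imp_space_eq[OF sets] by simp
  have mc: "measurable \<mu> N = measurable leb N" "measurable N \<mu> = measurable N leb" for N :: "'z measure"
    using sets by (auto intro!: measurable_cong_sets)
  have mc': "measurable \<mu> \<mu> = measurable leb leb" using sets by (auto intro!: measurable_cong_sets)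
  have T: "intermittent_map \<beta> \<in> measurable \<mu> \<mu>" if "\<beta> \<in> \<Omega>" for \<beta>
    unfolding mc' using that \<Omega> by (intro intermittent_measurable) auto
  have Tm: "(\<lambda>p. intermittent_map (fst p) (snd p)) \<in> measurable (M \<Otimes>\<^sub>M \<mu>) \<mu>"
  proof (rule measurable_compose_countable'[where I=\<Omega> and f="\<lambda>\<beta> p. intermittent_map \<beta> (snd p)" and g=fst])
    show "(\<lambda>p. intermittent_map i (snd p)) \<in> measurable (M \<Otimes>\<^sub>M \<mu>) \<mu>" if "i \<in> \<Omega>" for i
      by (rule measurable_compose[OF measurable_snd T[OF that]])
    have "fst \<in> measurable (M \<Otimes>\<^sub>M \<mu>) M" by (rule measurable_fst)
    then show "fst \<in> measurable (M \<Otimes>\<^sub>M \<mu>) (count_space \<Omega>)"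
      by (subst (asm) measurable_cong_sets[OF refl, of _ "count_space \<Omega>"])
        (simp_all add: M_def sets_point_measure_count_space)
    show "countable \<Omega>" using fin by (rule countable_finite)
  qed
  have D: "distr (M \<Otimes>\<^sub>M \<mu>) \<mu> (\<lambda>p. intermittent_map (fst p) (snd p)) = \<mu>"
  proof (rule measure_eqI)
    fix A assume "A \<in> sets (distr (M \<Otimes>\<^sub>M \<mu>) \<mu> (\<lambda>p. intermittent_map (fst p) (snd p)))"
    then have A: "A \<in> sets \<mu>" by simp
    have "emeasure (distr (M \<Otimes>\<^sub>M \<mu>) \<mu> (\<lambda>p. intermittent_map (fst p) (snd p))) A
        = emeasure (M \<Otimes>\<^sub>M \<mu>) ((\<lambda>p. intermittent_map (fst p) (snd p)) -` A \<inter> space (M \<Otimes>\<^sub>M \<mu>))"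
      by (rule emeasure_distr[OF Tm A])
    also have "\<dots> = (\<integral>\<^sup>+\<beta>. emeasure \<mu> (Pair \<beta> -` ((\<lambda>p. intermittent_map (fst p) (snd p)) -` A \<inter> space (M \<Otimes>\<^sub>M \<mu>))) \<partial>M)"
      by (rule \<mu>.emeasure_pair_measure_alt[OF measurable_sets[OF Tm A]])
    also have "\<dots> = (\<integral>\<^sup>+\<beta>. ennreal (measure \<mu> (intermittent_map \<beta> -` A \<inter> {0..1})) \<partial>M)"
    proof (rule nn_integral_cong)
      fix \<beta> assume "\<beta> \<in> space M"
      then have "Pair \<beta> -` ((\<lambda>p. intermittent_map (fst p) (snd p)) -` A \<inter> space (M \<Otimes>\<^sub>M \<mu>)) = intermittent_map \<beta> -` A \<inter> {0..1}"
        by (auto simp: space_pair_measure sp)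
      then show "emeasure \<mu> (Pair \<beta> -` ((\<lambda>p. intermittent_map (fst p) (snd p)) -` A \<inter> space (M \<Otimes>\<^sub>M \<mu>)))
        = ennreal (measure \<mu> (intermittent_map \<beta> -` A \<inter> {0..1}))"
        by (simp add: \<mu>.emeasure_eq_measure)
    qed
    also have "\<dots> = (\<Sum>\<beta>\<in>\<Omega>. ennreal (P \<beta>) * ennreal (measure \<mu> (intermittent_map \<beta> -` A \<inter> {0..1})))"
      unfolding M_def by (rule nn_integral_point_measure_finite[OF fin])
    also have "\<dots> = (\<Sum>\<beta>\<in>\<Omega>. ennreal (P \<beta> * measure \<mu> (intermittent_map \<beta> -` A \<inter> {0..1})))"
      using P0 by (intro sum.cong refl) (simp add: ennreal_mult)
    also have "\<dots> = ennreal (\<Sum>\<beta>\<in>\<Omega>. P \<beta> * measure \<mu> (intermittent_map \<beta> -` A \<inter> {0..1}))"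
      using P0 by (intro sum_ennreal) simp
    also have "\<dots> = emeasure \<mu> A"
    proof -
      have "measure \<mu> A = (\<Sum>\<beta>\<in>\<Omega>. P \<beta> * measure \<mu> (intermittent_map \<beta> -` A \<inter> {0..1}))"
        using \<mu> A unfolding stationary_def by blast
      then show ?thesis by (simp only: \<mu>.emeasure_eq_measure)
    qed
    finally show "emeasure (distr (M \<Otimes>\<^sub>M \<mu>) \<mu> (\<lambda>p. intermittent_map (fst p) (snd p))) A = emeasure \<mu> A" .
  qed simp
  have g\<mu>: "g \<in> borel_measurable \<mu>" using g(1) unfolding mc .
  have int: "integrable (M \<Otimes>\<^sub>M \<mu>) (\<lambda>p. g (intermittent_map (fst p) (snd p)))"
  proof (rule M\<mu>.P.integrable_const_bound[where B=B])
    show "(\<lambda>p. g (intermittent_map (fst p) (snd p))) \<in> borel_measurable (M \<Otimes>\<^sub>M \<mu>)" by (rule measurable_compose[OF Tm g\<mu>])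
    show "AE p in M \<Otimes>\<^sub>M \<mu>. norm (g (intermittent_map (fst p) (snd p))) \<le> B"
      using g(2) measurable_space[OF Tm] by (intro AE_I2) (auto simp: sp)
  qed
  have "(\<integral>x. g x \<partial>\<mu>) = (\<integral>p. g (intermittent_map (fst p) (snd p)) \<partial>(M \<Otimes>\<^sub>M \<mu>))"
    by (subst D[symmetric], rule integral_distr[OF Tm g\<mu>])
  also have "\<dots> = (\<integral>\<beta>. (\<integral>x. g (intermittent_map \<beta> x) \<partial>\<mu>) \<partial>M)"
    using M\<mu>.integral_fst'[OF int] by simp
  finally show ?thesis unfolding M_def integral_weight_measure[OF P] .
qed

text \<open>Each use of stationarity adds a map that acts before the others, so words grow at the
  front. The induction therefore carries an arbitrary suffix w, and the new letter has to be
  exchanged with the average over the earlier ones.\<close>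

lemma stationary_word_mean:
  assumes P: "prob_weights \<Omega> P" and \<Omega>: "\<Omega> \<subseteq> {0<..}" and \<mu>: "stationary \<Omega> P \<mu>"
    and g: "g \<in> borel_measurable leb" "\<And>x. x \<in> {0..1} \<Longrightarrow> \<bar>g x\<bar> \<le> B"
  shows "(\<integral>x. g x \<partial>\<mu>) = word_mean \<Omega> P s (\<lambda>w. \<integral>x. g (fold intermittent_map w x) \<partial>\<mu>)"
proof -
  have "(\<integral>x. g (fold intermittent_map w x) \<partial>\<mu>) = word_mean \<Omega> P s (\<lambda>v. \<integral>x. g (fold intermittent_map (v @ w) x) \<partial>\<mu>)"
    if "set w \<subseteq> \<Omega>" for w
    using that
  proof (induction s arbitrary: w)
    case (Suc s)
    have pos: "set w \<subseteq> {0<..}" using Suc.prems \<Omega> by auto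
    have "(\<integral>x. g (fold intermittent_map w x) \<partial>\<mu>) = (\<Sum>\<beta>\<in>\<Omega>. P \<beta> * (\<integral>x. g (fold intermittent_map w (intermittent_map \<beta> x)) \<partial>\<mu>))"
      by (rule stationary_integral[OF P \<Omega> \<mu> measurable_compose[OF fold_intermittent_measurable[OF pos] g(1)], of B])
        (use g(2) fold_intermittent_in[OF pos] in auto)
    also have "\<dots> = (\<Sum>\<beta>\<in>\<Omega>. P \<beta> * word_mean \<Omega> P s (\<lambda>v. \<integral>x. g (fold intermittent_map (v @ \<beta> # w) x) \<partial>\<mu>))"
      using Suc.IH[of "_ # w"] Suc.prems by (intro sum.cong refl) simp
    finally have 1: "(\<integral>x. g (fold intermittent_map w x) \<partial>\<mu>)
      = word_mean \<Omega> P 1 (\<lambda>u. word_mean \<Omega> P s (\<lambda>v. \<integral>x. g (fold intermittent_map (v @ u @ w) x) \<partial>\<mu>))" by simp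
    have swap: "word_mean \<Omega> P 1 (\<lambda>u. word_mean \<Omega> P s (\<lambda>v. H v u)) = word_mean \<Omega> P s (\<lambda>v. word_mean \<Omega> P 1 (H v))" for H
      by (simp add: word_mean_sum word_mean_cmult)
    have "word_mean \<Omega> P (s + 1) (\<lambda>v. \<integral>x. g (fold intermittent_map (v @ w) x) \<partial>\<mu>)
      = word_mean \<Omega> P s (\<lambda>v. word_mean \<Omega> P 1 (\<lambda>u. \<integral>x. g (fold intermittent_map ((v @ u) @ w) x) \<partial>\<mu>))"
      by (rule word_mean_append)
    then show ?case unfolding 1 swap by simp
  qed simp
  from this[of "[]"] show ?thesis by simp
qed

section \<open>Lipschitz functions are dense in L^1\<close>

lemma lipschitz_bounded_add:
  assumes "lipschitz_bounded B \<Lambda> f" "lipschitz_bounded B' \<Lambda>' g"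
  shows "lipschitz_bounded (B + B') (\<Lambda> + \<Lambda>') (\<lambda>x. f x + g x)"
  unfolding lipschitz_bounded_def
proof (intro conjI ballI)
  note fD = lipschitz_boundedD[OF assms(1)] and gD = lipschitz_boundedD[OF assms(2)]
  show "0 \<le> \<Lambda> + \<Lambda>'" using fD gD by simp
  fix x :: real assume x: "x \<in> {0..1}"
  show "\<bar>f x + g x\<bar> \<le> B + B'" using fD(2)[OF x] gD(2)[OF x] by linarith
  fix y :: real assume y: "y \<in> {0..1}"
  show "\<bar>f x + g x - (f y + g y)\<bar> \<le> (\<Lambda> + \<Lambda>') * \<bar>x - y\<bar>"
    using fD(3)[OF x y] gD(3)[OF x y] by (simp add: algebra_simps)
qed

lemma lipschitz_bounded_cmult:
  assumes "lipschitz_bounded B \<Lambda> f"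
  shows "lipschitz_bounded (\<bar>c\<bar> * B) (\<bar>c\<bar> * \<Lambda>) (\<lambda>x. c * f x)"
  unfolding lipschitz_bounded_def
proof (intro conjI ballI)
  note fD = lipschitz_boundedD[OF assms]
  show "0 \<le> \<bar>c\<bar> * \<Lambda>" using fD by simp
  fix x :: real assume x: "x \<in> {0..1}"
  show "\<bar>c * f x\<bar> \<le> \<bar>c\<bar> * B" using fD(2)[OF x] by (simp add: abs_mult mult_left_mono)
  fix y :: real assume y: "y \<in> {0..1}"
  have "\<bar>c * f x - c * f y\<bar> = \<bar>c\<bar> * \<bar>f x - f y\<bar>" by (simp add: abs_mult[symmetric] algebra_simps)
  also have "\<dots> \<le> \<bar>c\<bar> * (\<Lambda> * \<bar>x - y\<bar>)" using fD(3)[OF x y] by (intro mult_left_mono) auto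
  finally show "\<bar>c * f x - c * f y\<bar> \<le> \<bar>c\<bar> * \<Lambda> * \<bar>x - y\<bar>" by simp
qed

lemma lipschitz_bounded_integrable: "lipschitz_bounded B \<Lambda> g \<Longrightarrow> integrable leb g"
  by (rule leb.integrable_const_bound[where B=B]) (auto simp: lipschitz_measurable lipschitz_boundedD(2))

text \<open>Regularity gives a compact K inside A and an open U around A, each within \<epsilon>/2
  in measure. A Lipschitz cutoff that is 1 on K and 0 off U differs from the indicator only on U -
  K. An empty K is treated apart, with the zero function.\<close>

lemma indicator_lipschitz_approx:
  assumes A: "A \<in> sets leb" and \<epsilon>: "0 < \<epsilon>"
  shows "\<exists>B \<Lambda> g. lipschitz_bounded B \<Lambda> g \<and> (\<integral>x. \<bar>indicator A x - g x\<bar> \<partial>leb) < \<epsilon>"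
proof -
  have "\<exists>A'. A' \<in> sets borel \<and> A = A' \<inter> {0..1}" using A unfolding sets_leb by (auto simp: sets_restrict_space)
  then have Ab: "A \<in> sets borel" "A \<subseteq> {0..1}" by auto
  have AL: "A \<in> sets lebesgue" using Ab(1) by simp
  have e2: "0 < \<epsilon> / 2" using \<epsilon> by simp
  obtain U where U: "open U" "A \<subseteq> U" "emeasure lebesgue (U - A) < ennreal (\<epsilon> / 2)"
    using sets_lebesgue_outer_open[OF AL e2] by metis
  obtain K where K: "closed K" "K \<subseteq> A" "emeasure lebesgue (A - K) < ennreal (\<epsilon> / 2)"
    using sets_lebesgue_inner_closed[OF AL e2] by metis
  have "bounded K" using K(2) Ab(2) by (meson bounded_closed_interval bounded_subset)
  then have cK: "compact K" using K(1) by (simp add: compact_eq_bounded_closed)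
  have "\<exists>\<Lambda> g. lipschitz_bounded 1 \<Lambda> g \<and> (\<forall>x. 0 \<le> g x \<and> g x \<le> 1) \<and> (\<forall>x\<in>K. g x = 1) \<and> (\<forall>x. x \<notin> U \<longrightarrow> g x = 0)"
  proof (cases "K = {}")
    case True
    then show ?thesis by (intro exI[of _ 0] exI[of _ "\<lambda>x. 0"]) (simp add: lipschitz_bounded_def)
  next
    case False
    obtain e where e: "0 < e" "{x. infdist x K \<le> e} \<subseteq> U"
      using compact_in_open_separated[OF False cK U(1)] K(2) U(2) by blast
    define g where "g x = max 0 (1 - infdist x K / e)" for x
    have "lipschitz_bounded 1 (1 / e) g"
      unfolding lipschitz_bounded_def
    proof (intro conjI ballI)
      show "0 \<le> 1 / e" using e by simp
      show "\<bar>g x\<bar> \<le> 1" for x using e by (auto simp: g_def infdist_nonneg)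
      show "\<bar>g x - g y\<bar> \<le> 1 / e * \<bar>x - y\<bar>" for x y
      proof -
        have "\<bar>g x - g y\<bar> \<le> \<bar>infdist x K / e - infdist y K / e\<bar>" unfolding g_def by linarith
        also have "\<dots> = \<bar>infdist x K - infdist y K\<bar> / e" using e by (simp add: diff_divide_distrib[symmetric])
        also have "\<dots> \<le> \<bar>x - y\<bar> / e" using infdist_triangle_abs[of x K y] e by (intro divide_right_mono) (auto simp: dist_real_def)
        finally show ?thesis by simp
      qed
    qed
    moreover have "0 \<le> g x \<and> g x \<le> 1" for x using e by (auto simp: g_def infdist_nonneg)
    moreover have "g x = 1" if "x \<in> K" for x using that by (simp add: g_def)
    moreover have "g x = 0" if "x \<notin> U" for x
    proof -
      have "e < infdist x K" using e(2) that by force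
      then show ?thesis using e(1) by (simp add: g_def)
    qed
    ultimately show ?thesis by blast
  qed
  then obtain \<Lambda> g where g: "lipschitz_bounded 1 \<Lambda> g" "\<And>x. 0 \<le> g x \<and> g x \<le> 1" "\<And>x. x \<in> K \<Longrightarrow> g x = 1" "\<And>x. x \<notin> U \<Longrightarrow> g x = 0"
    by blast
  have b: "U - A \<in> sets borel" "A - K \<in> sets borel" using U(1) K(1) Ab(1) by auto
  have i: "integrable leb (\<lambda>x. indicator A x - g x)"
    using lipschitz_bounded_integrable[OF g(1)] integrable_leb_indicator[of "\<lambda>_. 1" A] Ab(1) by simp
  have "ennreal (\<integral>x. \<bar>indicator A x - g x\<bar> \<partial>leb) = (\<integral>\<^sup>+x. ennreal \<bar>indicator A x - g x\<bar> \<partial>leb)"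
    using i by (intro nn_integral_eq_integral[symmetric]) auto
  also have "\<dots> \<le> (\<integral>\<^sup>+x. indicator (U - A) x + indicator (A - K) x \<partial>lborel)"
    unfolding nn_integral_leb
  proof (rule nn_integral_mono)
    fix x :: real
    show "ennreal \<bar>indicator A x - g x\<bar> * indicator {0..1} x \<le> indicator (U - A) x + indicator (A - K) x"
      using g(2)[of x] g(3)[of x] g(4)[of x] U(2) K(2) by (auto split: split_indicator)
  qed
  also have "\<dots> = emeasure lborel (U - A) + emeasure lborel (A - K)"
    using b by (subst nn_integral_add) auto
  also have "\<dots> = emeasure lebesgue (U - A) + emeasure lebesgue (A - K)"
    using b by simp
  also have "\<dots> < ennreal (\<epsilon> / 2) + ennreal (\<epsilon> / 2)" by (rule add_strict_mono[OF U(3) K(3)])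
  also have "\<dots> = ennreal \<epsilon>" using \<epsilon> by (simp add: ennreal_plus[symmetric] del: ennreal_plus)
  finally have "(\<integral>x. \<bar>indicator A x - g x\<bar> \<partial>leb) < \<epsilon>" using \<epsilon> by (simp add: ennreal_less_iff)
  with g(1) show ?thesis by blast
qed

text \<open>Needed because absolute continuity gives \<mu> only an integrable density. It is used
  for convergence of means without a rate, so the size of the Lipschitz constant does not
  matter.\<close>

lemma integrable_lipschitz_approx:
  fixes h :: "real \<Rightarrow> real"
  assumes "integrable leb h" "0 < \<epsilon>"
  shows "\<exists>B \<Lambda> g. lipschitz_bounded B \<Lambda> g \<and> (\<integral>x. \<bar>h x - g x\<bar> \<partial>leb) < \<epsilon>"
  using assms
proof (induction h arbitrary: \<epsilon> rule: integrable_induct)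
  case (base A c)
  have "0 < \<epsilon> / (\<bar>c\<bar> + 1)" using base.prems by simp
  from indicator_lipschitz_approx[OF base(1) this] obtain B \<Lambda> g
    where g: "lipschitz_bounded B \<Lambda> g" "(\<integral>x. \<bar>indicator A x - g x\<bar> \<partial>leb) < \<epsilon> / (\<bar>c\<bar> + 1)" by blast
  have "(\<integral>x. \<bar>indicator A x *\<^sub>R c - c * g x\<bar> \<partial>leb) = (\<integral>x. \<bar>c\<bar> * \<bar>indicator A x - g x\<bar> \<partial>leb)"
    by (intro Bochner_Integration.integral_cong refl) (simp add: abs_mult[symmetric] algebra_simps)
  also have "\<dots> = \<bar>c\<bar> * (\<integral>x. \<bar>indicator A x - g x\<bar> \<partial>leb)" by simp
  also have "\<dots> \<le> \<bar>c\<bar> * (\<epsilon> / (\<bar>c\<bar> + 1))" using g(2) by (intro mult_left_mono) auto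
  also have "\<dots> < \<epsilon>" using base.prems by (simp add: field_simps)
  finally show ?case using lipschitz_bounded_cmult[OF g(1), of c] by blast
next
  case (add f1 f2)
  have e: "0 < \<epsilon> / 2" using add.prems by simp
  obtain B1 L1 g1 where g1: "lipschitz_bounded B1 L1 g1" "(\<integral>x. \<bar>f1 x - g1 x\<bar> \<partial>leb) < \<epsilon> / 2" using add.IH(1)[OF e] by blast
  obtain B2 L2 g2 where g2: "lipschitz_bounded B2 L2 g2" "(\<integral>x. \<bar>f2 x - g2 x\<bar> \<partial>leb) < \<epsilon> / 2" using add.IH(2)[OF e] by blast
  note i = add.hyps lipschitz_bounded_integrable[OF g1(1)] lipschitz_bounded_integrable[OF g2(1)]
  have "(\<integral>x. \<bar>f1 x + f2 x - (g1 x + g2 x)\<bar> \<partial>leb) \<le> (\<integral>x. \<bar>f1 x - g1 x\<bar> + \<bar>f2 x - g2 x\<bar> \<partial>leb)"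
    using i by (intro integral_leb_mono) auto
  also have "\<dots> = (\<integral>x. \<bar>f1 x - g1 x\<bar> \<partial>leb) + (\<integral>x. \<bar>f2 x - g2 x\<bar> \<partial>leb)" using i by simp
  also have "\<dots> < \<epsilon>" using g1(2) g2(2) by simp
  finally show ?case using lipschitz_bounded_add[OF g1(1) g2(1)] by blast
next
  case (lim f s)
  have "(\<lambda>i. (\<integral>x. \<bar>f x - s i x\<bar> \<partial>leb)) \<longlonglongrightarrow> (\<integral>x. 0 \<partial>leb)"
  proof (rule integral_dominated_convergence[where w="\<lambda>x. 3 * \<bar>f x\<bar>"])
    show "AE x in leb. (\<lambda>i. \<bar>f x - s i x\<bar>) \<longlonglongrightarrow> 0"
    proof (rule AE_I2)
      fix x assume "x \<in> space leb"
      then have "(\<lambda>i. \<bar>f x - s i x\<bar>) \<longlonglongrightarrow> \<bar>f x - f x\<bar>" by (intro tendsto_intros lim.hyps)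
      then show "(\<lambda>i. \<bar>f x - s i x\<bar>) \<longlonglongrightarrow> 0" by simp
    qed
    show "AE x in leb. norm \<bar>f x - s i x\<bar> \<le> 3 * \<bar>f x\<bar>" for i
    proof (rule AE_I2)
      fix x assume "x \<in> space leb"
      then have "\<bar>s i x\<bar> \<le> 2 * \<bar>f x\<bar>" using lim.hyps(3)[of x i] by simp
      then show "norm \<bar>f x - s i x\<bar> \<le> 3 * \<bar>f x\<bar>" by simp
    qed
  qed (use lim.hyps in auto)
  then have "\<forall>\<^sub>F i in sequentially. (\<integral>x. \<bar>f x - s i x\<bar> \<partial>leb) < \<epsilon> / 2"
    using lim.prems by (intro order_tendstoD(2)) auto
  then obtain i where i: "(\<integral>x. \<bar>f x - s i x\<bar> \<partial>leb) < \<epsilon> / 2" by (auto simp: eventually_sequentially)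
  obtain B \<Lambda> g where g: "lipschitz_bounded B \<Lambda> g" "(\<integral>x. \<bar>s i x - g x\<bar> \<partial>leb) < \<epsilon> / 2"
    using lim.IH[of "\<epsilon> / 2" i] lim.prems by auto
  note int = lim.hyps(1)[of i] lim.hyps(4) lipschitz_bounded_integrable[OF g(1)]
  have "(\<integral>x. \<bar>f x - g x\<bar> \<partial>leb) \<le> (\<integral>x. \<bar>f x - s i x\<bar> + \<bar>s i x - g x\<bar> \<partial>leb)"
    using int by (intro integral_leb_mono) auto
  also have "\<dots> = (\<integral>x. \<bar>f x - s i x\<bar> \<partial>leb) + (\<integral>x. \<bar>s i x - g x\<bar> \<partial>leb)" using int by simp
  also have "\<dots> < \<epsilon>" using i g(2) by simp
  finally show ?case using g(1) by blast
qed

section \<open>Averages and second moments of the fibrewise means\<close>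

lemma log_ratio_tendsto_0:
  assumes "0 < \<gamma>"
  shows "(\<lambda>n. (ln (real n) / real n) powr \<gamma>) \<longlonglongrightarrow> 0"
proof -
  have "(\<lambda>n. ln (real n) / real n) \<longlonglongrightarrow> 0" by (rule lim_ln_over_n)
  then have "(\<lambda>n. (ln (real n) / real n) powr \<gamma>) \<longlonglongrightarrow> 0 powr \<gamma>"
    by (rule tendsto_powr2[OF _ tendsto_const _ assms])
      (auto intro!: eventually_sequentiallyI[of 1])
  then show ?thesis by simp
qed

definition path_mean :: "(real \<Rightarrow> real) \<Rightarrow> real list \<Rightarrow> real"
  where "path_mean \<phi> w = (\<integral>x. \<phi> (fold intermittent_map w x) \<partial>leb)"

text \<open>Forgetting the distant past: both means integrate the observable against images under v,
  once of the image of Lebesgue measure under u and once of Lebesgue measure itself, two cone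
  densities of equal mass.\<close>

lemma path_mean_forget:
  assumes a: "0 < \<alpha>" "\<alpha> < 1" and C: "loss_bound \<alpha> C" and \<phi>: "lipschitz_bounded B \<Lambda> \<phi>"
    and u: "set u \<subseteq> {0<..\<alpha>}" and v: "set v \<subseteq> {0<..\<alpha>}" "v \<noteq> []" "length v \<le> N" and N: "3 \<le> N"
  shows "\<bar>path_mean \<phi> (u @ v) - path_mean \<phi> v\<bar> \<le> B * (C * (2 / (1 - \<alpha>)) * (ln (real N) / real (length v)) powr (1 / \<alpha> - 1))"
proof -
  note \<phi>D = lipschitz_boundedD[OF \<phi>] and pu = positive_parameters[OF u] and pv = positive_parameters[OF v(1)]
  have \<phi>m: "\<phi> \<in> borel_measurable leb" by (rule lipschitz_measurable[OF \<phi>])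
  define \<rho> where "\<rho> = push u (\<lambda>x. 1)"
  have \<rho>: "density_cone \<alpha> (2 / (1 - \<alpha>)) \<rho>" unfolding \<rho>_def by (rule density_cone_push[OF density_cone_one[OF a] u a(2)])
  have i1: "integrable leb (\<lambda>x. 1 :: real)" by simp
  have i\<rho>: "integrable leb \<rho>" unfolding \<rho>_def by (rule push_integrable[OF pu i1])
  have m: "(\<integral>x. \<rho> x \<partial>leb) = (\<integral>x. 1 \<partial>leb)" unfolding \<rho>_def by (rule integral_push[OF pu i1])
  have fm: "(\<lambda>x. \<phi> (fold intermittent_map v x)) \<in> borel_measurable leb"
    by (rule measurable_compose[OF fold_intermittent_measurable[OF pv] \<phi>m])
  have fb: "\<bar>\<phi> (fold intermittent_map v x)\<bar> \<le> B" if "x \<in> {0..1}" for x by (rule \<phi>D(2)[OF fold_intermittent_in[OF pv that]])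
  have "path_mean \<phi> (u @ v) = (\<integral>x. push v \<rho> x * \<phi> x \<partial>leb)"
    using push_dual[OF pu i1 fm fb] push_dual[OF pv i\<rho> \<phi>m \<phi>D(2)] by (simp add: path_mean_def \<rho>_def)
  moreover have "path_mean \<phi> v = (\<integral>x. push v (\<lambda>x. 1) x * \<phi> x \<partial>leb)"
    using push_dual[OF pv i1 \<phi>m \<phi>D(2)] by (simp add: path_mean_def)
  moreover have "integrable leb (\<lambda>x. push v \<rho> x * \<phi> x)"
    by (rule integrable_mult_bounded[OF push_integrable[OF pv i\<rho>] \<phi>m \<phi>D(2)])
  moreover have "integrable leb (\<lambda>x. push v (\<lambda>x. 1) x * \<phi> x)"
    by (rule integrable_mult_bounded[OF push_integrable[OF pv i1] \<phi>m \<phi>D(2)])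
  ultimately have eq: "path_mean \<phi> (u @ v) - path_mean \<phi> v = (\<integral>x. push v (\<lambda>x. \<rho> x - 1) x * \<phi> x \<partial>leb)"
    unfolding push_linear by (simp add: left_diff_distrib)
  have id: "integrable leb (push v (\<lambda>x. \<rho> x - 1))" using push_integrable[OF pv, of "\<lambda>x. \<rho> x - 1"] i\<rho> by simp
  have "\<bar>path_mean \<phi> (u @ v) - path_mean \<phi> v\<bar> \<le> (\<integral>x. \<bar>push v (\<lambda>x. \<rho> x - 1) x * \<phi> x\<bar> \<partial>leb)"
    unfolding eq by (rule integral_abs_bound)
  also have "\<dots> \<le> (\<integral>x. B * \<bar>push v (\<lambda>x. \<rho> x - 1) x\<bar> \<partial>leb)"
  proof (rule integral_leb_mono)
    show "integrable leb (\<lambda>x. \<bar>push v (\<lambda>x. \<rho> x - 1) x * \<phi> x\<bar>)"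
      by (rule integrable_abs[OF integrable_mult_bounded[OF id \<phi>m \<phi>D(2)]])
    show "integrable leb (\<lambda>x. B * \<bar>push v (\<lambda>x. \<rho> x - 1) x\<bar>)" using id by simp
    fix x :: real assume "0 < x" "x \<le> 1"
    then show "\<bar>push v (\<lambda>x. \<rho> x - 1) x * \<phi> x\<bar> \<le> B * \<bar>push v (\<lambda>x. \<rho> x - 1) x\<bar>"
      using \<phi>D(2)[of x] by (simp add: abs_mult mult.commute mult_right_mono)
  qed
  also have "\<dots> = B * (\<integral>x. \<bar>push v (\<lambda>x. \<rho> x - 1) x\<bar> \<partial>leb)" by simp
  also have "\<dots> \<le> B * (C * (2 / (1 - \<alpha>)) * (ln (real N) / real (length v)) powr (1 / \<alpha> - 1))"
    by (intro mult_left_mono loss_boundD(2)[OF C N v(2,3,1) \<rho> density_cone_one[OF a] m] \<phi>D(4))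
  finally show ?thesis .
qed

text \<open>By stationarity the averaged mean with respect to \<mu> is 0 at every time. The
  difference from the mean with respect to Lebesgue measure is governed by the image of h - 1, where
  h is the density of \<mu>; up to a small L^1 error this is Lipschitz with mean zero and
  decays.\<close>

lemma stationary_mean_tendsto:
  assumes a: "0 < \<alpha>" "\<alpha> < 1" and C: "loss_bound \<alpha> C" and \<phi>: "lipschitz_bounded B \<Lambda> \<phi>"
    and \<Omega>: "\<Omega> \<subseteq> {0<..\<alpha>}" and P: "prob_weights \<Omega> P" and \<mu>: "ac_stationary \<Omega> P \<mu>" and zero: "(\<integral>x. \<phi> x \<partial>\<mu>) = 0"
  shows "(\<lambda>s. word_mean \<Omega> P s (path_mean \<phi>)) \<longlonglongrightarrow> 0"
proof (rule LIMSEQ_I)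
  fix r :: real assume r: "0 < r"
  note \<phi>D = lipschitz_boundedD[OF \<phi>]
  have \<phi>m: "\<phi> \<in> borel_measurable leb" by (rule lipschitz_measurable[OF \<phi>])
  have st: "stationary \<Omega> P \<mu>" and ac: "absolutely_continuous leb \<mu>" using \<mu> by (auto simp: ac_stationary_def)
  interpret \<mu>: prob_space \<mu> using st by (simp add: stationary_def)
  have sets: "sets \<mu> = sets leb" using st by (simp add: stationary_def sets_leb)
  obtain h where h: "h \<in> borel_measurable leb" "AE x in leb. RN_deriv leb \<mu> x = ennreal (h x)" "\<And>x. 0 \<le> h x"
    using leb.real_RN_deriv[OF \<mu>.finite_measure_axioms ac sets] by metis
  have dens: "density leb (\<lambda>x. ennreal (h x)) = \<mu>"
    using leb.density_RN_deriv[OF ac sets] density_cong[OF _ _ h(2)] h(1) by simp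
  have h_int: "(\<integral>x. g x \<partial>\<mu>) = (\<integral>x. h x * g x \<partial>leb)" if "g \<in> borel_measurable leb" for g :: "real \<Rightarrow> real"
    unfolding dens[symmetric] using integral_density[OF that h(1)] h(3) by simp
  have ih: "integrable leb h"
  proof (rule integrableI_nonneg[OF h(1)])
    show "AE x in leb. 0 \<le> h x" using h(3) by simp
    have "(\<integral>\<^sup>+x. ennreal (h x) \<partial>leb) = emeasure (density leb (\<lambda>x. ennreal (h x))) (space leb)"
      using h(1) by (subst emeasure_density) (auto intro!: nn_integral_cong)
    also have "\<dots> = 1" unfolding dens using \<mu>.emeasure_space_1 sets_eq_imp_space_eq[OF sets] by simp
    finally show "(\<integral>\<^sup>+x. ennreal (h x) \<partial>leb) < \<infinity>" by simp
  qed
  have h1: "(\<integral>x. h x \<partial>leb) = 1" using h_int[of "\<lambda>x. 1"] \<mu>.prob_space by simp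
  \<comment> \<open>Makes 2B\<epsilon> <= r/2; the added 1 keeps the quotient meaningful when B =
    0.\<close>
  define \<epsilon> where "\<epsilon> = r / (2 * (2 * B + 1))"
  have \<epsilon>: "0 < \<epsilon>" using r \<phi>D(4) by (simp add: \<epsilon>_def)
  obtain B' \<Lambda>' g where g: "lipschitz_bounded B' \<Lambda>' g" and hg: "(\<integral>x. \<bar>(h x - 1) - g x\<bar> \<partial>leb) < \<epsilon>"
    using integrable_lipschitz_approx[OF _ \<epsilon>, of "\<lambda>x. h x - 1"] ih by auto
  note ig = lipschitz_bounded_integrable[OF g]
  define c where "c = (\<integral>x. g x \<partial>leb)"
  have cb: "\<bar>c\<bar> \<le> \<epsilon>"
  proof -
    have "c = - (\<integral>x. (h x - 1) - g x \<partial>leb)" unfolding c_def using ih ig h1 leb.prob_space by simp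
    then have "\<bar>c\<bar> = \<bar>\<integral>x. (h x - 1) - g x \<partial>leb\<bar>" by simp
    also have "\<dots> \<le> (\<integral>x. \<bar>(h x - 1) - g x\<bar> \<partial>leb)" by (rule integral_abs_bound)
    finally show ?thesis using hg by simp
  qed
  have gc: "lipschitz_bounded (B' + \<bar>c\<bar>) (\<Lambda>' + 0) (\<lambda>x. g x + - c)"
    by (rule lipschitz_bounded_add[OF g]) (simp add: lipschitz_bounded_def)
  define D where "D = C * ((2 * (B' + \<bar>c\<bar>) + 3 * (\<Lambda>' + 0)) * (2 / (1 - \<alpha>)))"
  have "(\<lambda>s. B * (D * (ln (real s) / real s) powr (1 / \<alpha> - 1))) \<longlonglongrightarrow> B * (D * 0)"
    by (intro tendsto_mult tendsto_const log_ratio_tendsto_0) (use a in simp)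
  then have "(\<lambda>s. B * (D * (ln (real s) / real s) powr (1 / \<alpha> - 1))) \<longlonglongrightarrow> 0" by simp
  from order_tendstoD(2)[OF this, of "r / 2"] r
  obtain s0 where s0: "\<And>s. s0 \<le> s \<Longrightarrow> B * (D * (ln (real s) / real s) powr (1 / \<alpha> - 1)) < r / 2"
    by (auto simp: eventually_sequentially)
  show "\<exists>no. \<forall>n\<ge>no. norm (word_mean \<Omega> P n (path_mean \<phi>) - 0) < r"
  proof (intro exI[of _ "max 3 s0"] allI impI)
    fix s assume s: "max 3 s0 \<le> s"
    have pos: "\<Omega> \<subseteq> {0<..}" using \<Omega> by auto
    have W: "\<bar>path_mean \<phi> w - (\<integral>x. \<phi> (fold intermittent_map w x) \<partial>\<mu>)\<bar> \<le> 2 * B * \<epsilon> + B * (D * (ln (real s) / real s) powr (1 / \<alpha> - 1))"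
      if w: "set w \<subseteq> \<Omega>" "length w = s" for w
    proof -
      have adm: "set w \<subseteq> {0<..\<alpha>}" using w \<Omega> by auto
      note pw = positive_parameters[OF adm]
      define f where "f x = \<phi> (fold intermittent_map w x)" for x
      have fm: "f \<in> borel_measurable leb" unfolding f_def[abs_def]
        by (rule measurable_compose[OF fold_intermittent_measurable[OF pw] \<phi>m])
      have fb: "\<bar>f x\<bar> \<le> B" if "x \<in> {0..1}" for x unfolding f_def by (rule \<phi>D(2)[OF fold_intermittent_in[OF pw that]])
      have if': "integrable leb (\<lambda>x. q x * f x)" if "integrable leb q" for q by (rule integrable_mult_bounded[OF that fm fb])
      have "(\<integral>x. f x \<partial>\<mu>) - (\<integral>x. f x \<partial>leb) = (\<integral>x. h x * f x \<partial>leb) - (\<integral>x. 1 * f x \<partial>leb)"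
        unfolding h_int[OF fm] by simp
      also have "\<dots> = (\<integral>x. h x * f x - 1 * f x \<partial>leb)"
        by (rule Bochner_Integration.integral_diff[symmetric]; rule if') (use ih in auto)
      \<comment> \<open>The approximant g need not have mean zero, so its mean c, of size at most
        \<epsilon>, is split off as a third term.\<close>
      also have "\<dots> = (\<integral>x. ((h x - 1) - g x) * f x + ((g x + - c) * f x + c * f x) \<partial>leb)"
        by (intro Bochner_Integration.integral_cong refl) (simp add: algebra_simps)
      also have "\<dots> = (\<integral>x. ((h x - 1) - g x) * f x \<partial>leb) + ((\<integral>x. (g x + - c) * f x \<partial>leb) + (\<integral>x. c * f x \<partial>leb))"
      proof -
        have i1: "integrable leb (\<lambda>x. ((h x - 1) - g x) * f x)" by (rule if') (use ih ig in simp)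
        have i2: "integrable leb (\<lambda>x. (g x + - c) * f x)" by (rule if') (use ig in simp)
        have i3: "integrable leb (\<lambda>x. c * f x)" by (rule if') simp
        show ?thesis
          unfolding Bochner_Integration.integral_add[OF i1 Bochner_Integration.integrable_add[OF i2 i3]]
            Bochner_Integration.integral_add[OF i2 i3] ..
      qed
      finally have eq: "(\<integral>x. f x \<partial>\<mu>) - (\<integral>x. f x \<partial>leb)
        = (\<integral>x. ((h x - 1) - g x) * f x \<partial>leb) + ((\<integral>x. (g x + - c) * f x \<partial>leb) + (\<integral>x. c * f x \<partial>leb))" .
      have wB: "\<bar>\<integral>x. q x * f' x \<partial>leb\<bar> \<le> B * (\<integral>x. \<bar>q x\<bar> \<partial>leb)"
        if q: "integrable leb q" and f': "f' \<in> borel_measurable leb" "\<And>x. x \<in> {0..1} \<Longrightarrow> \<bar>f' x\<bar> \<le> B" for q f' :: "real \<Rightarrow> real"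
      proof -
        have "\<bar>\<integral>x. q x * f' x \<partial>leb\<bar> \<le> (\<integral>x. \<bar>q x * f' x\<bar> \<partial>leb)" by (rule integral_abs_bound)
        also have "\<dots> \<le> (\<integral>x. B * \<bar>q x\<bar> \<partial>leb)"
        proof (rule integral_leb_mono)
          show "integrable leb (\<lambda>x. \<bar>q x * f' x\<bar>)" by (rule integrable_abs[OF integrable_mult_bounded[OF q f']])
          show "integrable leb (\<lambda>x. B * \<bar>q x\<bar>)" using q by simp
          fix x :: real assume "0 < x" "x \<le> 1"
          then show "\<bar>q x * f' x\<bar> \<le> B * \<bar>q x\<bar>" using f'(2)[of x] by (simp add: abs_mult mult.commute mult_right_mono)
        qed
        finally show ?thesis by simp
      qed
      have 1: "\<bar>\<integral>x. ((h x - 1) - g x) * f x \<partial>leb\<bar> \<le> B * \<epsilon>"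
      proof -
        have "integrable leb (\<lambda>x. (h x - 1) - g x)" using ih ig by simp
        from wB[OF this fm fb] show ?thesis using mult_left_mono[OF less_imp_le[OF hg] \<phi>D(4)] by linarith
      qed
      have 3: "\<bar>\<integral>x. c * f x \<partial>leb\<bar> \<le> B * \<epsilon>"
        using wB[of "\<lambda>x. c", OF _ fm fb] leb.prob_space mult_left_mono[OF cb \<phi>D(4)] by simp
      \<comment> \<open>The factor 1 is the cone density in the form expected by
        \<open>push_lipschitz_decay\<close>.\<close>
      have igc: "integrable leb (\<lambda>x. 1 * (g x + - c))" using ig by simp
      have "(\<integral>x. (g x + - c) * f x \<partial>leb) = (\<integral>x. push w (\<lambda>x. 1 * (g x + - c)) x * \<phi> x \<partial>leb)"
        using push_dual[OF pw igc \<phi>m \<phi>D(2)] by (simp add: f_def)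
      also have "\<bar>\<dots>\<bar> \<le> B * (\<integral>x. \<bar>push w (\<lambda>x. 1 * (g x + - c)) x\<bar> \<partial>leb)"
        by (rule wB[OF push_integrable[OF pw igc] \<phi>m \<phi>D(2)])
      also have "\<dots> \<le> B * (D * (ln (real s) / real (length w)) powr (1 / \<alpha> - 1))"
      proof (intro mult_left_mono \<phi>D(4))
        have z: "(\<integral>x. 1 * (g x + - c) \<partial>leb) = 0" using ig leb.prob_space by (simp add: c_def)
        show "(\<integral>x. \<bar>push w (\<lambda>x. 1 * (g x + - c)) x\<bar> \<partial>leb) \<le> D * (ln (real s) / real (length w)) powr (1 / \<alpha> - 1)"
          unfolding D_def by (rule push_lipschitz_decay[OF a C density_cone_one[OF a] gc z _ _ _ adm]) (use s w in auto)
      qed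
      finally have 2: "\<bar>\<integral>x. (g x + - c) * f x \<partial>leb\<bar> \<le> B * (D * (ln (real s) / real s) powr (1 / \<alpha> - 1))" using w by simp
      show ?thesis using eq 1 2 3 unfolding path_mean_def f_def[symmetric] by (simp add: abs_le_iff)
    qed
    have "0 = word_mean \<Omega> P s (\<lambda>w. \<integral>x. \<phi> (fold intermittent_map w x) \<partial>\<mu>)"
      using stationary_word_mean[OF P pos st \<phi>m \<phi>D(2), of s] zero by simp
    then have "word_mean \<Omega> P s (path_mean \<phi>) = word_mean \<Omega> P s (\<lambda>w. path_mean \<phi> w - (\<integral>x. \<phi> (fold intermittent_map w x) \<partial>\<mu>))"
      by (simp add: word_mean_diff)
    then have "\<bar>word_mean \<Omega> P s (path_mean \<phi>)\<bar> \<le> 2 * B * \<epsilon> + B * (D * (ln (real s) / real s) powr (1 / \<alpha> - 1))"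
      using word_mean_abs[OF P, of s] W by simp
    also have "\<dots> < 2 * B * \<epsilon> + r / 2" using s0[of s] s by simp
    also have "2 * B * \<epsilon> \<le> r / 2"
      using r \<phi>D(4) by (simp add: \<epsilon>_def field_simps)
    finally show "norm (word_mean \<Omega> P s (path_mean \<phi>) - 0) < r" by simp
  qed
qed

text \<open>The induction step n^(1-s) + (1 - s)(n + 1)^(-s) <= (n + 1)^(1-s) is the weighted mean
  inequality n^(1-s) (n + 1)^s <= (1 - s)n + s(n + 1), divided by (n + 1)^s.\<close>

lemma sum_powr_le:
  fixes s :: real
  assumes "0 \<le> s" "s < 1"
  shows "(\<Sum>r=1..n. real r powr - s) \<le> real n powr (1 - s) / (1 - s)"
proof (induction n)
  case (Suc n)
  have "real n powr (1 - s) + (1 - s) * real (Suc n) powr - s \<le> real (Suc n) powr (1 - s)"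
  proof (cases "n = 0")
    case False
    define N where "N = real (Suc n)"
    have N: "0 < N" "real n = N - 1" by (auto simp: N_def)
    have Z: "N powr s * N powr - s = 1" using N by (simp add: powr_add[symmetric])
    have "real n powr (1 - s) * N powr s \<le> (1 - s) * real n + s * N"
      using assms False N by (intro Youngs_inequality_0) auto
    also have "\<dots> = N - (1 - s)" by (simp add: N(2) algebra_simps)
    finally have "(real n powr (1 - s) * N powr s) * N powr - s \<le> (N - (1 - s)) * N powr - s"
      by (intro mult_right_mono) auto
    moreover have "(real n powr (1 - s) * N powr s) * N powr - s = real n powr (1 - s)"
      unfolding mult.assoc Z by simp
    moreover have "N powr (1 - s) = N * N powr - s" using powr_add[of N 1 "- s"] N by simp
    ultimately show ?thesis unfolding N_def[symmetric] by (simp add: left_diff_distrib)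
  qed (use assms in simp)
  then have "(real n powr (1 - s) + (1 - s) * real (Suc n) powr - s) / (1 - s) \<le> real (Suc n) powr (1 - s) / (1 - s)"
    using assms by (intro divide_right_mono) auto
  then have "real n powr (1 - s) / (1 - s) + real (Suc n) powr - s \<le> real (Suc n) powr (1 - s) / (1 - s)"
    using assms by (simp add: add_divide_distrib)
  then show ?case using Suc.IH by simp
qed simp

lemma path_mean_bound:
  assumes "lipschitz_bounded B \<Lambda> \<phi>" "set w \<subseteq> {0<..}"
  shows "\<bar>path_mean \<phi> w\<bar> \<le> B"
proof -
  note \<phi>D = lipschitz_boundedD[OF assms(1)]
  have b: "\<bar>\<phi> (fold intermittent_map w x)\<bar> \<le> B" if "x \<in> {0..1}" for x
    by (rule \<phi>D(2)[OF fold_intermittent_in[OF assms(2) that]])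
  have i: "integrable leb (\<lambda>x. \<phi> (fold intermittent_map w x))"
    by (rule leb.integrable_const_bound[where B=B])
      (use b measurable_compose[OF fold_intermittent_measurable[OF assms(2)] lipschitz_measurable[OF assms(1)]] in auto)
  have "\<bar>path_mean \<phi> w\<bar> \<le> (\<integral>x. \<bar>\<phi> (fold intermittent_map w x)\<bar> \<partial>leb)"
    unfolding path_mean_def by (rule integral_abs_bound)
  also have "\<dots> \<le> (\<integral>x. B \<partial>leb)" by (rule integral_leb_mono) (use i b in auto)
  finally show ?thesis using leb.prob_space by simp
qed

text \<open>Given the first i parameters, the expected fibrewise mean r steps later is small:
  forgetting the prefix costs \<open>D r\<close>, and the unconditional mean is itself at most
  \<open>D r\<close>. Covariances over a gap r thus decay like a power of (ln n)/r, and summing them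
  over pairs gives the bound.\<close>

lemma path_mean_second_moment:
  assumes a: "0 < \<alpha>" "\<alpha> < 1" and \<phi>: "lipschitz_bounded B \<Lambda> \<phi>"
    and \<Omega>: "\<Omega> \<subseteq> {0<..\<alpha>}" and P: "prob_weights \<Omega> P" and \<mu>: "ac_stationary \<Omega> P \<mu>" and zero: "(\<integral>x. \<phi> x \<partial>\<mu>) = 0"
    and u: "u = min 1 (1 / \<alpha> - 1)"
  obtains K where "\<And>n. 3 \<le> n \<Longrightarrow>
    word_mean \<Omega> P n (\<lambda>w. (\<Sum>j=1..n. path_mean \<phi> (take j w))\<^sup>2) \<le> K * real n powr (2 - 7 * u / 8)"
proof -
  obtain C where C: "loss_bound \<alpha> C" using loss_bound_exists[OF a] .
  note C0 = loss_boundD(1)[OF C] and \<phi>D = lipschitz_boundedD[OF \<phi>]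
  define F where "F = path_mean \<phi>"
  define \<gamma> where "\<gamma> = 1 / \<alpha> - 1"
  \<comment> \<open>An exponent below both 1 and \<gamma>, so that the sums of r^(-s) are of order
    n^(1-s). The logarithm is paid with n^(u/16), and 1 - 15u/16 + u/16 = 1 - 7u/8.\<close>
  define s where "s = 15 * u / 16"
  define c0 where "c0 = B + 2 * (B * (C * (2 / (1 - \<alpha>))))"
  have u01: "0 < u" "u \<le> 1" "u \<le> \<gamma>" using a by (auto simp: u \<gamma>_def)
  have s: "0 < s" "s < 1" "s \<le> \<gamma>" using u01 by (auto simp: s_def)
  have c0: "0 \<le> c0" using \<phi>D(4) C0 a by (simp add: c0_def)
  have FB: "\<bar>F w\<bar> \<le> B" if "set w \<subseteq> \<Omega>" for w
    unfolding F_def by (rule path_mean_bound[OF \<phi>]) (use that \<Omega> in auto)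
  have bound: "word_mean \<Omega> P n (\<lambda>w. (\<Sum>j=1..n. F (take j w))\<^sup>2)
      \<le> (B\<^sup>2 + 2 * B * c0 * (16 / (u * (1 - s)))) * real n powr (2 - 7 * u / 8)" if n: "3 \<le> n" for n
  proof -
    define D where "D r = B * (C * (2 / (1 - \<alpha>)) * (ln (real n) / real r) powr \<gamma>)" for r :: nat
    have "exp 1 \<le> (3 :: real)" by (rule exp_le)
    also have "\<dots> \<le> real n" using n by simp
    finally have lnn: "1 \<le> ln (real n)" using n by (subst ln_ge_iff) auto
    have forget: "\<bar>word_mean \<Omega> P r (\<lambda>v. F (x @ v)) - word_mean \<Omega> P r F\<bar> \<le> D r"
      if "set x \<subseteq> \<Omega>" "1 \<le> r" "r \<le> n" for x r
      unfolding word_mean_diff[symmetric]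
    proof (rule word_mean_abs[OF P])
      fix w :: "real list" assume w: "set w \<subseteq> \<Omega>" "length w = r"
      have "\<bar>path_mean \<phi> (x @ w) - path_mean \<phi> w\<bar> \<le> B * (C * (2 / (1 - \<alpha>)) * (ln (real n) / real (length w)) powr (1 / \<alpha> - 1))"
        by (rule path_mean_forget[OF a C \<phi>]) (use that w \<Omega> n in auto)
      then show "\<bar>F (x @ w) - F w\<bar> \<le> D r" using w by (simp add: F_def D_def \<gamma>_def)
    qed
    have mean: "\<bar>word_mean \<Omega> P r F\<bar> \<le> D r" if r: "1 \<le> r" "r \<le> n" for r
    proof -
      have le: "\<bar>word_mean \<Omega> P (m + r) F - word_mean \<Omega> P r F\<bar> \<le> D r" for m
      proof -
        have "word_mean \<Omega> P (m + r) F - word_mean \<Omega> P r F = word_mean \<Omega> P m (\<lambda>x. word_mean \<Omega> P r (\<lambda>v. F (x @ v)) - word_mean \<Omega> P r F)"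
          unfolding word_mean_append word_mean_diff word_mean_const[OF P] ..
        then show ?thesis using word_mean_abs[OF P, of m] forget r by simp
      qed
      have "(\<lambda>m. word_mean \<Omega> P (m + r) F) \<longlonglongrightarrow> 0"
        unfolding F_def by (rule LIMSEQ_ignore_initial_segment[OF stationary_mean_tendsto[OF a C \<phi> \<Omega> P \<mu> zero]])
      then have "(\<lambda>m. \<bar>word_mean \<Omega> P (m + r) F - word_mean \<Omega> P r F\<bar>) \<longlonglongrightarrow> \<bar>0 - word_mean \<Omega> P r F\<bar>"
        by (intro tendsto_intros)
      then have "\<bar>0 - word_mean \<Omega> P r F\<bar> \<le> D r" by (rule LIMSEQ_le_const2) (use le in auto)
      then show ?thesis by simp
    qed
    \<comment> \<open>Lowering the exponent from \<gamma> to s is allowed where (ln n)/r <= 1; for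
      shorter gaps the trivial bound B suffices. The constant c0 covers both ranges.\<close>
    have cond: "\<bar>word_mean \<Omega> P r (\<lambda>v. F (x @ v))\<bar> \<le> c0 * (ln (real n) / real r) powr s"
      if x: "set x \<subseteq> \<Omega>" and r: "1 \<le> r" "r \<le> n" for x r
    proof (cases "ln (real n) / real r \<le> 1")
      case True
      have p: "0 < ln (real n) / real r" using lnn r n by (auto intro!: divide_pos_pos)
      have "\<bar>word_mean \<Omega> P r (\<lambda>v. F (x @ v))\<bar> \<le> 2 * D r" using forget[OF x r] mean[OF r] by linarith
      also have "\<dots> = 2 * (B * (C * (2 / (1 - \<alpha>)))) * (ln (real n) / real r) powr \<gamma>" by (simp add: D_def)
      also have "\<dots> \<le> c0 * (ln (real n) / real r) powr s"
        using True p s \<phi>D(4) c0 C0 a by (intro mult_mono powr_mono') (auto simp: c0_def)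
      finally show ?thesis .
    next
      case False
      have "\<bar>word_mean \<Omega> P r (\<lambda>v. F (x @ v))\<bar> \<le> B * 1"
        using word_mean_abs[OF P, of r "\<lambda>v. F (x @ v)" B] FB x by simp
      also have "\<dots> \<le> c0 * (ln (real n) / real r) powr s"
        using False s \<phi>D(4) C0 a by (intro mult_mono ge_one_powr_ge_zero) (auto simp: c0_def)
      finally show ?thesis .
    qed
    have cov: "word_mean \<Omega> P n (\<lambda>w. F (take i w) * F (take j w)) \<le> B * (c0 * (ln (real n) / real (j - i)) powr s)"
      if ij: "1 \<le> i" "i < j" "j \<le> n" for i j
    proof -
      have "word_mean \<Omega> P n (\<lambda>w. F (take i w) * F (take j w)) = word_mean \<Omega> P j (\<lambda>w. F (take i w) * F w)"
        using word_mean_take[OF P ij(3), of "\<lambda>w. F (take i w) * F w"] ij by (simp add: min_absorb1)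
      also have "\<dots> = word_mean \<Omega> P (i + (j - i)) (\<lambda>w. F (take i w) * F w)" using ij by simp
      also have "\<dots> \<le> \<bar>\<dots>\<bar>" by simp
      also have "\<dots> \<le> B * (c0 * (ln (real n) / real (j - i)) powr s)"
        unfolding word_mean_append
      proof (rule word_mean_abs[OF P])
        fix x :: "real list" assume x: "set x \<subseteq> \<Omega>" "length x = i"
        have "word_mean \<Omega> P (j - i) (\<lambda>v. F (take i (x @ v)) * F (x @ v)) = F x * word_mean \<Omega> P (j - i) (\<lambda>v. F (x @ v))"
          using x by (simp add: word_mean_cmult)
        then show "\<bar>word_mean \<Omega> P (j - i) (\<lambda>v. F (take i (x @ v)) * F (x @ v))\<bar> \<le> B * (c0 * (ln (real n) / real (j - i)) powr s)"
          using FB[OF x(1)] cond[OF x(1), of "j - i"] ij \<phi>D(4) by (simp add: abs_mult mult_mono)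
      qed
      finally show ?thesis .
    qed
    define S where "S = (\<Sum>r=1..n. (ln (real n) / real r) powr s)"
    have step: "word_mean \<Omega> P n (\<lambda>w. (\<Sum>j=1..m. F (take j w))\<^sup>2) \<le> real m * (B\<^sup>2 + 2 * B * c0 * S)" if "m \<le> n" for m
      using that
    proof (induction m)
      case 0
      show ?case using word_mean_const[OF P, of n 0] by simp
    next
      case (Suc m)
      have e: "(\<Sum>j=1..Suc m. F (take j w))\<^sup>2 = (\<Sum>j=1..m. F (take j w))\<^sup>2
          + (2 * (\<Sum>j=1..m. F (take j w) * F (take (Suc m) w)) + (F (take (Suc m) w))\<^sup>2)" for w
        by (simp add: power2_eq_square algebra_simps sum_distrib_left)
      have "word_mean \<Omega> P n (\<lambda>w. (F (take (Suc m) w))\<^sup>2) \<le> word_mean \<Omega> P n (\<lambda>w. B\<^sup>2)"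
      proof (rule word_mean_mono[OF P])
        fix w :: "real list" assume "set w \<subseteq> \<Omega>"
        then have "\<bar>F (take (Suc m) w)\<bar> \<le> B" by (intro FB) (meson set_take_subset subset_trans)
        then show "(F (take (Suc m) w))\<^sup>2 \<le> B\<^sup>2" using abs_le_square_iff[of "F (take (Suc m) w)" B] \<phi>D(4) by simp
      qed
      then have 1: "word_mean \<Omega> P n (\<lambda>w. (F (take (Suc m) w))\<^sup>2) \<le> B\<^sup>2" unfolding word_mean_const[OF P] .
      have "(\<Sum>j=1..m. word_mean \<Omega> P n (\<lambda>w. F (take j w) * F (take (Suc m) w)))
          \<le> (\<Sum>j=1..m. B * (c0 * (ln (real n) / real (Suc m - j)) powr s))"
        using Suc.prems by (intro sum_mono cov) auto
      also have "\<dots> = B * c0 * (\<Sum>j=1..m. (ln (real n) / real (m + 1 - j)) powr s)" by (simp add: sum_distrib_left mult.assoc)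
      also have "(\<Sum>j=1..m. (ln (real n) / real (m + 1 - j)) powr s) = (\<Sum>r=1..m. (ln (real n) / real r) powr s)"
        by (rule sum.atLeastAtMost_rev[symmetric])
      also have "\<dots> \<le> S" unfolding S_def using Suc.prems by (intro sum_mono2) auto
      finally have 2: "(\<Sum>j=1..m. word_mean \<Omega> P n (\<lambda>w. F (take j w) * F (take (Suc m) w))) \<le> B * c0 * S"
        using \<phi>D(4) c0 by (simp add: mult_left_mono)
      have "word_mean \<Omega> P n (\<lambda>w. (\<Sum>j=1..Suc m. F (take j w))\<^sup>2) = word_mean \<Omega> P n (\<lambda>w. (\<Sum>j=1..m. F (take j w))\<^sup>2)
          + (2 * (\<Sum>j=1..m. word_mean \<Omega> P n (\<lambda>w. F (take j w) * F (take (Suc m) w))) + word_mean \<Omega> P n (\<lambda>w. (F (take (Suc m) w))\<^sup>2))"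
        unfolding e word_mean_add word_mean_cmult word_mean_sum ..
      also have "\<dots> \<le> real m * (B\<^sup>2 + 2 * B * c0 * S) + (2 * (B * c0 * S) + B\<^sup>2)"
        using Suc 1 2 by (intro add_mono mult_left_mono) auto
      also have "\<dots> = real (Suc m) * (B\<^sup>2 + 2 * B * c0 * S)" by (simp add: algebra_simps)
      finally show ?case .
    qed
    define Q where "Q = real n powr (1 - 7 * u / 8)"
    have Q1: "1 \<le> Q" unfolding Q_def using n u01 by (intro ge_one_powr_ge_zero) auto
    have "ln (real n) = 16 / u * ln (real n powr (u / 16))" using u01 n by (simp add: ln_powr)
    also have "\<dots> \<le> 16 / u * real n powr (u / 16)" using u01 n by (intro mult_left_mono ln_bound) auto
    finally have lnle: "ln (real n) \<le> 16 / u * real n powr (u / 16)" .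
    have "S = ln (real n) powr s * (\<Sum>r=1..n. real r powr - s)"
      unfolding S_def sum_distrib_left using lnn by (intro sum.cong refl) (simp add: powr_divide powr_minus_divide)
    also have "\<dots> \<le> ln (real n) powr 1 * (real n powr (1 - s) / (1 - s))"
      using lnn s by (intro mult_mono sum_powr_le powr_mono sum_nonneg) auto
    also have "\<dots> \<le> 16 / u * real n powr (u / 16) * (real n powr (1 - s) / (1 - s))"
      using lnle lnn s by (intro mult_right_mono) auto
    also have "\<dots> = 16 / (u * (1 - s)) * Q"
      unfolding Q_def s_def by (simp add: powr_add[symmetric] algebra_simps)
    finally have SQ: "S \<le> 16 / (u * (1 - s)) * Q" .
    have "word_mean \<Omega> P n (\<lambda>w. (\<Sum>j=1..n. F (take j w))\<^sup>2) \<le> real n * (B\<^sup>2 + 2 * B * c0 * S)" by (rule step) simp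
    also have "\<dots> \<le> real n * (B\<^sup>2 * Q + 2 * B * c0 * (16 / (u * (1 - s)) * Q))"
      using Q1 SQ \<phi>D(4) c0 by (intro mult_left_mono add_mono) (auto simp: mult_le_cancel_left1)
    also have "\<dots> = (B\<^sup>2 + 2 * B * c0 * (16 / (u * (1 - s)))) * (real n * Q)" by (simp add: algebra_simps)
    also have "real n * Q = real n powr (2 - 7 * u / 8)"
      unfolding Q_def using powr_add[of "real n" 1 "1 - 7 * u / 8"] n by simp
    finally show ?thesis .
  qed
  show thesis by (rule that[OF bound[unfolded F_def]])
qed

section \<open>Almost sure bound for the sum of the fibrewise means\<close>

lemma power_bracket:
  fixes n q :: nat
  assumes "1 \<le> q"
  shows "\<exists>l. l ^ q \<le> n \<and> n < Suc l ^ q"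
proof (induction n)
  case 0
  then show ?case using assms by (intro exI[of _ 0]) (auto simp: zero_power)
next
  case (Suc n)
  then obtain l where l: "l ^ q \<le> n" "n < Suc l ^ q" by blast
  show ?case
  proof (cases "Suc n < Suc l ^ q")
    case False
    then have "Suc l ^ q = Suc n" using l by simp
    moreover have "Suc l ^ q < Suc (Suc l) ^ q" using assms by (intro power_strict_mono) auto
    ultimately show ?thesis by (intro exI[of _ "Suc l"]) simp
  qed (use l in \<open>auto intro: exI[of _ l]\<close>)
qed

text \<open>Chebyshev's probabilities are not known to be summable over all n, but they are along n
  = l^q for large q. Between such times the sum moves by at most B per step, and q must be small
  enough for the gaps to stay below n^(1-\<theta>).\<close>

lemma path_mean_sum_small:
  assumes a: "0 < \<alpha>" "\<alpha> < 1" and \<phi>: "lipschitz_bounded B \<Lambda> \<phi>"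
    and \<Omega>: "\<Omega> \<subseteq> {0<..\<alpha>}" and P: "prob_weights \<Omega> P" and \<mu>: "ac_stationary \<Omega> P \<mu>" and zero: "(\<integral>x. \<phi> x \<partial>\<mu>) = 0"
    and u: "u = min 1 (1 / \<alpha> - 1)" and \<theta>: "0 < \<theta>" "\<theta> < u / 4"
  shows "AE \<omega> in sequence_measure \<Omega> P. \<exists>N. \<forall>n\<ge>N. \<bar>\<Sum>j=1..n. path_mean \<phi> (map \<omega> [0..<j])\<bar> \<le> real n powr (1 - \<theta>)"
proof -
  define S where "S = sequence_measure \<Omega> P"
  define Z where "Z n \<omega> = (\<Sum>j=1..n. path_mean \<phi> (map \<omega> [0..<j]))" for n \<omega>
  note \<phi>D = lipschitz_boundedD[OF \<phi>]
  have fin: "finite \<Omega>" using P by (simp add: prob_weights_def)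
  interpret S: prob_space S
    unfolding S_def sequence_measure_def by (rule prob_space_PiM) (rule prob_space_weight_measure[OF P])
  have u01: "0 < u" "u \<le> 1" using a by (auto simp: u)
  obtain K where K: "\<And>n. 3 \<le> n \<Longrightarrow>
    word_mean \<Omega> P n (\<lambda>w. (\<Sum>j=1..n. path_mean \<phi> (take j w))\<^sup>2) \<le> K * real n powr (2 - 7 * u / 8)"
    using path_mean_second_moment[OF a \<phi> \<Omega> P \<mu> zero u] by blast
  have Zp: "Z n \<omega> = (\<lambda>w. \<Sum>j=1..n. path_mean \<phi> (take j w)) (map \<omega> [0..<n])" for n \<omega>
    unfolding Z_def by (auto intro!: sum.cong simp: take_map)
  have Zm[measurable]: "Z n \<in> borel_measurable S" for n
    unfolding Zp[abs_def] S_def by (rule measurable_prefix[OF fin])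
  have wordin: "set (map \<omega> xs) \<subseteq> \<Omega>" if "\<omega> \<in> space S" for \<omega> xs
    using that by (auto simp: S_def sequence_measure_def space_PiM space_point_measure)
  have FB: "\<bar>path_mean \<phi> (map \<omega> xs)\<bar> \<le> B" if "\<omega> \<in> space S" for \<omega> xs
    by (rule path_mean_bound[OF \<phi> order_trans[OF wordin[OF that]]]) (use \<Omega> in auto)
  have Zdiff: "\<bar>Z n \<omega> - Z m \<omega>\<bar> \<le> B * (real n - real m)" if "m \<le> n" "\<omega> \<in> space S" for m n \<omega>
    using that(1)
  proof (induction n rule: dec_induct)
    case (step n)
    have "Z (Suc n) \<omega> = Z n \<omega> + path_mean \<phi> (map \<omega> [0..<Suc n])" by (simp add: Z_def)
    then show ?case using step.IH FB[OF that(2), of "[0..<Suc n]"] by (simp add: algebra_simps)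
  qed simp
  have Z2: "(\<integral>\<omega>. (Z n \<omega>)\<^sup>2 \<partial>S) \<le> K * real n powr (2 - 7 * u / 8)" if "3 \<le> n" for n
    using K[OF that] integral_prefix[OF P, of "\<lambda>w. (\<Sum>j=1..n. path_mean \<phi> (take j w))\<^sup>2" n] unfolding Zp S_def by simp
  have Zi: "integrable S (\<lambda>\<omega>. (Z n \<omega>)\<^sup>2)" for n
  proof (rule S.integrable_const_bound[where B="(B * real n)\<^sup>2"])
    have "\<bar>Z n \<omega>\<bar> \<le> \<bar>B * real n\<bar>" if "\<omega> \<in> space S" for \<omega>
      using Zdiff[OF le0 that, of n] \<phi>D(4) by (simp add: Z_def)
    then show "AE \<omega> in S. norm ((Z n \<omega>)\<^sup>2) \<le> (B * real n)\<^sup>2"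
      by (intro AE_I2) (simp add: abs_le_square_iff)
  qed measurable
  have K0: "0 \<le> K"
  proof -
    have "0 \<le> (\<integral>\<omega>. (Z 3 \<omega>)\<^sup>2 \<partial>S)" by simp
    also have "\<dots> \<le> K * real 3 powr (2 - 7 * u / 8)" by (rule Z2) simp
    finally show ?thesis by (simp add: zero_le_mult_iff)
  qed
  \<comment> \<open>Above 3/u for summability, at most 4/u so that q\<theta> < 1.\<close>
  define q where "q = nat \<lfloor>3 / u\<rfloor> + 1"
  have q: "1 \<le> q" "3 / u < real q" "real q \<le> 4 / u"
  proof -
    have "0 \<le> 3 / u" using u01 by simp
    then have rq: "real q = of_int \<lfloor>3 / u\<rfloor> + 1" unfolding q_def by simp
    show "1 \<le> q" by (simp add: q_def)
    show "3 / u < real q" unfolding rq by linarith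
    have "real q \<le> 3 / u + 1" unfolding rq by linarith
    also have "\<dots> \<le> 4 / u" using u01 by (simp add: field_simps)
    finally show "real q \<le> 4 / u" .
  qed
  obtain m where m: "q = Suc m" using q(1) by (cases q) auto
  have q\<theta>: "real q * \<theta> < 1"
  proof -
    have "real q * \<theta> \<le> 4 / u * \<theta>" using q \<theta> by (intro mult_right_mono) auto
    also have "\<dots> < 1" using \<theta> u01 by (simp add: field_simps)
    finally show ?thesis .
  qed
  \<comment> \<open>Decay exponent in l of the exceptional probabilities. As \<theta> < u/4, the
    bracket exceeds 3u/8, and q > 3/u makes e larger than 9/8.\<close>
  define e where "e = real q * (7 * u / 8 - 2 * \<theta>)"
  have e: "1 < e"
  proof -
    have "1 < 3 / u * (3 * u / 8)" using u01 by simp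
    also have "\<dots> \<le> real q * (7 * u / 8 - 2 * \<theta>)" using q \<theta> u01 by (intro mult_mono) auto
    finally show ?thesis by (simp add: e_def)
  qed
  define A where "A l = {\<omega> \<in> space S. (1/2 * real (l ^ q) powr (1 - \<theta>))\<^sup>2 < (Z (l ^ q) \<omega>)\<^sup>2}" for l
  have Am: "A l \<in> sets S" for l unfolding A_def by measurable
  have Ap: "measure S (A l) \<le> 4 * K * real l powr - e" if l: "3 \<le> l" for l
  proof -
    define n where "n = l ^ q"
    have "l ^ 1 \<le> l ^ q" using l q by (intro power_increasing) auto
    then have n3: "3 \<le> n" using l by (simp add: n_def)
    define t where "t = (1/2 * real n powr (1 - \<theta>))\<^sup>2"
    have t: "0 < t" "t = 1/4 * real n powr (2 - 2 * \<theta>)"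
      using n3 by (simp_all add: t_def power_mult_distrib powr_power) (simp add: power2_eq_square powr_add[symmetric])
    have "measure S (A l) \<le> measure S {\<omega> \<in> space S. t \<le> (Z n \<omega>)\<^sup>2}"
      unfolding A_def n_def t_def by (rule S.finite_measure_mono) (auto simp: less_imp_le)
    also have "\<dots> \<le> (\<integral>\<omega>. (Z n \<omega>)\<^sup>2 \<partial>S) / t"
      by (rule integral_Markov_inequality_measure[where A="{}"]) (use Zi t(1) in auto)
    also have "\<dots> \<le> K * real n powr (2 - 7 * u / 8) / t" using Z2[OF n3] less_imp_le[OF t(1)] by (intro divide_right_mono)
    also have "\<dots> = 4 * K * (real n powr (2 - 7 * u / 8) / real n powr (2 - 2 * \<theta>))" unfolding t(2) by simp
    also have "real n powr (2 - 7 * u / 8) / real n powr (2 - 2 * \<theta>) = real n powr - (7 * u / 8 - 2 * \<theta>)"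
      unfolding powr_diff[symmetric] by (simp add: algebra_simps)
    also have "\<dots> = real l powr - e"
    proof -
      have "real n = real l powr real q" using l by (simp add: n_def powr_realpow)
      then show ?thesis unfolding e_def by (simp only: powr_powr mult_minus_right)
    qed
    finally show ?thesis .
  qed
  have "summable (\<lambda>l. measure S (A l))"
  proof (rule summable_comparison_test_ev)
    show "\<forall>\<^sub>F l in sequentially. norm (measure S (A l)) \<le> 4 * K * real l powr - e"
      using Ap by (intro eventually_sequentiallyI[of 3]) auto
    show "summable (\<lambda>l. 4 * K * real l powr - e)"
      using e by (intro summable_mult) (simp add: summable_real_powr_iff)
  qed
  then have "AE \<omega> in S. \<forall>\<^sub>F l in sequentially. \<omega> \<in> space S - A l"
    by (intro borel_cantelli_AE1 Am) (auto simp: S.emeasure_eq_measure)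
  moreover have "\<exists>N. \<forall>n\<ge>N. \<bar>Z n \<omega>\<bar> \<le> real n powr (1 - \<theta>)"
    if ev: "\<forall>\<^sub>F l in sequentially. \<omega> \<in> space S - A l" for \<omega>
  proof -
    obtain L where L: "\<And>l. L \<le> l \<Longrightarrow> \<omega> \<in> space S - A l" using ev by (auto simp: eventually_sequentially)
    have \<omega>: "\<omega> \<in> space S" using L[of L] by simp
    define c where "c = B * (real q * 2 ^ m)"
    have c: "0 \<le> c" using \<phi>D(4) by (simp add: c_def)
    have pe: "0 < 1 / real q - \<theta>" using q\<theta> q(1) by (simp add: field_simps)
    \<comment> \<open>From here on c n^(1 - 1/q), the largest possible change within a gap, is at
      most half of n^(1-\<theta>).\<close>
    define N0 where "N0 = nat \<lceil>(2 * c) powr (1 / (1 / real q - \<theta>))\<rceil>"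
    have N0: "2 * c \<le> real n powr (1 / real q - \<theta>)" if "N0 \<le> n" for n
    proof -
      have "(2 * c) powr (1 / (1 / real q - \<theta>)) \<le> real n" using that unfolding N0_def by (simp add: nat_ceiling_le_eq)
      then have "((2 * c) powr (1 / (1 / real q - \<theta>))) powr (1 / real q - \<theta>) \<le> real n powr (1 / real q - \<theta>)"
        using pe by (intro powr_mono2) auto
      moreover have "1 / (1 / real q - \<theta>) * (1 / real q - \<theta>) = 1" using pe by simp
      ultimately show ?thesis using c by (simp only: powr_powr) simp
    qed
    show ?thesis
    proof (intro exI[of _ "max N0 (max 1 (Suc L ^ q))"] allI impI)
      fix n assume n: "max N0 (max 1 (Suc L ^ q)) \<le> n"
      obtain l where l: "l ^ q \<le> n" "n < Suc l ^ q" using power_bracket[OF q(1)] by blast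
      have "Suc L ^ q < Suc l ^ q" using n l by simp
      then have "L < l" using power_less_imp_less_base[of "Suc L" q "Suc l"] by simp
      then have l1: "1 \<le> l" "L \<le> l" by auto
      have n0: "0 < real n" using n unfolding max.bounded_iff by linarith
      have "\<not> (1/2 * real (l ^ q) powr (1 - \<theta>))\<^sup>2 < (Z (l ^ q) \<omega>)\<^sup>2" using L[OF l1(2)] \<omega> by (auto simp: A_def)
      then have "\<bar>Z (l ^ q) \<omega>\<bar> \<le> 1/2 * real (l ^ q) powr (1 - \<theta>)"
        using abs_le_square_iff[of "Z (l ^ q) \<omega>" "1/2 * real (l ^ q) powr (1 - \<theta>)"] by simp
      also have "\<dots> \<le> 1/2 * real n powr (1 - \<theta>)"
        using l(1) \<theta> u01 by (intro mult_left_mono powr_mono2 of_nat_mono) auto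
      finally have 1: "\<bar>Z (l ^ q) \<omega>\<bar> \<le> 1/2 * real n powr (1 - \<theta>)" .
      \<comment> \<open>The gap around n has length at most q(2l)^(q-1), hence at most a constant
        times n^(1 - 1/q).\<close>
      have "real n - real (l ^ q) \<le> real (Suc l ^ q) - real (l ^ q)" using l(2) by linarith
      also have "\<dots> \<le> \<bar>real (Suc l) ^ Suc m - real l ^ Suc m\<bar>" unfolding m of_nat_power by (rule abs_ge_self)
      also have "\<dots> \<le> real (Suc m) * \<bar>real (Suc l) - real l\<bar> * real (Suc l) ^ m"
        by (rule power_diff_bound) auto
      also have "\<dots> \<le> real q * 1 * (2 * real l) ^ m"
        using l1 by (intro mult_mono power_mono) (auto simp: m)
      also have "\<dots> = real q * 2 ^ m * real l powr real m" using l1 by (simp add: power_mult_distrib powr_realpow)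
      also have "real l powr real m \<le> real n powr (1 - 1 / real q)"
      proof -
        have "real l powr real m = (real l powr real q) powr (real m / real q)" using q by (simp add: powr_powr)
        also have "real l powr real q = real (l ^ q)" using l1 by (simp add: powr_realpow)
        also have "real (l ^ q) powr (real m / real q) \<le> real n powr (real m / real q)"
          using l(1) by (intro powr_mono2 of_nat_mono) auto
        also have "real m / real q = 1 - 1 / real q" by (simp add: m field_simps)
        finally show ?thesis .
      qed
      finally have "real n - real (l ^ q) \<le> real q * 2 ^ m * real n powr (1 - 1 / real q)" by (simp add: mult_left_mono)
      then have "B * (real n - real (l ^ q)) \<le> c * real n powr (1 - 1 / real q)"
        using \<phi>D(4) by (simp add: c_def mult_left_mono mult.assoc)
      also have "\<dots> = 1/2 * (2 * c) * real n powr (1 - 1 / real q)" by simp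
      also have "\<dots> \<le> 1/2 * real n powr (1 / real q - \<theta>) * real n powr (1 - 1 / real q)"
        using N0[of n] n by (intro mult_right_mono mult_left_mono) auto
      also have "\<dots> = 1/2 * real n powr (1 - \<theta>)" by (simp add: powr_add[symmetric])
      finally have 2: "\<bar>Z n \<omega> - Z (l ^ q) \<omega>\<bar> \<le> 1/2 * real n powr (1 - \<theta>)"
        using Zdiff[OF l(1) \<omega>] by simp
      show "\<bar>Z n \<omega>\<bar> \<le> real n powr (1 - \<theta>)" using 1 2 by linarith
    qed
  qed
  ultimately show ?thesis unfolding S_def[symmetric] Z_def[symmetric] by (rule eventually_mono)
qed

section \<open>Quenched large deviations\<close>

lemma C1_lipschitz_bounded:
  assumes "C1_unit_interval \<phi>"
  obtains B \<Lambda> where "lipschitz_bounded B \<Lambda> \<phi>"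
proof -
  obtain \<phi>' where d: "\<And>x. x \<in> {0..1} \<Longrightarrow> (\<phi> has_real_derivative \<phi>' x) (at x within {0..1})"
    and c: "continuous_on {0..1} \<phi>'"
    using assms unfolding C1_unit_interval_def by blast
  have "bounded (\<phi>' ` {0..1})" by (rule compact_imp_bounded[OF compact_continuous_image[OF c compact_Icc]])
  then obtain \<Lambda> where "\<forall>x\<in>{0..1}. norm (\<phi>' x) \<le> \<Lambda>" by (auto simp: bounded_iff)
  then have \<Lambda>: "norm (\<phi>' x) \<le> \<Lambda>" if "x \<in> {0..1}" for x using that by blast
  have lip: "\<bar>\<phi> x - \<phi> y\<bar> \<le> \<Lambda> * \<bar>x - y\<bar>" if "x \<in> {0..1}" "y \<in> {0..1}" for x y
    using field_differentiable_bound[OF convex_closed_interval d \<Lambda> that] that by (simp add: abs_minus_commute)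
  have \<Lambda>0: "0 \<le> \<Lambda>" using order_trans[OF norm_ge_zero \<Lambda>[of 0]] by simp
  have "\<bar>\<phi> x\<bar> \<le> \<bar>\<phi> 0\<bar> + \<Lambda>" if x: "x \<in> {0..1}" for x
  proof -
    have "\<bar>\<phi> x - \<phi> 0\<bar> \<le> \<Lambda> * \<bar>x - 0\<bar>" using lip[OF x, of 0] by simp
    also have "\<dots> \<le> \<Lambda>" using x \<Lambda>0 by (simp add: mult_left_le)
    finally show ?thesis by linarith
  qed
  then have "lipschitz_bounded (\<bar>\<phi> 0\<bar> + \<Lambda>) \<Lambda> \<phi>" using lip \<Lambda>0 by (simp add: lipschitz_bounded_def)
  then show thesis by (rule that)
qed

text \<open>Markov's inequality for the power 2l + 2 of the centred sum at level n\<epsilon>. On the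
  event the full sum exceeds 4n\<epsilon> and the means contribute at most n\<epsilon>, so the
  centred sum passes this level.\<close>

lemma centered_deviation:
  assumes a: "0 < \<alpha>" "\<alpha> < 1" and C: "loss_bound \<alpha> C" and \<phi>: "lipschitz_bounded B \<Lambda> \<phi>"
    and \<omega>: "\<And>i. \<omega> i \<in> {0<..\<alpha>}" and n: "3 \<le> n" and l: "2 * (1 / \<alpha> - 1) \<le> real l" and \<epsilon>: "0 < \<epsilon>"
    and mean: "\<bar>\<Sum>j=1..n. path_mean \<phi> (map \<omega> [0..<j])\<bar> \<le> real n * \<epsilon>"
  shows "measure leb {x\<in>{0..1}. \<bar>\<Sum>j=1..n. \<phi> (orbit \<omega> j x)\<bar> > 4 * real n * \<epsilon>}
    \<le> moment_const l (2 * B) (2 * B) (C * ((4 * B + 3 * \<Lambda>) * (2 / (1 - \<alpha>))))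
      * real n powr (1 - 1 / \<alpha>) * ln (real n) powr (1 / \<alpha> - 1) * \<epsilon> powr - real (2 * l + 2)"
proof -
  define M where "M = moment_const l (2 * B) (2 * B) (C * ((4 * B + 3 * \<Lambda>) * (2 / (1 - \<alpha>))))"
  define c where "c j = (\<integral>x. \<phi> (orbit \<omega> j x) \<partial>leb)" for j
  define s where "s x = (\<Sum>j=1..n. \<phi> (orbit \<omega> j x) - c j)" for x
  have pos: "set (map \<omega> xs) \<subseteq> {0<..}" for xs using \<omega> by auto
  have c: "path_mean \<phi> (map \<omega> [0..<j]) = c j" for j by (simp add: path_mean_def c_def orbit_fold)
  have ot: "(\<lambda>x. \<phi> (orbit \<omega> j x)) \<in> borel_measurable leb" for j
    unfolding orbit_fold by (rule measurable_compose[OF fold_intermittent_measurable[OF pos] lipschitz_measurable[OF \<phi>]])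
  have sm[measurable]: "s \<in> borel_measurable leb" unfolding s_def[abs_def] using ot by measurable
  have ob: "\<bar>\<phi> (orbit \<omega> j x)\<bar> \<le> B" if "x \<in> {0..1}" for j x
    unfolding orbit_fold by (rule lipschitz_boundedD(2)[OF \<phi> fold_intermittent_in[OF pos that]])
  have si: "integrable leb (\<lambda>x. s x ^ (2 * l + 2))"
  proof (rule leb.integrable_const_bound[where B="(\<Sum>j=1..n. B + \<bar>c j\<bar>) ^ (2 * l + 2)"])
    show "(\<lambda>x. s x ^ (2 * l + 2)) \<in> borel_measurable leb" by measurable
    show "AE x in leb. norm (s x ^ (2 * l + 2)) \<le> (\<Sum>j=1..n. B + \<bar>c j\<bar>) ^ (2 * l + 2)"
    proof (rule AE_I2)
      fix x assume x: "x \<in> space leb"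
      have "\<bar>s x\<bar> \<le> (\<Sum>j=1..n. B + \<bar>c j\<bar>)"
        unfolding s_def
      proof (rule order_trans[OF sum_abs sum_mono])
        show "\<bar>\<phi> (orbit \<omega> j x) - c j\<bar> \<le> B + \<bar>c j\<bar>" for j using ob[of x j] x by simp
      qed
      then show "norm (s x ^ (2 * l + 2)) \<le> (\<Sum>j=1..n. B + \<bar>c j\<bar>) ^ (2 * l + 2)"
        unfolding real_norm_def power_abs by (intro power_mono) auto
    qed
  qed
  define t where "t = (real n * \<epsilon>) ^ (2 * l + 2)"
  have n0: "0 < real n" using n by simp
  have t: "0 < t" using n0 \<epsilon> by (simp add: t_def)
  have "measure leb {x\<in>{0..1}. \<bar>\<Sum>j=1..n. \<phi> (orbit \<omega> j x)\<bar> > 4 * real n * \<epsilon>}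
      \<le> measure leb {x \<in> space leb. t \<le> s x ^ (2 * l + 2)}"
  proof (rule leb.finite_measure_mono)
    show "{x\<in>{0..1}. \<bar>\<Sum>j=1..n. \<phi> (orbit \<omega> j x)\<bar> > 4 * real n * \<epsilon>} \<subseteq> {x \<in> space leb. t \<le> s x ^ (2 * l + 2)}"
    proof safe
      fix x assume x: "x \<in> {0..1}" "\<bar>\<Sum>j=1..n. \<phi> (orbit \<omega> j x)\<bar> > 4 * real n * \<epsilon>"
      show "x \<in> space leb" using x by simp
      have "s x = (\<Sum>j=1..n. \<phi> (orbit \<omega> j x)) - (\<Sum>j=1..n. c j)" by (simp add: s_def sum_subtractf)
      moreover have "0 \<le> real n * \<epsilon>" using n0 \<epsilon> by simp
      ultimately have "real n * \<epsilon> \<le> \<bar>s x\<bar>" using x(2) mean unfolding c by linarith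
      then have "t \<le> \<bar>s x\<bar> ^ (2 * l + 2)" unfolding t_def using n0 \<epsilon> by (intro power_mono) auto
      also have "\<dots> = s x ^ (2 * l + 2)" by (rule power_even_abs) simp
      finally show "t \<le> s x ^ (2 * l + 2)" .
    qed
  qed measurable
  also have "\<dots> \<le> (\<integral>x. s x ^ (2 * l + 2) \<partial>leb) / t"
    by (rule integral_Markov_inequality_measure[where A="{}", OF si _ _ t]) (auto intro!: AE_I2 zero_le_even_power simp del: power_Suc)
  also have "\<dots> \<le> (M * real n powr (real (2 * l + 2) - (1 / \<alpha> - 1)) * ln (real n) powr (1 / \<alpha> - 1)) / t"
    using sequential_moment[OF a C \<phi> \<omega> n l] t unfolding s_def c_def M_def by (intro divide_right_mono) auto
  also have "t = real n powr real (2 * l + 2) * \<epsilon> powr real (2 * l + 2)"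
    unfolding t_def powr_realpow[OF n0] powr_realpow[OF \<epsilon>] by (rule power_mult_distrib)
  also have "(M * real n powr (real (2 * l + 2) - (1 / \<alpha> - 1)) * ln (real n) powr (1 / \<alpha> - 1)) / \<dots>
      = M * (real n powr (real (2 * l + 2) - (1 / \<alpha> - 1)) / real n powr real (2 * l + 2)) * ln (real n) powr (1 / \<alpha> - 1) * (1 / \<epsilon> powr real (2 * l + 2))"
    by simp
  also have "real n powr (real (2 * l + 2) - (1 / \<alpha> - 1)) / real n powr real (2 * l + 2) = real n powr (1 - 1 / \<alpha>)"
    unfolding powr_diff[symmetric] by simp
  also have "1 / \<epsilon> powr real (2 * l + 2) = \<epsilon> powr - real (2 * l + 2)" by (simp only: powr_minus_divide)
  finally show ?thesis unfolding M_def .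
qed

theorem theorem4p8:
  fixes \<alpha> p :: real and \<phi> :: "real \<Rightarrow> real" and \<kappa> :: int
  assumes "0 < \<alpha>" and "\<alpha> < 1"
    and "C1_unit_interval \<phi>"
    and "p > max 1 (1 / \<alpha> - 1)"
    and "\<kappa> = \<lceil>4 * p / (1 - \<alpha>)\<rceil>"
  shows "\<exists>C::real. \<forall>\<Omega> P \<mu>.
    \<Omega> \<subseteq> {0<..<\<alpha>} \<longrightarrow> prob_weights \<Omega> P \<longrightarrow> ac_stationary \<Omega> P \<mu> \<longrightarrow>
    (\<integral>x. \<phi> x \<partial>\<mu>) = 0 \<longrightarrow>
    (AE \<omega> in sequence_measure \<Omega> P. \<exists>N::nat. \<forall>\<epsilon>>0. \<forall>n\<ge>N.
      measure unit_lebesgue {x\<in>{0..1}. \<bar>\<Sum>j=1..n. \<phi> (orbit \<omega> j x)\<bar> > 4 * real n * \<epsilon>}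
        \<le> C * real n powr (1 - 1 / \<alpha>) * ln (real n) powr (1 / \<alpha>) * \<epsilon> powi (- \<kappa>))"
proof -
  note a = assms(1,2)
  define \<gamma> where "\<gamma> = 1 / \<alpha> - 1"
  define u where "u = min 1 (1 / \<alpha> - 1)"
  define l where "l = nat \<lceil>2 * \<gamma>\<rceil>"
  define d where "d = real (2 * l + 2)"
  define \<theta> where "\<theta> = \<gamma> / of_int \<kappa>"
  have \<gamma>: "0 < \<gamma>" using a by (simp add: \<gamma>_def)
  have p: "1 < p" "\<gamma> < p" using assms(4) by (auto simp: \<gamma>_def)
  have \<kappa>: "4 * p / (1 - \<alpha>) \<le> of_int \<kappa>" unfolding assms(5) by (rule le_of_int_ceiling)
  have l: "2 * \<gamma> \<le> real l" "real l < 2 * \<gamma> + 1" using \<gamma> unfolding l_def by linarith+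
  have "4 * \<gamma> / (1 - \<alpha>) < 4 * p / (1 - \<alpha>)" using p a by (intro divide_strict_right_mono) auto
  moreover have "4 * \<gamma> / (1 - \<alpha>) = 4 * \<gamma> + 4" using a by (simp add: \<gamma>_def field_simps)
  ultimately have \<kappa>d: "d < of_int \<kappa>" using \<kappa> l by (simp add: d_def)
  have \<kappa>0: "0 < (of_int \<kappa> :: real)" using \<kappa>d by (simp add: d_def)
  have \<theta>: "0 < \<theta>" "\<theta> < u / 4"
  proof -
    show "0 < \<theta>" using \<gamma> \<kappa>0 by (simp add: \<theta>_def)
    have "4 * p \<le> 4 * p / (1 - \<alpha>)" using p a by (simp add: field_simps)
    then have "4 * p \<le> of_int \<kappa>" using \<kappa> by simp
    \<comment> \<open>Both conditions on p are used: p > 1 makes \<gamma>/p less than \<gamma>, and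
      p > \<gamma> makes it less than 1.\<close>
    then have "\<theta> \<le> \<gamma> / (4 * p)" unfolding \<theta>_def using \<gamma> p \<kappa>0 by (intro divide_left_mono) auto
    moreover have "\<gamma> / p < u" using \<gamma> p by (simp add: u_def \<gamma>_def[symmetric] field_simps)
    ultimately show "\<theta> < u / 4" by simp
  qed
  obtain B \<Lambda> where \<phi>: "lipschitz_bounded B \<Lambda> \<phi>" using C1_lipschitz_bounded[OF assms(3)] .
  obtain C0 where C0: "loss_bound \<alpha> C0" using loss_bound_exists[OF a] .
  define M where "M = moment_const l (2 * B) (2 * B) (C0 * ((4 * B + 3 * \<Lambda>) * (2 / (1 - \<alpha>))))"
  \<comment> \<open>The 1 serves small \<epsilon>, where the right-hand side must reach 1; the other
    entry serves \<epsilon> <= B, where \<epsilon>^(\<kappa>-d) <= B^(\<kappa>-d).\<close>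
  define C where "C = max 1 (\<bar>M\<bar> * B powr (of_int \<kappa> - d))"
  have C1: "1 \<le> C" "\<bar>M\<bar> * B powr (of_int \<kappa> - d) \<le> C" by (auto simp: C_def)
  have bound: "measure leb {x\<in>{0..1}. \<bar>\<Sum>j=1..n. \<phi> (orbit \<omega> j x)\<bar> > 4 * real n * \<epsilon>}
        \<le> C * real n powr (1 - 1 / \<alpha>) * ln (real n) powr (1 / \<alpha>) * \<epsilon> powi (- \<kappa>)"
    if \<omega>: "\<And>i. \<omega> i \<in> {0<..\<alpha>}" and n: "3 \<le> n" and \<epsilon>: "0 < \<epsilon>"
      and mean: "\<bar>\<Sum>j=1..n. path_mean \<phi> (map \<omega> [0..<j])\<bar> \<le> real n powr (1 - \<theta>)" for \<omega> n \<epsilon>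
  proof -
    have n0: "0 < real n" using n by simp
    have "exp 1 \<le> (3 :: real)" by (rule exp_le)
    also have "\<dots> \<le> real n" using n by simp
    finally have lnn: "1 \<le> ln (real n)" using n by (subst ln_ge_iff) auto
    have powi: "\<epsilon> powi (- \<kappa>) = \<epsilon> powr - of_int \<kappa>" using \<epsilon> powr_real_of_int'[of \<epsilon> "- \<kappa>"] by simp
    \<comment> \<open>For \<epsilon> > B the event is empty. For \<epsilon> <= n^(-\<theta>) the
      right-hand side is at least 1, since \<theta>\<kappa> = \<gamma>. In between, the bound
      n^(1-\<theta>) on the means is below n\<epsilon>.\<close>
    consider "B < \<epsilon>" | "\<epsilon> \<le> real n powr - \<theta>" | "real n powr - \<theta> < \<epsilon>" "\<epsilon> \<le> B" by linarith
    then show ?thesis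
    proof cases
      case 1
      have pos: "set (map \<omega> xs) \<subseteq> {0<..}" for xs using \<omega> by auto
      have "\<bar>\<Sum>j=1..n. \<phi> (orbit \<omega> j x)\<bar> \<le> 4 * real n * \<epsilon>" if x: "x \<in> {0..1}" for x
      proof -
        have "\<bar>\<Sum>j=1..n. \<phi> (orbit \<omega> j x)\<bar> \<le> (\<Sum>j=1..n. B)"
          by (rule order_trans[OF sum_abs sum_mono])
            (simp only: orbit_fold lipschitz_boundedD(2)[OF \<phi> fold_intermittent_in[OF pos x]])
        also have "\<dots> \<le> real n * \<epsilon>" using 1 by (simp add: mult_left_mono)
        also have "\<dots> \<le> 4 * real n * \<epsilon>" using n0 \<epsilon> by simp
        finally show ?thesis .
      qed
      then have e: "{x\<in>{0..1}. \<bar>\<Sum>j=1..n. \<phi> (orbit \<omega> j x)\<bar> > 4 * real n * \<epsilon>} = {}" by force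
      show ?thesis unfolding e powi using C1 by simp
    next
      case 2
      have "1 = real n powr (1 - 1 / \<alpha>) * real n powr (\<theta> * of_int \<kappa>)"
        using n0 \<kappa>0 by (simp add: \<theta>_def powr_add[symmetric] \<gamma>_def)
      also have "real n powr (\<theta> * of_int \<kappa>) = (real n powr - \<theta>) powr - of_int \<kappa>" by (simp add: powr_powr)
      also have "real n powr (1 - 1 / \<alpha>) * \<dots> \<le> real n powr (1 - 1 / \<alpha>) * \<epsilon> powr - of_int \<kappa>"
        using 2 \<epsilon> \<kappa>0 by (intro mult_left_mono powr_mono2') auto
      finally have "1 \<le> real n powr (1 - 1 / \<alpha>) * \<epsilon> powr - of_int \<kappa>" .
      moreover have "1 \<le> ln (real n) powr (1 / \<alpha>)" using lnn a by (intro ge_one_powr_ge_zero) auto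
      ultimately have "1 * 1 * 1 \<le> C * ln (real n) powr (1 / \<alpha>) * (real n powr (1 - 1 / \<alpha>) * \<epsilon> powr - of_int \<kappa>)"
        using C1 by (intro mult_mono) auto
      then have "1 \<le> C * real n powr (1 - 1 / \<alpha>) * ln (real n) powr (1 / \<alpha>) * \<epsilon> powi (- \<kappa>)"
        unfolding powi by (simp add: mult_ac)
      then show ?thesis using order_trans[OF leb.prob_le_1] by blast
    next
      case 3
      have "real n powr (1 - \<theta>) = real n * real n powr - \<theta>" using powr_add[of "real n" 1 "- \<theta>"] n0 by simp
      also have "\<dots> \<le> real n * \<epsilon>" using 3 n0 by (intro mult_left_mono) auto
      finally have "\<bar>\<Sum>j=1..n. path_mean \<phi> (map \<omega> [0..<j])\<bar> \<le> real n * \<epsilon>" using mean by linarith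
      from centered_deviation[OF a C0 \<phi> \<omega> n l(1)[unfolded \<gamma>_def] \<epsilon> this]
      have "measure leb {x\<in>{0..1}. \<bar>\<Sum>j=1..n. \<phi> (orbit \<omega> j x)\<bar> > 4 * real n * \<epsilon>}
        \<le> M * real n powr (1 - 1 / \<alpha>) * ln (real n) powr (1 / \<alpha> - 1) * \<epsilon> powr - d"
        unfolding M_def d_def .
      also have "\<dots> \<le> \<bar>M\<bar> * real n powr (1 - 1 / \<alpha>) * ln (real n) powr (1 / \<alpha>) * (B powr (of_int \<kappa> - d) * \<epsilon> powr - of_int \<kappa>)"
      proof (intro mult_mono order_refl)
        have "\<epsilon> powr - d = \<epsilon> powr (of_int \<kappa> - d) * \<epsilon> powr - of_int \<kappa>" by (simp add: powr_add[symmetric])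
        also have "\<dots> \<le> B powr (of_int \<kappa> - d) * \<epsilon> powr - of_int \<kappa>"
          using 3 \<epsilon> \<kappa>d by (intro mult_right_mono powr_mono2) auto
        finally show "\<epsilon> powr - d \<le> B powr (of_int \<kappa> - d) * \<epsilon> powr - of_int \<kappa>" .
        show "ln (real n) powr (1 / \<alpha> - 1) \<le> ln (real n) powr (1 / \<alpha>)" using lnn by (intro powr_mono) auto
      qed auto
      also have "\<dots> = (\<bar>M\<bar> * B powr (of_int \<kappa> - d)) * (real n powr (1 - 1 / \<alpha>) * ln (real n) powr (1 / \<alpha>) * \<epsilon> powr - of_int \<kappa>)"
        by (simp add: mult_ac)
      also have "\<dots> \<le> C * (real n powr (1 - 1 / \<alpha>) * ln (real n) powr (1 / \<alpha>) * \<epsilon> powr - of_int \<kappa>)"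
        by (intro mult_right_mono C1) auto
      finally show ?thesis unfolding powi by (simp add: mult_ac)
    qed
  qed
  show ?thesis
  proof (intro exI[of _ C] allI impI)
    fix \<Omega> P \<mu>
    assume \<Omega>: "\<Omega> \<subseteq> {0<..<\<alpha>}" and P: "prob_weights \<Omega> P" and \<mu>: "ac_stationary \<Omega> P \<mu>" and zero: "(\<integral>x. \<phi> x \<partial>\<mu>) = 0"
    have \<Omega>': "\<Omega> \<subseteq> {0<..\<alpha>}" using \<Omega> by auto
    from path_mean_sum_small[OF a \<phi> \<Omega>' P \<mu> zero u_def \<theta>] AE_space
    show "AE \<omega> in sequence_measure \<Omega> P. \<exists>N::nat. \<forall>\<epsilon>>0. \<forall>n\<ge>N.
      measure unit_lebesgue {x\<in>{0..1}. \<bar>\<Sum>j=1..n. \<phi> (orbit \<omega> j x)\<bar> > 4 * real n * \<epsilon>}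
        \<le> C * real n powr (1 - 1 / \<alpha>) * ln (real n) powr (1 / \<alpha>) * \<epsilon> powi (- \<kappa>)"
    proof eventually_elim
      case (elim \<omega>)
      have \<omega>: "\<omega> i \<in> {0<..\<alpha>}" for i
        using elim(2) \<Omega>' by (auto simp: sequence_measure_def space_PiM space_point_measure dest!: PiE_mem[of _ _ _ i])
      obtain N where "\<forall>n\<ge>N. \<bar>\<Sum>j=1..n. path_mean \<phi> (map \<omega> [0..<j])\<bar> \<le> real n powr (1 - \<theta>)" using elim(1) by blast
      \<comment> \<open>The threshold comes from the fibrewise means alone, so it is fixed before
        \<epsilon>.\<close>
      then show ?case using bound[OF \<omega>] by (intro exI[of _ "max 3 N"]) auto
    qed
  qed
qed

end
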